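(* Let $G$ be a group acting on a mediangle graph $X$ and let $\mathcal{J}$ be a $G$-invariant collection of hyperplanes of $X$. Assume that, for every $J\in\mathcal{J}$, $\mathrm{stab}_\circlearrowright(J)$ permutes freely and transitively the sectors delimited by $J$. Then there exists a convex subgraph $Y\subset X$ such that $G$ decomposes as the semidirect product $\mathrm{Rot}\rtimes\mathrm{stab}(Y)$, where $\mathrm{Rot}:=\langle\mathrm{stab}_\circlearrowright(J)\mid J\in\mathcal{J}\rangle$ and $\mathrm{stab}(Y)$ is the stabiliser of $Y$ in $G$. Moreover, $\mathrm{Rot}$ is a periagroup with $\{\mathrm{stab}_\circlearrowright(J)\mid J\text{ a hyperplane tangent to }Y\}$ as a basis.
   Context: Graphs. All graphs are simplicial (no loops, no multiple edges). Subgraphs are identified with sets of vertices endowed with the induced adjacency relation; connected graphs are non-empty. $d$ denotes the graph distance and $I(x,y)=\{z \mid d(x,y)=d(x,z)+d(z,y)\}$. A subgraph $Y$ is convex if $I(x,y)\subset Y$ for all $x,y\in Y$. A convex cycle is a convex subgraph isomorphic to a cycle. A clique is a maximal complete subgraph. Group actions on graphs are by automorphisms. Mediangle graphs. A connected graph $X$ is mediangle if: (Triangle Condition) for all vertices $o,x,y$ with $d(o,x)=d(o,y)$ and $d(x,y)=1$, there is a common neighbour $z$ of $x,y$ with $z\in I(o,x)\cap I(o,y)$; (Intersection of Triangles) $X$ contains no induced copy of $K_4^-$ (the complete graph $K_4$ minus an edge); (Cycle Condition) for all vertices $o,x,y,z$ with $x\neq y$, $d(o,x)=d(o,y)=d(o,z)-1$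 and $d(x,z)=d(y,z)=1$, there is a convex cycle of even length containing the edges $[z,x],[z,y]$ such that the vertex opposite to $z$ in it belongs to $I(o,x)\cap I(o,y)$; (Intersection of Even Cycles) the intersection of any two distinct convex cycles of even lengths contains at most one edge. Hyperplanes. A hyperplane of $X$ is an equivalence class of edges with respect to the transitive closure of the relation that identifies two edges whenever they belong to a common $3$-cycle or are opposite in a convex cycle of even length. The sectors delimited by a hyperplane $J$ are the connected components of the graph obtained from $X$ by removing the edges in $J$. For a group $G$ acting on $X$, the rotative-stabiliser $\mathrm{stab}_\circlearrowright(J)$ is the intersection of the stabilisers in $G$ of all the cliques whose edges belong to $J$. A hyperplane $J$ is tangent to a subgraph $Y$ if some edge in $J$ has exactly one endpoint in $Y$. Periagroups. Let $\Gamma$ be a graph, $\lambda:E(\Gamma)\to\mathbb{N}_{\geq 2}$ a labelling, and $\mathcal{G}=\{G_u\mid u\in V(\Gamma)\}$ a collection of groups such that for every edge $\{u,v\}$, if $\lambda(u,v)>2$ then $G_u,G_v$ have order two. The periagroup $\Pi(\Gamma,\lambda,\mathcal{G})$ is the quotient of the free product of the $G_u$ by the relations $\langle a,b\rangle^{\lambda(u,v)}=\langle b,a\rangle^{\lambda(u,v)}$ for all $\{u,v\}\in E(\Gamma)$ and all non-trivial $a\in G_u$, $b\in G_v$, where $\langle a,b\rangle^k$ is the word formed by the first $k$ letters of $ababab\cdots$. Let $H$ be a group and $\mathcal{B}$ a collection of non-trivial subgroups of $H$. Let $\Gamma$ be the graph with vertex-set $\mathcal{B}$ in which two distinct $A,B\in\mathcal{B}$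 are adjacent whenever the canonical map $A\ast B\to\langle A,B\rangle$ is not an isomorphism. $H$ is a periagroup with $\mathcal{B}$ as a basis if there is a labelling $\lambda:E(\Gamma)\to\mathbb{N}_{\geq2}$ (as required in the definition of a periagroup) such that the identity map $\mathcal{B}\to\mathcal{B}$ extends to an isomorphism $\Pi(\Gamma,\lambda,\mathcal{B})\to H$. *)

theory Defs
  imports "HOL-Algebra.Group_Action" "HOL-Algebra.Generated_Groups"
begin

section \<open>Simplicial graphs\<close>

text \<open>
  Edges are unordered pairs.  Subgraphs are sets of vertices, read with the induced adjacency
  relation; in particular cycles and cliques below are sets of vertices.
\<close>

record 'v sgraph =
  verts :: "'v set"
  edges :: "'v set set"

definition simple_graph :: "'v sgraph \<Rightarrow> bool" where
  "simple_graph X \<longleftrightarrow> edges X \<subseteq> {{x, y} | x y. x \<in> verts X \<and> y \<in> verts X \<and> x \<noteq> y}"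

definition adj :: "'v sgraph \<Rightarrow> ('v \<times> 'v) set" where
  "adj X = {(x, y). {x, y} \<in> edges X}"

definition connected_graph :: "'v sgraph \<Rightarrow> bool" where
  "connected_graph X \<longleftrightarrow> verts X \<noteq> {} \<and> (\<forall>x\<in>verts X. \<forall>y\<in>verts X. (x, y) \<in> (adj X)\<^sup>*)"

text \<open>Only meaningful for vertices that are joined by a path.\<close>
definition gdist :: "'v sgraph \<Rightarrow> 'v \<Rightarrow> 'v \<Rightarrow> nat" where
  "gdist X x y = (LEAST n. (x, y) \<in> adj X ^^ n)"

definition ival :: "'v sgraph \<Rightarrow> 'v \<Rightarrow> 'v \<Rightarrow> 'v set" where
  "ival X x y = {z \<in> verts X. gdist X x y = gdist X x z + gdist X z y}"

definition induced :: "'v sgraph \<Rightarrow> 'v set \<Rightarrow> 'v sgraph" where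
  "induced X C = \<lparr>verts = C, edges = {e \<in> edges X. e \<subseteq> C}\<rparr>"

definition convex_subgraph :: "'v sgraph \<Rightarrow> 'v set \<Rightarrow> bool" where
  "convex_subgraph X Y \<longleftrightarrow> Y \<subseteq> verts X \<and> (\<forall>x\<in>Y. \<forall>y\<in>Y. ival X x y \<subseteq> Y)"

definition graph_iso :: "('v \<Rightarrow> 'w) \<Rightarrow> 'v sgraph \<Rightarrow> 'w sgraph \<Rightarrow> bool" where
  "graph_iso f X Y \<longleftrightarrow> bij_betw f (verts X) (verts Y) \<and>
     (\<forall>x\<in>verts X. \<forall>y\<in>verts X. {x, y} \<in> edges X \<longleftrightarrow> {f x, f y} \<in> edges Y)"

text \<open>The cycle on \<open>n \<ge> 3\<close> vertices, and the complete graph on four vertices minus an edge.\<close>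
definition cycle_graph :: "nat \<Rightarrow> nat sgraph" where
  "cycle_graph n = \<lparr>verts = {..<n}, edges = {{i, Suc i mod n} | i. i < n}\<rparr>"

definition K4_minus :: "nat sgraph" where
  "K4_minus = \<lparr>verts = {..<4}, edges = {{i, j} | i j. i < 4 \<and> j < 4 \<and> i \<noteq> j} - {{2, 3}}\<rparr>"

text \<open>The map \<open>c\<close> is a cyclic enumeration of the cycle \<open>C\<close>, of length \<open>n\<close>.\<close>
definition cycle_param :: "'v sgraph \<Rightarrow> nat \<Rightarrow> (nat \<Rightarrow> 'v) \<Rightarrow> 'v set \<Rightarrow> bool" where
  "cycle_param X n c C \<longleftrightarrow> 3 \<le> n \<and> C \<subseteq> verts X \<and> graph_iso c (cycle_graph n) (induced X C)"

definition even_convex_cycle :: "'v sgraph \<Rightarrow> 'v set \<Rightarrow> bool" where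
  "even_convex_cycle X C \<longleftrightarrow> convex_subgraph X C \<and> (\<exists>n c. even n \<and> cycle_param X n c C)"

definition opposite_vertices :: "'v sgraph \<Rightarrow> 'v set \<Rightarrow> 'v \<Rightarrow> 'v \<Rightarrow> bool" where
  "opposite_vertices X C x y \<longleftrightarrow> (\<exists>n c i. even n \<and> cycle_param X n c C \<and> i < n \<and>
     x = c i \<and> y = c ((i + n div 2) mod n))"

definition opposite_edges :: "'v sgraph \<Rightarrow> 'v set \<Rightarrow> 'v set \<Rightarrow> 'v set \<Rightarrow> bool" where
  "opposite_edges X C e f \<longleftrightarrow> (\<exists>n c i. even n \<and> cycle_param X n c C \<and> i < n \<and>
     e = {c i, c (Suc i mod n)} \<and>
     f = {c ((i + n div 2) mod n), c (Suc (i + n div 2) mod n)})"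

definition clique :: "'v sgraph \<Rightarrow> 'v set \<Rightarrow> bool" where
  "clique X C \<longleftrightarrow>
     (let complete = (\<lambda>D. D \<subseteq> verts X \<and> (\<forall>x\<in>D. \<forall>y\<in>D. x \<noteq> y \<longrightarrow> {x, y} \<in> edges X))
      in complete C \<and> (\<forall>D. complete D \<and> C \<subseteq> D \<longrightarrow> D = C))"

definition connected_components :: "'v sgraph \<Rightarrow> 'v set set" where
  "connected_components X = verts X // (adj X)\<^sup>*"


section \<open>Mediangle graphs and their hyperplanes\<close>

definition triangle_condition :: "'v sgraph \<Rightarrow> bool" where
  "triangle_condition X \<longleftrightarrow>
     (\<forall>p\<in>verts X. \<forall>x\<in>verts X. \<forall>y\<in>verts X.
        gdist X p x = gdist X p y \<and> gdist X x y = 1 \<longrightarrow>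
        (\<exists>z. {x, z} \<in> edges X \<and> {y, z} \<in> edges X \<and> z \<in> ival X p x \<inter> ival X p y))"

definition intersection_of_triangles :: "'v sgraph \<Rightarrow> bool" where
  "intersection_of_triangles X \<longleftrightarrow>
     \<not> (\<exists>C f. C \<subseteq> verts X \<and> graph_iso f K4_minus (induced X C))"

definition cycle_condition :: "'v sgraph \<Rightarrow> bool" where
  "cycle_condition X \<longleftrightarrow>
     (\<forall>p\<in>verts X. \<forall>x\<in>verts X. \<forall>y\<in>verts X. \<forall>z\<in>verts X.
        x \<noteq> y \<and> gdist X p x = gdist X p y \<and> gdist X p z = gdist X p x + 1 \<and>
        gdist X x z = 1 \<and> gdist X y z = 1 \<longrightarrow>
        (\<exists>C w. even_convex_cycle X C \<and> {z, x} \<in> edges (induced X C) \<and>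
           {z, y} \<in> edges (induced X C) \<and> opposite_vertices X C z w \<and>
           w \<in> ival X p x \<inter> ival X p y))"

definition intersection_of_even_cycles :: "'v sgraph \<Rightarrow> bool" where
  "intersection_of_even_cycles X \<longleftrightarrow>
     (\<forall>C D. even_convex_cycle X C \<and> even_convex_cycle X D \<and> C \<noteq> D \<longrightarrow>
        (\<forall>e\<in>edges (induced X (C \<inter> D)). \<forall>f\<in>edges (induced X (C \<inter> D)). e = f))"

definition mediangle :: "'v sgraph \<Rightarrow> bool" where
  "mediangle X \<longleftrightarrow> simple_graph X \<and> connected_graph X \<and> triangle_condition X \<and>
     intersection_of_triangles X \<and> cycle_condition X \<and> intersection_of_even_cycles X"

definition edge_rel :: "'v sgraph \<Rightarrow> ('v set \<times> 'v set) set" where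
  "edge_rel X = {(e, f).
     (\<exists>C c. cycle_param X 3 c C \<and> e \<in> edges (induced X C) \<and> f \<in> edges (induced X C)) \<or>
     (\<exists>C. even_convex_cycle X C \<and> opposite_edges X C e f)}"

text \<open>
  The relation \<open>edge_rel\<close> is symmetric, but it is reflexive only at edges of triangles; the
  reflexive closure makes an edge that is related to no other one a hyperplane by itself.
\<close>
definition hyperplanes :: "'v sgraph \<Rightarrow> 'v set set set" where
  "hyperplanes X = edges X // (edge_rel X)\<^sup>*"

definition sectors :: "'v sgraph \<Rightarrow> 'v set set \<Rightarrow> 'v set set" where
  "sectors X J = connected_components (X\<lparr>edges := edges X - J\<rparr>)"

definition tangent :: "'v set set \<Rightarrow> 'v set \<Rightarrow> bool" where
  "tangent J Y \<longleftrightarrow> (\<exists>x y. {x, y} \<in> J \<and> x \<in> Y \<and> y \<notin> Y)"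


section \<open>Groups acting on graphs\<close>

definition graph_action :: "('g, 'm) monoid_scheme \<Rightarrow> 'v sgraph \<Rightarrow> ('g \<Rightarrow> 'v \<Rightarrow> 'v) \<Rightarrow> bool" where
  "graph_action G X \<phi> \<longleftrightarrow> group_action G (verts X) \<phi> \<and> (\<forall>g\<in>carrier G. graph_iso (\<phi> g) X X)"

definition set_stab ::
    "('g, 'm) monoid_scheme \<Rightarrow> ('g \<Rightarrow> 'v \<Rightarrow> 'v) \<Rightarrow> 'v set \<Rightarrow> 'g set" where
  "set_stab G \<phi> Y = stabilizer G (\<lambda>g. image (\<phi> g)) Y"

definition rot_stab ::
    "('g, 'm) monoid_scheme \<Rightarrow> 'v sgraph \<Rightarrow> ('g \<Rightarrow> 'v \<Rightarrow> 'v) \<Rightarrow> 'v set set \<Rightarrow> 'g set" where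
  "rot_stab G X \<phi> J =
     carrier G \<inter> (\<Inter>C\<in>{C. clique X C \<and> edges (induced X C) \<subseteq> J}. set_stab G \<phi> C)"

definition free_action :: "('g, 'm) monoid_scheme \<Rightarrow> 's set \<Rightarrow> ('g \<Rightarrow> 's \<Rightarrow> 's) \<Rightarrow> bool" where
  "free_action G S \<phi> \<longleftrightarrow> (\<forall>s\<in>S. stabilizer G \<phi> s = {\<one>\<^bsub>G\<^esub>})"

text \<open>
  The restriction is needed because the library's actions take values in extensional functions.
\<close>
definition permutes_sectors_freely_transitively ::
    "('g, 'm) monoid_scheme \<Rightarrow> 'v sgraph \<Rightarrow> ('g \<Rightarrow> 'v \<Rightarrow> 'v) \<Rightarrow> 'v set set \<Rightarrow> bool" where
  "permutes_sectors_freely_transitively G X \<phi> J \<longleftrightarrow>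
     (let R = G\<lparr>carrier := rot_stab G X \<phi> J\<rparr>;
          \<sigma> = (\<lambda>g. restrict (image (\<phi> g)) (sectors X J))
      in transitive_action R (sectors X J) \<sigma> \<and> free_action R (sectors X J) \<sigma>)"

definition invariant_collection ::
    "('g, 'm) monoid_scheme \<Rightarrow> ('g \<Rightarrow> 'v \<Rightarrow> 'v) \<Rightarrow> 'v set set set \<Rightarrow> bool" where
  "invariant_collection G \<phi> \<J> \<longleftrightarrow> (\<forall>g\<in>carrier G. \<forall>J\<in>\<J>. image (\<phi> g) ` J \<in> \<J>)"

definition internal_semidirect :: "('g, 'm) monoid_scheme \<Rightarrow> 'g set \<Rightarrow> 'g set \<Rightarrow> bool" where
  "internal_semidirect G N K \<longleftrightarrow>
     N \<lhd> G \<and> subgroup K G \<and> N \<inter> K = {\<one>\<^bsub>G\<^esub>} \<and> N <#>\<^bsub>G\<^esub> K = carrier G"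


section \<open>Free products\<close>

text \<open>
  The free product of the groups \<open>\<G> u\<close> with \<open>u \<in> I\<close>: words in the disjoint union of the
  groups, modulo deleting trivial letters and multiplying adjacent letters of the same group.
\<close>

definition fp_words :: "'i set \<Rightarrow> ('i \<Rightarrow> ('g, 'm) monoid_scheme) \<Rightarrow> ('i \<times> 'g) list set" where
  "fp_words I \<G> = lists (SIGMA u:I. carrier (\<G> u))"

definition fp_step ::
    "'i set \<Rightarrow> ('i \<Rightarrow> ('g, 'm) monoid_scheme) \<Rightarrow> (('i \<times> 'g) list \<times> ('i \<times> 'g) list) set" where
  "fp_step I \<G> =
     {(p @ [(u, \<one>\<^bsub>\<G> u\<^esub>)] @ q, p @ q) | p q u.
        p \<in> fp_words I \<G> \<and> q \<in> fp_words I \<G> \<and> u \<in> I} \<union>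
     {(p @ [(u, a), (u, b)] @ q, p @ [(u, a \<otimes>\<^bsub>\<G> u\<^esub> b)] @ q) | p q u a b.
        p \<in> fp_words I \<G> \<and> q \<in> fp_words I \<G> \<and> u \<in> I \<and> a \<in> carrier (\<G> u) \<and> b \<in> carrier (\<G> u)}"

definition fp_eq ::
    "'i set \<Rightarrow> ('i \<Rightarrow> ('g, 'm) monoid_scheme) \<Rightarrow> (('i \<times> 'g) list \<times> ('i \<times> 'g) list) set" where
  "fp_eq I \<G> = (fp_step I \<G> \<union> (fp_step I \<G>)\<inverse>)\<^sup>*"

definition fp_class ::
    "'i set \<Rightarrow> ('i \<Rightarrow> ('g, 'm) monoid_scheme) \<Rightarrow> ('i \<times> 'g) list \<Rightarrow> ('i \<times> 'g) list set" where
  "fp_class I \<G> w = fp_eq I \<G> `` {w}"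

definition free_product ::
    "'i set \<Rightarrow> ('i \<Rightarrow> ('g, 'm) monoid_scheme) \<Rightarrow> ('i \<times> 'g) list set monoid" where
  "free_product I \<G> =
     \<lparr>carrier = fp_words I \<G> // fp_eq I \<G>,
      mult = (\<lambda>A B. \<Union>v\<in>A. \<Union>w\<in>B. fp_class I \<G> (v @ w)),
      one = fp_class I \<G> []\<rparr>"

text \<open>
  The map from a free product of subgroups of \<open>H\<close> to \<open>H\<close> extending the inclusions: it multiplies
  out the letters of any representative.
\<close>
definition fp_canonical ::
    "('h, 'm) monoid_scheme \<Rightarrow> ('i \<times> 'h) list set \<Rightarrow> 'h" where
  "fp_canonical H A = the_elem ((\<lambda>w. foldr (\<otimes>\<^bsub>H\<^esub>) (map snd w) \<one>\<^bsub>H\<^esub>) ` A)"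


section \<open>Periagroups\<close>

definition normal_closure :: "('g, 'm) monoid_scheme \<Rightarrow> 'g set \<Rightarrow> 'g set" where
  "normal_closure G R = \<Inter>{N. N \<lhd> G \<and> R \<subseteq> N}"

text \<open>The first \<open>k\<close> letters of the word \<open>ababab\<dots>\<close>.\<close>
fun alt_word :: "nat \<Rightarrow> 'a \<Rightarrow> 'a \<Rightarrow> 'a list" where
  "alt_word 0 a b = []"
| "alt_word (Suc k) a b = a # alt_word k b a"

definition periagroup_data ::
    "'u sgraph \<Rightarrow> ('u set \<Rightarrow> nat) \<Rightarrow> ('u \<Rightarrow> ('g, 'm) monoid_scheme) \<Rightarrow> bool" where
  "periagroup_data \<Gamma> lab \<G> \<longleftrightarrow>
     simple_graph \<Gamma> \<and> (\<forall>u\<in>verts \<Gamma>. group (\<G> u)) \<and> (\<forall>e\<in>edges \<Gamma>. 2 \<le> lab e) \<and>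
     (\<forall>u v. {u, v} \<in> edges \<Gamma> \<and> 2 < lab {u, v} \<longrightarrow> order (\<G> u) = 2 \<and> order (\<G> v) = 2)"

text \<open>The relation \<open>s = t\<close> is imposed by killing \<open>s t\<inverse>\<close>.\<close>
definition periagroup_relators ::
    "'u sgraph \<Rightarrow> ('u set \<Rightarrow> nat) \<Rightarrow> ('u \<Rightarrow> ('g, 'm) monoid_scheme) \<Rightarrow> ('u \<times> 'g) list set set" where
  "periagroup_relators \<Gamma> lab \<G> =
     (let F = free_product (verts \<Gamma>) \<G>; cl = fp_class (verts \<Gamma>) \<G>
      in {cl (alt_word (lab {u, v}) (u, a) (v, b)) \<otimes>\<^bsub>F\<^esub>
            inv\<^bsub>F\<^esub> (cl (alt_word (lab {u, v}) (v, b) (u, a))) | u v a b.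
          {u, v} \<in> edges \<Gamma> \<and> a \<in> carrier (\<G> u) - {\<one>\<^bsub>\<G> u\<^esub>} \<and> b \<in> carrier (\<G> v) - {\<one>\<^bsub>\<G> v\<^esub>}})"

definition periagroup ::
    "'u sgraph \<Rightarrow> ('u set \<Rightarrow> nat) \<Rightarrow> ('u \<Rightarrow> ('g, 'm) monoid_scheme) \<Rightarrow> ('u \<times> 'g) list set set monoid"
  where
  "periagroup \<Gamma> lab \<G> =
     (let F = free_product (verts \<Gamma>) \<G>
      in F Mod normal_closure F (periagroup_relators \<Gamma> lab \<G>))"

text \<open>The image in the periagroup of the element \<open>a\<close> of the vertex-group \<open>\<G> u\<close>.\<close>
definition periagroup_gen ::
    "'u sgraph \<Rightarrow> ('u set \<Rightarrow> nat) \<Rightarrow> ('u \<Rightarrow> ('g, 'm) monoid_scheme) \<Rightarrow> 'u \<Rightarrow> 'g \<Rightarrow>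
     ('u \<times> 'g) list set set" where
  "periagroup_gen \<Gamma> lab \<G> u a =
     (let F = free_product (verts \<Gamma>) \<G>
      in normal_closure F (periagroup_relators \<Gamma> lab \<G>) #>\<^bsub>F\<^esub> fp_class (verts \<Gamma>) \<G> [(u, a)])"

text \<open>The subgroup \<open>A\<close>, as a vertex, is labelled by itself, as a group.\<close>
abbreviation (input) sub_group :: "'h monoid \<Rightarrow> 'h set \<Rightarrow> 'h monoid" where
  "sub_group H A \<equiv> H\<lparr>carrier := A\<rparr>"

definition basis_graph :: "'h monoid \<Rightarrow> 'h set set \<Rightarrow> 'h set sgraph" where
  "basis_graph H \<B> =
     \<lparr>verts = \<B>,
      edges = {{A, B} | A B. A \<in> \<B> \<and> B \<in> \<B> \<and> A \<noteq> B \<and>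
        fp_canonical H \<notin>
          iso (free_product {A, B} (sub_group H)) (sub_group H (generate H (A \<union> B)))}\<rparr>"

definition periagroup_with_basis :: "'h monoid \<Rightarrow> 'h set set \<Rightarrow> bool" where
  "periagroup_with_basis H \<B> \<longleftrightarrow>
     group H \<and> (\<forall>B\<in>\<B>. subgroup B H \<and> B \<noteq> {\<one>\<^bsub>H\<^esub>}) \<and>
     (\<exists>lab \<psi>. periagroup_data (basis_graph H \<B>) lab (sub_group H) \<and>
        \<psi> \<in> iso (periagroup (basis_graph H \<B>) lab (sub_group H)) H \<and>
        (\<forall>B\<in>\<B>. \<forall>b\<in>B. \<psi> (periagroup_gen (basis_graph H \<B>) lab (sub_group H) B b) = b))"

end

theory Submission
  imports Defs
begin

text \<open>
  Each vertex has a unique nearest vertex in a given clique, so a clique partitions \<open>X\<close>; opposite edges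
  of a convex even cycle induce the same partition. Hence a hyperplane is the set of edges that cross such
  a partition, whose classes are its sectors, and they are convex.

  Take for \<open>Y\<close> a chamber, that is a class of vertices not separated by \<open>\<J>\<close>. Rotations carry a chamber to the
  adjacent ones, so \<open>Rot\<close> is transitive on chambers and is generated by the rotation groups \<open>R J\<close> of the
  hyperplanes tangent to \<open>Y\<close>. Two of these either play ping-pong and generate a free product, or their
  hyperplanes cross a common convex even cycle. If the cycle is a square the two groups commute; otherwise
  both have order two and generate a finite dihedral group, which preserves the cycle.

  Let \<open>P\<close> be the periagroup so defined. The translates of \<open>Y\<close> by \<open>P\<close>, glued like the chambers of \<open>X\<close>, form a
  covering of \<open>X\<close> to which triangles and convex even cycles lift as closed paths. The triangle and cycle
  conditions then show, by induction on the distance to a base point, that all geodesics from the base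
  point to a vertex have lifts with the same end. So the covering is trivial: \<open>P\<close> acts freely on
  the chambers, which yields both the presentation of \<open>Rot\<close> and the triviality of \<open>Rot \<inter> stab Y\<close>.
\<close>

section \<open>The metric of a mediangle graph\<close>

text \<open>Both conclusions come from one statement: an element of \<open>P\<close> whose image in
  \<open>G\<close> returns some vertex of \<open>Y\<close> to \<open>Y\<close> is trivial. For
  elements of the kernel it gives injectivity of the map from \<open>P\<close> to
  \<open>Rot\<close>; for elements above \<open>Rot \<inter> stab Y\<close> it gives triviality of
  that intersection. This is why the covering is indexed by \<open>P\<close> and not by
  \<open>Rot\<close>. The obstacle is to close the lift of a convex even cycle. Only some of its
  edges need belong to members of \<open>\<J>\<close>, and it may run inside \<open>Y\<close> for a
  while; what counts are the two edges at which it leaves and enters \<open>Y\<close>. If these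
  carry different rotations \<open>a\<close> and \<open>b\<close> and the cycle is longer than four,
  \<open>a b\<close> shifts the cycle, and a power of it that fixes the cycle must be trivial in
  \<open>G\<close>, hence in \<open>P\<close>. For this the labels are the least lengths of braid
  relations holding in \<open>G\<close>, not half the lengths of cycles. All this rests on the fact
  that no edge of a convex cycle of length at least six lies in a triangle: it makes rotations
  restrict to reflections of the cycle. Proving it is the hardest metric step.\<close>

locale mediangle_graph =
  fixes X :: "'v sgraph"
  assumes med: "mediangle X"
begin

abbreviation V where "V \<equiv> verts X"
abbreviation d where "d \<equiv> gdist X"
abbreviation nb (infix "\<sim>" 50) where "x \<sim> y \<equiv> {x, y} \<in> edges X"

lemma simple: "simple_graph X" and conn: "connected_graph X"
  and tri_cond: "triangle_condition X" and int_tri: "intersection_of_triangles X"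
  and cyc_cond: "cycle_condition X" and int_cyc: "intersection_of_even_cycles X"
  using med by (auto simp: mediangle_def)

lemma nb_sym: "x \<sim> y \<Longrightarrow> y \<sim> x"
  by (simp add: insert_commute)

lemma nb_V: assumes "x \<sim> y" shows "x \<in> V" "y \<in> V" "x \<noteq> y"
proof -
  obtain a b where "{x, y} = {a, b}" "a \<in> V" "b \<in> V" "a \<noteq> b"
    using assms simple unfolding simple_graph_def by blast
  then show "x \<in> V" "y \<in> V" "x \<noteq> y" by (auto simp: doubleton_eq_iff)
qed

lemma nb_irrefl: "\<not> v \<sim> v" "{v} \<notin> edges X"
  using nb_V(3)[of v v] by auto

lemma edgeE:
  assumes "e \<in> edges X"
  obtains x y where "e = {x, y}" "x \<sim> y"
  using assms simple unfolding simple_graph_def by blast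

lemma adj_pow_sym: "(x, y) \<in> adj X ^^ n \<Longrightarrow> (y, x) \<in> adj X ^^ n"
proof (induction n arbitrary: x y)
  case (Suc n)
  then obtain z where "(x, z) \<in> adj X ^^ n" "(z, y) \<in> adj X" by auto
  then have "(z, x) \<in> adj X ^^ n" "(y, z) \<in> adj X" using Suc.IH
    by (auto simp: adj_def insert_commute)
  then show ?case by (metis relpow_Suc_I2)
qed auto

lemma d_path: assumes "x \<in> V" "y \<in> V" shows "(x, y) \<in> adj X ^^ d x y"
proof -
  have "(x, y) \<in> (adj X)\<^sup>*" using conn assms by (auto simp: connected_graph_def)
  then obtain n where "(x, y) \<in> adj X ^^ n" by (auto simp: rtrancl_power)
  then show ?thesis unfolding gdist_def by (rule LeastI)
qed

lemma d_le: "(x, y) \<in> adj X ^^ n \<Longrightarrow> d x y \<le> n"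
  unfolding gdist_def by (rule Least_le)

lemma d_sym: "x \<in> V \<Longrightarrow> y \<in> V \<Longrightarrow> d x y = d y x"
  by (meson adj_pow_sym d_le d_path le_antisym)

lemma d_refl [simp]: "d x x = 0"
  using d_le[of x x 0] by simp

lemma d_eq_0: "x \<in> V \<Longrightarrow> y \<in> V \<Longrightarrow> d x y = 0 \<longleftrightarrow> x = y"
  using d_path[of x y] by auto

lemma d_triangle: "x \<in> V \<Longrightarrow> y \<in> V \<Longrightarrow> z \<in> V \<Longrightarrow> d x z \<le> d x y + d y z"
  using d_path[of x y] d_path[of y z] by (intro d_le) (auto simp: relpow_add)

lemma d_eq_1: "x \<in> V \<Longrightarrow> y \<in> V \<Longrightarrow> d x y = 1 \<longleftrightarrow> x \<sim> y"
proof
  assume "x \<in> V" "y \<in> V" "d x y = 1"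
  then show "x \<sim> y" using d_path[of x y] by (auto simp: adj_def)
next
  assume "x \<in> V" "y \<in> V" "x \<sim> y"
  then have "(x, y) \<in> adj X ^^ 1" by (simp add: adj_def)
  then have "d x y \<le> 1" by (rule d_le)
  moreover have "d x y \<noteq> 0" using d_eq_0 \<open>x \<in> V\<close> \<open>y \<in> V\<close> nb_V(3)[OF \<open>x \<sim> y\<close>] by auto
  ultimately show "d x y = 1" by linarith
qed

lemma d_nb: "x \<sim> y \<Longrightarrow> d x y = 1"
  using d_eq_1 nb_V by blast

lemma d_nb_le: "x \<sim> y \<Longrightarrow> v \<in> V \<Longrightarrow> d v x \<le> d v y + 1" "x \<sim> y \<Longrightarrow> v \<in> V \<Longrightarrow> d v y \<le> d v x + 1"
  using d_triangle[of v y x] d_triangle[of v x y] d_nb nb_V d_nb[of y x] nb_sym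
  by (metis)+

lemma d_step:
  assumes "x \<in> V" "y \<in> V" "x \<noteq> y"
  obtains z where "y \<sim> z" "d x y = d x z + 1" "z \<in> V"
proof -
  have "d x y \<noteq> 0" using assms d_eq_0 by auto
  then obtain n where n: "d x y = Suc n" using not0_implies_Suc by blast
  then have "(x, y) \<in> adj X ^^ Suc n" using d_path[of x y] assms by metis
  then obtain z where z: "(x, z) \<in> adj X ^^ n" "(z, y) \<in> adj X" by auto
  then have zy: "z \<sim> y" by (simp add: adj_def)
  have "d x z \<le> n" using z d_le by blast
  moreover have "d x y \<le> d x z + 1" using d_nb_le(2)[OF zy assms(1)] .
  ultimately have "d x z = n" using n by linarith
  then show thesis using that[of z] n nb_sym[OF zy] nb_V[OF zy] by simp
qed

lemma d_step_nb:
  assumes "x \<in> V" "y \<in> V" "d x y = Suc n"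
  obtains z where "y \<sim> z" "d x z = n" "z \<in> V"
  by (rule d_step[of x y]) (use assms in auto)

lemma ival_iff: "z \<in> ival X x y \<longleftrightarrow> z \<in> V \<and> d x y = d x z + d z y"
  by (auto simp: ival_def)

subsection \<open>The local conditions\<close>

lemma triangle_rule:
  assumes "p \<in> V" "x \<sim> y" "d p x = d p y"
  obtains z where "x \<sim> z" "y \<sim> z" "d p x = d p z + 1" "z \<in> V"
proof -
  have V: "x \<in> V" "y \<in> V" "d x y = 1" using nb_V d_nb assms by auto
  then obtain z where z: "x \<sim> z" "y \<sim> z" "z \<in> ival X p x"
    using tri_cond assms unfolding triangle_condition_def by blast
  moreover have "z \<in> V" "d z x = 1" using nb_V[OF z(1)] d_nb[OF nb_sym[OF z(1)]] by auto
  ultimately show thesis using that[of z] by (auto simp: ival_iff)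
qed

lemma K4_rule:
  assumes "x \<sim> y" "x \<sim> z" "y \<sim> z" "x \<sim> w" "y \<sim> w" "z \<noteq> w"
  shows "z \<sim> w"
proof (rule ccontr)
  assume n: "\<not> z \<sim> w"
  define f where "f = (\<lambda>i::nat. if i = 0 then x else if i = 1 then y else if i = 2 then z else w)"
  have ne: "x \<noteq> y" "x \<noteq> z" "x \<noteq> w" "y \<noteq> z" "y \<noteq> w" using nb_V assms by auto
  have s: "{x, z} = {z, x}" "{x, w} = {w, x}" "{y, z} = {z, y}" "{y, w} = {w, y}" "{x, y} = {y, x}"
    "{z, w} = {w, z}"
    by auto
  have lt: "{..<4::nat} = {0, 1, 2, 3}" by auto
  have "graph_iso f K4_minus (induced X {x, y, z, w})"
    unfolding graph_iso_def
  proof (intro conjI ballI)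
    show "bij_betw f (verts K4_minus) (verts (induced X {x, y, z, w}))"
      using ne assms(6) by (auto simp: K4_minus_def induced_def bij_betw_def inj_on_def f_def lt)
  next
    fix i j :: nat
    assume ij: "i \<in> verts K4_minus" "j \<in> verts K4_minus"
    have K: "{i, j} \<in> edges K4_minus \<longleftrightarrow> i \<noteq> j \<and> {i, j} \<noteq> {2, 3}"
      using ij by (auto simp: K4_minus_def doubleton_eq_iff)
    have I: "{f i, f j} \<in> edges (induced X {x, y, z, w}) \<longleftrightarrow> f i \<sim> f j"
      using ij by (auto simp: induced_def f_def K4_minus_def)
    have "i \<in> {0, 1, 2, 3}" "j \<in> {0, 1, 2, 3}" using ij lt by (auto simp: K4_minus_def)
    then show "{i, j} \<in> edges K4_minus \<longleftrightarrow> {f i, f j} \<in> edges (induced X {x, y, z, w})"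
      unfolding K I using assms ne n
      by (auto simp: f_def doubleton_eq_iff s nb_irrefl)
  qed
  moreover have "{x, y, z, w} \<subseteq> V" using assms nb_V by auto
  ultimately show False using int_tri unfolding intersection_of_triangles_def by blast
qed

subsection \<open>Convex even cycles\<close>

text \<open>Convex cycles of length \<open>2 k\<close>, with integer indices read modulo \<open>2 k\<close>; the vertex and the edge
  opposite to a given one are found at the index shifted by \<open>k\<close>.\<close>
definition ecyc :: "int \<Rightarrow> (int \<Rightarrow> 'v) \<Rightarrow> bool" where
  "ecyc k c \<longleftrightarrow> 2 \<le> k \<and> (\<forall>i j. c i = c j \<longleftrightarrow> 2 * k dvd i - j) \<and>
     (\<forall>i j. c i \<sim> c j \<longleftrightarrow> 2 * k dvd i - j - 1 \<or> 2 * k dvd i - j + 1) \<and> convex_subgraph X (range c)"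

lemma ecyc_k: "ecyc k c \<Longrightarrow> 2 \<le> k"
  and ecyc_eq: "ecyc k c \<Longrightarrow> c i = c j \<longleftrightarrow> 2 * k dvd i - j"
  and ecyc_nb_iff: "ecyc k c \<Longrightarrow> c i \<sim> c j \<longleftrightarrow> 2 * k dvd i - j - 1 \<or> 2 * k dvd i - j + 1"
  and ecyc_convex: "ecyc k c \<Longrightarrow> convex_subgraph X (range c)"
  by (auto simp: ecyc_def)

lemma ecyc_nb: "ecyc k c \<Longrightarrow> c i \<sim> c (i + 1)" "ecyc k c \<Longrightarrow> c (i + 1) \<sim> c i"
   "ecyc k c \<Longrightarrow> c i \<sim> c (i - 1)" "ecyc k c \<Longrightarrow> c (i - 1) \<sim> c i"
  by (auto simp: ecyc_nb_iff)

lemma ecyc_V: "ecyc k c \<Longrightarrow> c i \<in> V"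
  using ecyc_nb nb_V by blast

lemma ecyc_periodic: "ecyc k c \<Longrightarrow> c (i + 2 * k) = c i" "ecyc k c \<Longrightarrow> c (i - 2 * k) = c i"
  by (simp_all add: ecyc_eq)

lemma ecyc_shift: "ecyc k c \<Longrightarrow> ecyc k (\<lambda>i. c (i + s))"
proof -
  assume c: "ecyc k c"
  have "range (\<lambda>i. c (i + s)) = range c"
    by (auto simp: image_iff) (metis diff_add_cancel)
  then show ?thesis using c by (auto simp: ecyc_def)
qed

lemma ecyc_reflect: "ecyc k c \<Longrightarrow> ecyc k (\<lambda>i. c (- i))"
proof -
  assume c: "ecyc k c"
  have "range (\<lambda>i. c (- i)) = range c"
    by (auto simp: image_iff) (metis minus_minus)
  moreover have "2 * k dvd - i + j \<longleftrightarrow> 2 * k dvd i - j" for i j :: int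
    by (metis add.commute dvd_minus_iff minus_diff_eq uminus_add_conv_diff)
  moreover have "2 * k dvd - i + j - 1 \<longleftrightarrow> 2 * k dvd i - j + 1" for i j :: int
    using dvd_minus_iff[of "2*k" "i - j + 1"] by (simp add: algebra_simps)
  moreover have "2 * k dvd - i + j + 1 \<longleftrightarrow> 2 * k dvd i - j - 1" for i j :: int
    using dvd_minus_iff[of "2*k" "i - j - 1"] by (simp add: algebra_simps)
  ultimately show ?thesis using c by (auto simp: ecyc_def)
qed

lemma convexD:
  assumes "convex_subgraph X C" "x \<in> C" "y \<in> C" "z \<in> V" "d x y = d x z + d z y"
  shows "z \<in> C"
  using assms unfolding convex_subgraph_def ival_def by blast

text \<open>Convexity keeps a geodesic between two vertices of the cycle inside the cycle, so every
  step of it changes the index by one. This bounds distances in \<open>X\<close> from below by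
  distances along the cycle.\<close>

lemma ecyc_reach:
  assumes c: "ecyc k c"
  shows "d (c i) (c j) = l \<Longrightarrow> \<exists>m. \<bar>m\<bar> \<le> int l \<and> c j = c (i + m)"
proof (induction l arbitrary: j)
  case 0
  then have "c i = c j" using d_eq_0 ecyc_V[OF c] by blast
  then show ?case by (intro exI[of _ 0]) auto
next
  case (Suc l)
  then obtain z where z: "c j \<sim> z" "d (c i) z = l" "z \<in> V"
    using d_step_nb[of "c i" "c j" l] ecyc_V[OF c] by metis
  then have "z \<in> range c"
    using convexD[OF ecyc_convex[OF c], of "c i" "c j" z] Suc.prems d_nb[OF nb_sym[OF z(1)]] by auto
  then obtain j' where j': "z = c j'" by auto
  with Suc.IH z obtain m where m: "\<bar>m\<bar> \<le> int l" "z = c (i + m)" by metis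
  then have "c j \<sim> c (i + m)" using z by simp
  then have "2 * k dvd j - (i + m) - 1 \<or> 2 * k dvd j - (i + m) + 1" using ecyc_nb_iff[OF c] by simp
  then have "c j = c (i + (m + 1)) \<or> c j = c (i + (m - 1))"
    unfolding ecyc_eq[OF c] by (auto simp: algebra_simps)
  then show ?case using m(1) by (elim disjE) (rule exI, erule conjI[rotated], simp)+
qed

lemma ecyc_d_le:
  assumes c: "ecyc k c"
  shows "d (c i) (c (i + int j)) \<le> j"
proof (induction j)
  case (Suc j)
  have "c (i + int j) \<sim> c (i + int j + 1)" using ecyc_nb[OF c] by blast
  then show ?case using d_nb_le(2)[of "c (i + int j)" "c (i + int j + 1)" "c i"] Suc ecyc_V[OF c, of i]
    by (simp add: algebra_simps)
qed auto

text \<open>Walking along the cycle gives the upper bound. By \<open>ecyc_reach\<close>, a shorter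
  path would give an index congruent to \<open>j\<close> modulo \<open>2 * k\<close> of absolute
  value below \<open>j \<le> k\<close>, which does not exist.\<close>

lemma ecyc_d:
  assumes c: "ecyc k c" and j: "0 \<le> j" "j \<le> k"
  shows "int (d (c i) (c (i + j))) = j" "int (d (c i) (c (i - j))) = j"
proof -
  have *: "int (d (c i) (c (i + j))) = j" for i
  proof -
    have "int (d (c i) (c (i + j))) \<le> j" using ecyc_d_le[OF c, of i "nat j"] j by simp
    moreover obtain m where m: "\<bar>m\<bar> \<le> int (d (c i) (c (i + j)))" "c (i + j) = c (i + m)"
      using ecyc_reach[OF c] by blast
    then have dv: "2 * k dvd j - m" using ecyc_eq[OF c] by simp
    have "j \<le> \<bar>m\<bar>"
    proof (rule ccontr)
      assume "\<not> j \<le> \<bar>m\<bar>"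
      then have "0 < j - m" "j - m < 2 * k" using j by auto
      then show False using dv zdvd_not_zless by blast
    qed
    ultimately show ?thesis using m by linarith
  qed
  show "int (d (c i) (c (i + j))) = j" by (rule *)
  show "int (d (c i) (c (i - j))) = j" using *[of "i - j"] d_sym[of "c i" "c (i - j)"] ecyc_V[OF c]
    by simp
qed

text \<open>The definitions enumerate a cycle by \<open>{..<n}\<close>; reading indices modulo
  \<open>n\<close> extends this to all integers, where shifts and reflections need no case
  distinction. Evenness rules out \<open>n = 3\<close>, whence \<open>2 \<le> k\<close>.\<close>

lemma ecyc_of_param:
  assumes "even n" "cycle_param X n c0 C" "convex_subgraph X C"
  defines "c \<equiv> \<lambda>i::int. c0 (nat (i mod int n))"
  shows "ecyc (int n div 2) c" "range c = C" "i < n \<Longrightarrow> c (int i) = c0 i"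
proof -
  have n: "n \<ge> 3" "C \<subseteq> V" "bij_betw c0 {..<n} C"
    and E: "\<And>i j. i < n \<Longrightarrow> j < n \<Longrightarrow>
      {i, j} \<in> {{i, Suc i mod n} | i. i < n} \<longleftrightarrow> {c0 i, c0 j} \<in> edges X \<and> {c0 i, c0 j} \<subseteq> C"
    using assms(2) by (auto simp: cycle_param_def graph_iso_def cycle_graph_def induced_def)
  have n4: "int n \<ge> 4" using n assms(1) by (cases "n = 3") auto
  have inC: "c0 i \<in> C" if "i < n" for i using n(3) that by (auto simp: bij_betw_def)
  have lt: "nat (i mod int n) < n" for i using n4 by (simp add: nat_less_iff)
  have n2: "2 * (int n div 2) = int n" using assms(1) by auto
  show R: "range c = C"
  proof
    show "range c \<subseteq> C" using inC lt by (auto simp: c_def)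
    show "C \<subseteq> range c"
    proof
      fix x assume "x \<in> C"
      then obtain i where "i < n" "x = c0 i" using n(3) by (auto simp: bij_betw_def)
      then have "x = c (int i)" by (simp add: c_def)
      then show "x \<in> range c" by simp
    qed
  qed
  have eq: "c i = c j \<longleftrightarrow> int n dvd i - j" for i j
  proof -
    have "c i = c j \<longleftrightarrow> nat (i mod int n) = nat (j mod int n)"
      using n(3) lt[of i] lt[of j] unfolding c_def by (metis bij_betw_def inj_on_eq_iff lessThan_iff)
    also have "\<dots> \<longleftrightarrow> i mod int n = j mod int n" using n4 by (simp add: eq_nat_nat_iff)
    also have "\<dots> \<longleftrightarrow> int n dvd i - j" by (rule mod_eq_dvd_iff)
    finally show ?thesis .
  qed
  have suc: "Suc a mod n = nat ((int a + 1) mod int n)" for a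
    by (metis nat_int of_nat_Suc of_nat_mod add.commute)
  have nb: "c i \<sim> c j \<longleftrightarrow> int n dvd i - j - 1 \<or> int n dvd i - j + 1" for i j
  proof -
    define a b where "a = nat (i mod int n)" and "b = nat (j mod int n)"
    have ab: "a < n" "b < n" "int a = i mod int n" "int b = j mod int n"
      using lt n4 by (auto simp: a_def b_def)
    have S: "b = Suc a mod n \<longleftrightarrow> int n dvd i - j + 1"
     and S': "a = Suc b mod n \<longleftrightarrow> int n dvd i - j - 1"
    proof -
      have "b = Suc a mod n \<longleftrightarrow> int b = (int a + 1) mod int n"
        unfolding suc using n4 ab(4) by (metis nat_int pos_mod_sign int_nat_eq of_nat_0_less_iff n(1) not_numeral_le_zero gr0I)
      also have "\<dots> \<longleftrightarrow> j mod int n = (i + 1) mod int n" unfolding ab by (simp add: mod_simps)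
      also have "\<dots> \<longleftrightarrow> (i + 1) mod int n = j mod int n" by metis
      also have "\<dots> \<longleftrightarrow> int n dvd i - j + 1" by (simp add: mod_eq_dvd_iff algebra_simps)
      finally show "b = Suc a mod n \<longleftrightarrow> int n dvd i - j + 1" .
      have "a = Suc b mod n \<longleftrightarrow> int a = (int b + 1) mod int n"
        unfolding suc using n4 ab(3) by (metis nat_int pos_mod_sign int_nat_eq of_nat_0_less_iff n(1) not_numeral_le_zero gr0I)
      also have "\<dots> \<longleftrightarrow> i mod int n = (j + 1) mod int n" unfolding ab by (simp add: mod_simps)
      also have "\<dots> \<longleftrightarrow> int n dvd i - j - 1" by (simp add: mod_eq_dvd_iff algebra_simps)
      finally show "a = Suc b mod n \<longleftrightarrow> int n dvd i - j - 1" .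
    qed
    have "c i \<sim> c j \<longleftrightarrow> {a, b} \<in> {{i, Suc i mod n} | i. i < n}"
      using E[OF ab(1,2)] inC ab by (simp add: c_def a_def b_def)
    also have "\<dots> \<longleftrightarrow> b = Suc a mod n \<or> a = Suc b mod n"
      using ab by (auto simp: doubleton_eq_iff)
    finally show ?thesis unfolding S S' by blast
  qed
  show "ecyc (int n div 2) c"
    unfolding ecyc_def n2 using n4 eq nb assms(3) R by auto
  show "i < n \<Longrightarrow> c (int i) = c0 i" by (simp add: c_def)
qed

lemma param_of_ecyc:
  assumes c: "ecyc k c"
  shows "even (nat (2 * k))" "cycle_param X (nat (2 * k)) (\<lambda>i. c (int i)) (range c)"
    "even_convex_cycle X (range c)"
proof -
  define n where "n = nat (2 * k)"
  have n: "int n = 2 * k" "n \<ge> 4" using ecyc_k[OF c] by (auto simp: n_def)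
  show ev: "even (nat (2 * k))" using n unfolding n_def by (simp add: even_nat_iff)
  have eq: "c i = c j \<longleftrightarrow> int n dvd i - j"
    and nb: "c i \<sim> c j \<longleftrightarrow> int n dvd i - j - 1 \<or> int n dvd i - j + 1" for i j
    using c n by (auto simp: ecyc_def)
  have small: "int n dvd int i - int j + m \<longleftrightarrow> int j = (int i + m) mod int n" if "i < n" "j < n" for i j m
  proof -
    have "int n dvd int i - int j + m \<longleftrightarrow> (int i + m) mod int n = int j mod int n"
      by (simp add: mod_eq_dvd_iff algebra_simps)
    then show ?thesis using that by auto
  qed
  show "cycle_param X (nat (2 * k)) (\<lambda>i. c (int i)) (range c)"
    unfolding cycle_param_def graph_iso_def n_def[symmetric]
  proof (intro conjI ballI)
    show "3 \<le> n" "range c \<subseteq> V" using n ecyc_V[OF c] by auto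
    have "inj_on (\<lambda>i. c (int i)) {..<n}"
    proof (rule inj_onI)
      fix i j assume ij: "i \<in> {..<n}" "j \<in> {..<n}" "c (int i) = c (int j)"
      then have "int n dvd int i - int j + 0" using eq by simp
      then show "i = j" using small[of i j 0] ij by auto
    qed
    moreover have "(\<lambda>i. c (int i)) ` {..<n} = range c"
    proof safe
      fix i :: int
      have "c i = c (int (nat (i mod int n)))" using n eq by (simp add: mod_eq_dvd_iff[symmetric])
      moreover have "nat (i mod int n) < n" using n by (simp add: nat_less_iff)
      ultimately show "c i \<in> (\<lambda>i. c (int i)) ` {..<n}" by blast
    qed auto
    ultimately show "bij_betw (\<lambda>i. c (int i)) (verts (cycle_graph n)) (verts (induced X (range c)))"
      by (auto simp: bij_betw_def cycle_graph_def induced_def)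
  next
    fix i j assume "i \<in> verts (cycle_graph n)" "j \<in> verts (cycle_graph n)"
    then have ij: "i < n" "j < n" by (auto simp: cycle_graph_def)
    have suc: "int (Suc a mod n) = (int a + 1) mod int n" for a
      by (simp add: of_nat_mod add.commute)
    have "{i, j} \<in> edges (cycle_graph n) \<longleftrightarrow> j = Suc i mod n \<or> i = Suc j mod n"
      using ij by (auto simp: doubleton_eq_iff cycle_graph_def)
    also have "\<dots> \<longleftrightarrow> int j = (int i + 1) mod int n \<or> int i = (int j + 1) mod int n"
      by (metis suc of_nat_eq_iff)
    also have "\<dots> \<longleftrightarrow> int n dvd int i - int j + 1 \<or> int n dvd int j - int i + 1"
      using small[OF ij, of 1] small[OF ij(2,1), of 1] by simp
    also have "int n dvd int j - int i + 1 \<longleftrightarrow> int n dvd int i - int j - 1"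
      using dvd_minus_iff[of "int n" "int j - int i + 1"] by (simp add: algebra_simps)
    finally show "{i, j} \<in> edges (cycle_graph n) \<longleftrightarrow>
       {c (int i), c (int j)} \<in> edges (induced X (range c))"
      using nb by (auto simp: induced_def)
  qed
  then show "even_convex_cycle X (range c)"
    unfolding even_convex_cycle_def using ev ecyc_convex[OF c] by blast
qed

lemma ecyc_same:
  assumes "ecyc k c" "ecyc l c'" "e \<in> edges X" "f \<in> edges X" "e \<noteq> f"
    "e \<subseteq> range c" "f \<subseteq> range c" "e \<subseteq> range c'" "f \<subseteq> range c'"
  shows "range c = range c'"
proof (rule ccontr)
  assume "range c \<noteq> range c'"
  moreover have "e \<in> edges (induced X (range c \<inter> range c'))" "f \<in> edges (induced X (range c \<inter> range c'))"
    using assms by (auto simp: induced_def)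
  ultimately show False
    using int_cyc param_of_ecyc(3)[OF assms(1)] param_of_ecyc(3)[OF assms(2)] assms(5)
    unfolding intersection_of_even_cycles_def by blast
qed

text \<open>The cycle condition in normal form: the enumeration is shifted so that the vertex
  opposite to \<open>z\<close> gets index 0, and reversed if necessary so that \<open>x\<close>
  comes just before \<open>z\<close>.\<close>

lemma cycle_rule:
  assumes "p \<in> V" "x \<sim> z" "y \<sim> z" "x \<noteq> y" "d p x = d p y" "d p z = d p x + 1"
  obtains k c where "ecyc k c" "c k = z" "c (k - 1) = x" "c (k + 1) = y"
    "c 0 \<in> ival X p x" "c 0 \<in> ival X p y"
proof -
  have "x \<in> V" "y \<in> V" "z \<in> V" "d x z = 1" "d y z = 1" using assms nb_V d_nb by auto
  then obtain C w where C: "even_convex_cycle X C" "{z, x} \<in> edges (induced X C)"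
     "{z, y} \<in> edges (induced X C)" "opposite_vertices X C z w" "w \<in> ival X p x" "w \<in> ival X p y"
    using cyc_cond assms unfolding cycle_condition_def by (metis IntE)
  from C(4) obtain n c0 i where n: "even n" "cycle_param X n c0 C" "i < n" "z = c0 i"
      "w = c0 ((i + n div 2) mod n)" unfolding opposite_vertices_def by blast
  have cv: "convex_subgraph X C" using C(1) by (auto simp: even_convex_cycle_def)
  define k c where "k = int n div 2" and "c = (\<lambda>i::int. c0 (nat (i mod int n)))"
  have c: "ecyc k c" "range c = C" using ecyc_of_param[OF n(1,2) cv] by (simp_all add: c_def k_def)
  have zi: "z = c (int i)" using n(3,4) by (simp add: c_def)
  have "int ((i + n div 2) mod n) = (int i + k) mod int n"
    by (simp add: of_nat_mod k_def zdiv_int)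
  then have wi: "w = c (int i + k)" using n(5) by (metis c_def nat_int)
  have xC: "x \<in> range c" "y \<in> range c" "z \<sim> x" "z \<sim> y"
    using C(2,3) c(2) by (auto simp: induced_def)
  have nbz: "u = c (int i + 1) \<or> u = c (int i - 1)" if u: "u \<in> range c" "z \<sim> u" for u
  proof -
    obtain j where j: "u = c j" using u by auto
    then have "2 * k dvd int i - j - 1 \<or> 2 * k dvd int i - j + 1"
      using u zi ecyc_nb_iff[OF c(1)] by simp
    then have "c (int i - 1) = c j \<or> c (int i + 1) = c j"
      unfolding ecyc_eq[OF c(1)] by (simp add: algebra_simps)
    then show ?thesis using j by auto
  qed
  have p: "c (int i + k + k + j) = c (int i + j)" "c (int i + k - k + j) = c (int i + j)" for j
    using ecyc_periodic(1)[OF c(1), of "int i + j"] by (simp_all add: algebra_simps)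
  show thesis
  proof (cases "x = c (int i - 1)")
    case True
    then have y: "y = c (int i + 1)" using nbz[OF xC(2,4)] assms(4) by blast
    define c' where "c' = (\<lambda>j. c (j + (int i + k)))"
    have "ecyc k c'" unfolding c'_def by (rule ecyc_shift[OF c(1)])
    moreover have "c' k = z" "c' (k - 1) = x" "c' (k + 1) = y" "c' 0 = w"
      using p(1)[of 0] p(1)[of 1] p(1)[of "-1"] zi True y wi
      by (simp_all add: c'_def algebra_simps)
    ultimately show thesis using that C by blast
  next
    case False
    then have x: "x = c (int i + 1)" using nbz[OF xC(1,3)] by blast
    have y: "y = c (int i - 1)" using nbz[OF xC(2,4)] assms(4) x by blast
    define c' where "c' = (\<lambda>j. c (- j + (int i + k)))"
    have "ecyc k c'" unfolding c'_def using ecyc_reflect[OF ecyc_shift[OF c(1), of "int i + k"]] by simp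
    moreover have "c' k = z" "c' (k - 1) = x" "c' (k + 1) = y" "c' 0 = w"
      using zi x y wi by (simp_all add: c'_def algebra_simps)
    ultimately show thesis using that C by blast
  qed
qed

text \<open>The distance to \<open>p\<close> rises by \<open>k\<close> over the \<open>k\<close>
  edges of either half starting at \<open>c 0\<close>, so it rises by one on each of them: the
  triangle inequality is sharp throughout.\<close>

lemma cycle_levels:
  assumes c: "ecyc k c" and p: "p \<in> V" and top: "int (d p (c k)) = int (d p (c 0)) + k"
   and j: "0 \<le> j" "j \<le> k"
  shows "int (d p (c j)) = int (d p (c 0)) + j" "int (d p (c (- j))) = int (d p (c 0)) + j"
proof -
  note V = ecyc_V[OF c]
  have k: "c (- k) = c k" using ecyc_periodic(1)[OF c, of "-k"] by simp
  have "int (d p (c j)) \<le> int (d p (c 0)) + j"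
    using d_triangle[OF p V V, of j 0] ecyc_d(1)[OF c j, of 0] by simp
  moreover have "int (d p (c k)) \<le> int (d p (c j)) + (k - j)"
    using d_triangle[OF p V V, of k j] ecyc_d(1)[OF c, of "k - j" j] j by simp
  ultimately show "int (d p (c j)) = int (d p (c 0)) + j" using top by linarith
  have "int (d p (c (- j))) \<le> int (d p (c 0)) + j"
    using d_triangle[OF p V V, of "-j" 0] ecyc_d(2)[OF c j, of 0] by simp
  moreover have "int (d p (c k)) \<le> int (d p (c (-j))) + (k - j)"
    using d_triangle[OF p V V, of "-k" "-j"] ecyc_d(2)[OF c, of "k - j" "-j"] j k by simp
  ultimately show "int (d p (c (-j))) = int (d p (c 0)) + j" using top by linarith
qed

lemma not_nb:
  assumes "x \<sim> y" "x \<sim> z" "y \<noteq> z" "\<not> y \<sim> z" shows "d y z = 2"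
proof -
  have V: "x \<in> V" "y \<in> V" "z \<in> V" using nb_V assms by auto
  have "d y z \<le> d y x + d x z" using d_triangle V by blast
  also have "\<dots> = 2" using d_nb assms nb_sym by simp
  finally have "d y z \<le> 2" .
  moreover have "d y z \<noteq> 0" "d y z \<noteq> 1" using V assms d_eq_0 d_eq_1 by auto
  ultimately show ?thesis by linarith
qed

text \<open>The cycle condition based at \<open>x\<close> applies because \<open>d x z = 2\<close>.
  The vertex opposite to \<open>z\<close> lies on geodesics from \<open>x\<close> to each of its
  neighbours \<open>y\<close> and \<open>w\<close>, hence is \<open>x\<close>, and the convex cycle
  is the square.\<close>

lemma square_convex:
  assumes "x \<sim> y" "y \<sim> z" "z \<sim> w" "w \<sim> x" "x \<noteq> z" "y \<noteq> w" "\<not> x \<sim> z" "\<not> y \<sim> w"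
  obtains c where "ecyc 2 c" "c 0 = x" "c 1 = y" "c 2 = z" "c 3 = w"
proof -
  have V: "x \<in> V" "y \<in> V" "z \<in> V" "w \<in> V" using nb_V assms by auto
  have "d x z = 2" using not_nb[of y x z] assms nb_sym by blast
  moreover have "d x y = 1" "d x w = 1" using d_nb assms nb_sym by auto
  ultimately obtain k c where c: "ecyc k c" "c k = z" "c (k - 1) = y" "c (k + 1) = w"
    "c 0 \<in> ival X x y" "c 0 \<in> ival X x w"
    using cycle_rule[of x y z w] assms V nb_sym[OF assms(3)] by auto
  have V0: "c 0 \<in> V" using ecyc_V[OF c(1)] .
  have s: "d x (c 0) + d (c 0) y = 1" "d x (c 0) + d (c 0) w = 1" using c(5,6)
    \<open>d x y = 1\<close> \<open>d x w = 1\<close> by (auto simp: ival_iff)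
  have "d x (c 0) = 0"
  proof (rule ccontr)
    assume "d x (c 0) \<noteq> 0"
    then have "d (c 0) y = 0" "d (c 0) w = 0" using s by auto
    then show False using d_eq_0 V V0 assms(6) by blast
  qed
  then have x: "c 0 = x" using d_eq_0 V V0 by auto
  have "int (d (c 0) (c k)) = k" using ecyc_d(1)[OF c(1), of k 0] ecyc_k[OF c(1)] by simp
  then have k: "k = 2" using \<open>d x z = 2\<close> x c(2) by simp
  show thesis using that[of c] c x k by simp
qed

subsection \<open>Cliques\<close>

text \<open>Meant for adjacent \<open>x\<close> and \<open>y\<close>. Without an induced
  \<open>K4_minus\<close>, the common neighbours of the two ends are adjacent to one another, so
  this is the one clique through the edge.\<close>

definition ecl :: "'v \<Rightarrow> 'v \<Rightarrow> 'v set" where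
  "ecl x y = {z. z = x \<or> z = y \<or> (z \<sim> x \<and> z \<sim> y)}"

lemma ecl_self: "x \<in> ecl x y" "y \<in> ecl x y"
  by (auto simp: ecl_def)

lemma ecl_sym: "ecl x y = ecl y x"
  by (auto simp: ecl_def)

lemma ecl_nb: assumes "x \<sim> y" "u \<in> ecl x y" "v \<in> ecl x y" "u \<noteq> v" shows "u \<sim> v"
  using assms K4_rule[of x y u v] unfolding ecl_def by (auto dest: nb_sym)

lemma ecl_V: "x \<sim> y \<Longrightarrow> u \<in> ecl x y \<Longrightarrow> u \<in> V"
  using nb_V[of x y] nb_V[of u x] by (auto simp: ecl_def)

lemma ecl_absorb:
  assumes "x \<sim> y" "u \<in> ecl x y" "v \<in> ecl x y" "u \<noteq> v" "w \<sim> u" "w \<sim> v"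
  shows "w \<in> ecl x y"
proof (cases "w = x \<or> w = y")
  case False
  have uv: "u \<sim> v" using ecl_nb assms by blast
  have *: "w \<sim> t" if "t \<in> ecl x y" "t \<noteq> w" for t
  proof (cases "t = u \<or> t = v")
    case False
    then show ?thesis using K4_rule[of u v w t] uv assms that ecl_nb[OF assms(1)] nb_sym by metis
  qed (use assms in auto)
  show ?thesis using *[of x] *[of y] False by (auto simp: ecl_def)
qed (auto simp: ecl_self)

lemma ecl_eq:
  assumes "x \<sim> y" "u \<in> ecl x y" "v \<in> ecl x y" "u \<noteq> v"
  shows "ecl u v = ecl x y"
proof
  show "ecl u v \<subseteq> ecl x y" using ecl_absorb[OF assms] assms by (auto simp: ecl_def)
  show "ecl x y \<subseteq> ecl u v"
  proof
    fix w assume "w \<in> ecl x y"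
    then show "w \<in> ecl u v" using ecl_nb[OF assms(1)] assms unfolding ecl_def[of u v] by blast
  qed
qed

section \<open>Gates: nearest vertices in a clique\<close>

definition gate :: "'v set \<Rightarrow> 'v \<Rightarrow> 'v \<Rightarrow> bool" where
  "gate K v p \<longleftrightarrow> p \<in> K \<and> (\<forall>q\<in>K. q \<noteq> p \<longrightarrow> d v q = d v p + 1)"

lemma gate_unique: "gate K v p \<Longrightarrow> gate K v q \<Longrightarrow> p = q"
  unfolding gate_def by (metis add_cancel_right_right add.assoc one_neq_zero add_eq_0_iff_both_eq_0)

text \<open>A second vertex of the clique at minimal distance from \<open>v\<close> would, by the
  triangle condition, have with the first one a common neighbour nearer to \<open>v\<close>. Being
  adjacent to two vertices of the clique, that neighbour belongs to it, against minimality.\<close>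

lemma gate_ex:
  assumes xy: "x \<sim> y" and v: "v \<in> V"
  shows "\<exists>p. gate (ecl x y) v p"
proof -
  define p where "p = arg_min (d v) (\<lambda>q. q \<in> ecl x y)"
  have p: "p \<in> ecl x y" "\<And>q. q \<in> ecl x y \<Longrightarrow> d v p \<le> d v q"
    using arg_min_nat_lemma[of "\<lambda>q. q \<in> ecl x y" x "d v"] ecl_self(1) by (auto simp: p_def)
  have "d v q = d v p + 1" if q: "q \<in> ecl x y" "q \<noteq> p" for q
  proof -
    have pq: "p \<sim> q" using ecl_nb[OF xy p(1) q(1)] q by auto
    have "d v q \<noteq> d v p"
    proof
      assume "d v q = d v p"
      then obtain z where "p \<sim> z" "q \<sim> z" "d v p = d v z + 1"
        using triangle_rule[OF v pq] by metis
      then have "z \<in> ecl x y" using ecl_absorb[OF xy p(1) q(1)] q by (metis nb_sym)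
      then show False using p(2) \<open>d v p = d v z + 1\<close> by fastforce
    qed
    then show ?thesis using p(2)[OF q(1)] d_nb_le(2)[OF pq v] by linarith
  qed
  then show ?thesis using p(1) by (auto simp: gate_def)
qed

lemma gate_self: assumes "x \<sim> y" "p \<in> ecl x y" shows "gate (ecl x y) p p"
  using assms ecl_nb d_nb by (auto simp: gate_def)

definition same :: "'v set \<Rightarrow> 'v \<Rightarrow> 'v \<Rightarrow> bool" where
  "same K v w \<longleftrightarrow> (\<exists>p. gate K v p \<and> gate K w p)"

text \<open>The cliques through opposite edges of a square form a prism: adjacency is a matching
  between them. A vertex \<open>s\<close> other than \<open>p\<close> and \<open>q\<close> is at
  distance two from \<open>p'\<close> and \<open>q'\<close>, and the triangle condition supplies its
  partner; two partners would force \<open>s\<close> into the second clique by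
  \<open>ecl_absorb\<close>.\<close>

lemma prism:
  assumes sq: "p \<sim> q" "q \<sim> q'" "q' \<sim> p'" "p' \<sim> p" "\<not> p \<sim> q'" "\<not> q \<sim> p'" "p \<noteq> q'" "q \<noteq> p'"
    and s: "s \<in> ecl p q"
  shows "\<exists>!t. t \<in> ecl p' q' \<and> s \<sim> t" and "s \<notin> ecl p' q'"
proof -
  have p'q': "p' \<sim> q'" using nb_sym[OF sq(3)] .
  have V: "p \<in> V" "q \<in> V" "q' \<in> V" "p' \<in> V" "s \<in> V" using nb_V sq ecl_V[OF sq(1) s] by auto
  have pq': "d p q' = 2" "d q p' = 2"
    using not_nb[of q p q'] not_nb[of p q p'] sq nb_sym by metis+
  show nin: "s \<notin> ecl p' q'"
  proof
    assume A: "s \<in> ecl p' q'"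
    then have "s = p \<or> s = q \<or> s \<sim> p \<and> s \<sim> q" "s = p' \<or> s = q' \<or> s \<sim> p' \<and> s \<sim> q'"
      using s by (auto simp: ecl_def)
    then show False using sq K4_rule[of s p q p'] nb_irrefl nb_sym
      by (metis)
  qed
  have ex: "\<exists>t. t \<in> ecl p' q' \<and> s \<sim> t"
  proof -
    consider "s = p" | "s = q" | "s \<sim> p" "s \<sim> q" using s by (auto simp: ecl_def)
    then show ?thesis
    proof cases
      case 3
      have n: "\<not> s \<sim> p'" "\<not> s \<sim> q'" "s \<noteq> p'" "s \<noteq> q'"
        using K4_rule[of s p q p'] K4_rule[of s q p q'] 3 sq nb_sym by metis+
      have "d s p' = 2" "d s q' = 2" using not_nb[of p s p'] not_nb[of q s q'] 3 sq n nb_sym by metis+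
      then obtain t where t: "p' \<sim> t" "q' \<sim> t" "2 = d s t + 1" "t \<in> V"
        using triangle_rule[OF V(5) p'q'] by metis
      then have "s \<sim> t" using d_eq_1[of s t] V by auto
      then show ?thesis using t nb_sym by (auto simp: ecl_def)
    qed (use sq nb_sym in \<open>auto simp: ecl_self intro: exI[of _ p'] exI[of _ q']\<close>)
  qed
  moreover have "t = t'" if "t \<in> ecl p' q'" "s \<sim> t" "t' \<in> ecl p' q'" "s \<sim> t'" for t t'
    using ecl_absorb[OF p'q' that(1,3)] that nin by blast
  ultimately show "\<exists>!t. t \<in> ecl p' q' \<and> s \<sim> t" by blast
qed

text \<open>The cycle given by the cycle condition shares two edges with the square, hence is the square.\<close>
lemma square_top:
  assumes sq: "a \<sim> b" "b \<sim> e" "e \<sim> f" "f \<sim> a" "a \<noteq> e" "b \<noteq> f" "\<not> a \<sim> e" "\<not> b \<sim> f"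
    and v: "v \<in> V" and eq: "d v a = d v e" "d v b = d v a + 1"
  shows "d v a = d v f + 1"
proof -
  obtain k c where c: "ecyc k c" "c k = b" "c (k - 1) = a" "c (k + 1) = e" "c 0 \<in> ival X v a"
    using cycle_rule[OF v, of a b e] eq sq nb_sym[OF sq(2)] by metis
  obtain c' where c': "ecyc 2 c'" "c' 0 = a" "c' 1 = b" "c' 2 = e" "c' 3 = f"
    using square_convex[OF sq] .
  have mem: "{a, b, e} \<subseteq> range c" "{a, b, e} \<subseteq> range c'"
    using c c' by (metis insert_subset empty_subsetI rangeI)+
  have "range c = range c'"
    by (rule ecyc_same[OF c(1) c'(1), of "{a, b}" "{b, e}"])
      (use mem sq in \<open>auto simp: doubleton_eq_iff\<close>)
  then obtain i where i: "c 0 = c' i" by (metis rangeE rangeI)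
  have "i mod 4 \<in> {0, 1, 2, 3}" by auto
  moreover have "c 0 = c' (i mod 4)"
    using ecyc_eq[OF c'(1)] i by (simp add: mod_eq_dvd_iff[symmetric])
  ultimately have "c 0 \<in> {a, b, e, f}" using c' by auto
  moreover have "c 0 \<noteq> a" "c 0 \<noteq> b" "c 0 \<noteq> e"
    using ecyc_eq[OF c(1), of "k - 1" 0] ecyc_eq[OF c(1), of "k + 1" 0] ecyc_eq[OF c(1), of k 0]
      ecyc_k[OF c(1)] c(2-4) zdvd_not_zless[of "k - 1" "2 * k"] zdvd_not_zless[of "k + 1" "2 * k"]
      zdvd_not_zless[of k "2 * k"] by auto
  ultimately have "f \<in> ival X v a" using c(5) by auto
  then show ?thesis using d_nb[OF sq(4)] by (simp add: ival_iff)
qed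

text \<open>A mismatch of gates would give a square whose distances to \<open>v\<close> have two opposite local maxima,
  against the cycle condition.\<close>
lemma square_gates:
  assumes sq: "p \<sim> q" "q \<sim> q'" "q' \<sim> p'" "p' \<sim> p" "\<not> p \<sim> q'" "\<not> q \<sim> p'" "p \<noteq> q'" "q \<noteq> p'"
    and v: "v \<in> V" and s: "gate (ecl p q) v s" and t: "gate (ecl p' q') v t"
  shows "s \<sim> t"
proof (rule ccontr)
  assume st: "\<not> s \<sim> t"
  have p'q': "p' \<sim> q'" using nb_sym[OF sq(3)] .
  have sq': "p' \<sim> q'" "q' \<sim> q" "q \<sim> p" "p \<sim> p'" "\<not> p' \<sim> q" "\<not> q' \<sim> p" "p' \<noteq> q" "q' \<noteq> p"
    using sq nb_sym by metis+
  have sK: "s \<in> ecl p q" and tK: "t \<in> ecl p' q'" using s t by (auto simp: gate_def)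
  obtain s' where s': "s' \<in> ecl p' q'" "s \<sim> s'" using prism(1)[OF sq sK] by blast
  obtain t' where t': "t' \<in> ecl p q" "t \<sim> t'" using prism(1)[OF sq' tK] by blast
  have ne: "s \<noteq> t'" "s' \<noteq> t" using st s' t' nb_sym by metis+
  have n: "\<not> s' \<sim> t'" "s' \<noteq> t'"
    using prism(1)[OF sq' s'(1)] s' t' sK ne nb_sym prism(2)[OF sq' s'(1)] by metis+
  have nst: "s \<noteq> t" using prism(2)[OF sq sK] tK by blast
  have e: "s \<sim> t'" "s' \<sim> t" using ecl_nb[OF sq(1) sK t'(1) ne(1)] ecl_nb[OF p'q' s'(1) tK ne(2)] .
  have ds: "d v t' = d v s + 1" "d v s' = d v t + 1"
    using s t t' s' ne by (auto simp: gate_def)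
  have "d v s' \<le> d v s + 1" "d v t' \<le> d v t + 1"
    using d_nb_le(2)[OF s'(2) v] d_nb_le(2)[OF t'(2) v] .
  then have eq: "d v s = d v t" using ds by linarith
  have "d v s = d v s' + 1"
    by (rule square_top[of s t' t s']) (use e s' t' n nst st v eq ds nb_sym in metis)+
  then show False using ds eq by auto
qed

text \<open>By \<open>square_gates\<close> the matching of \<open>prism\<close> sends the gate in
  one clique to the gate in the other, so two vertices share the first gate exactly if they share
  the second.\<close>

lemma square_same:
  assumes sq: "p \<sim> q" "q \<sim> q'" "q' \<sim> p'" "p' \<sim> p" "\<not> p \<sim> q'" "\<not> q \<sim> p'" "p \<noteq> q'" "q \<noteq> p'"
    and v: "v \<in> V" "w \<in> V"
  shows "same (ecl p q) v w \<longleftrightarrow> same (ecl p' q') v w"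
proof -
  have sq': "p' \<sim> q'" "q' \<sim> q" "q \<sim> p" "p \<sim> p'" "\<not> p' \<sim> q" "\<not> q' \<sim> p" "p' \<noteq> q" "q' \<noteq> p"
    using sq nb_sym by metis+
  obtain s t s' t' where g: "gate (ecl p q) v s" "gate (ecl p q) w t" "gate (ecl p' q') v s'" "gate (ecl p' q') w t'"
    using gate_ex sq(1) sq'(1) v by metis
  have a: "s \<sim> s'" "t \<sim> t'" using square_gates[OF sq v(1)] square_gates[OF sq v(2)] g by auto
  have "s = t \<longleftrightarrow> s' = t'"
    using prism(1)[OF sq, of s] prism(1)[OF sq', of s'] g a nb_sym unfolding gate_def by metis
  moreover have "same (ecl p q) v w \<longleftrightarrow> s = t" "same (ecl p' q') v w \<longleftrightarrow> s' = t'"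
    using g gate_unique unfolding same_def by blast+
  ultimately show ?thesis by blast
qed

subsection \<open>Long convex cycles\<close>

lemma not_dvd_small: "\<lbrakk>2 * k dvd m; \<bar>m\<bar> < 2 * k; m \<noteq> 0\<rbrakk> \<Longrightarrow> False" for k m :: int
  using dvd_imp_le_int[of m "2 * k"] by linarith

lemma ecyc_ne: "ecyc k c \<Longrightarrow> \<bar>i - j\<bar> < 2 * k \<Longrightarrow> i \<noteq> j \<Longrightarrow> c i \<noteq> c j"
  using not_dvd_small[of k "i - j"] by (auto simp: ecyc_eq)

lemma ecyc_not_nb: "ecyc k c \<Longrightarrow> 1 < \<bar>i - j\<bar> \<Longrightarrow> \<bar>i - j\<bar> < 2 * k - 1 \<Longrightarrow> \<not> c i \<sim> c j"
  by (smt (verit) ecyc_nb_iff not_dvd_small)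

lemma ecyc_nbE:
  assumes "ecyc k c" "x \<in> range c" "c i \<sim> x"
  shows "x = c (i + 1) \<or> x = c (i - 1)"
proof -
  obtain j where j: "x = c j" using assms by auto
  then have "2 * k dvd i - j - 1 \<or> 2 * k dvd i - j + 1" using assms ecyc_nb_iff by blast
  then have "c (i - 1) = c j \<or> c (i + 1) = c j"
    unfolding ecyc_eq[OF assms(1)] by (simp add: algebra_simps)
  then show ?thesis using j by auto
qed

text \<open>Here begins the proof that an edge of a convex cycle of length at least six lies in no
  triangle; \<open>z\<close> is the hypothetical third vertex. If \<open>z\<close> were on the
  cycle, two vertices of index difference two would be adjacent.\<close>

lemma long_apex_outside:
  assumes c: "ecyc k c" "3 \<le> k" and z: "z \<sim> c i" "z \<sim> c (i + 1)"
  shows "z \<notin> range c"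
proof
  assume "z \<in> range c"
  then have "z = c (i - 1)"
    using ecyc_nbE[OF c(1) _ nb_sym[OF z(1)]] z(2) nb_irrefl by auto
  then have "c (i - 1) \<sim> c (i + 1)" using z by simp
  then show False using ecyc_not_nb[OF c(1), of "i - 1" "i + 1"] c(2) by auto
qed

lemma long_apex_not_nb:
  assumes c: "ecyc k c" "3 \<le> k" and z: "z \<sim> c 0" "z \<sim> c 1"
  shows "\<not> z \<sim> c 2"
proof
  assume "z \<sim> c 2"
  moreover have "c 1 \<sim> c 2" "c 1 \<sim> c 0" "c 0 \<noteq> c 2"
    using ecyc_nb(1)[OF c(1), of 1] ecyc_nb(2)[OF c(1), of 0] ecyc_ne[OF c(1), of 0 2] c(2) by auto
  ultimately have "c 0 \<sim> c 2" using K4_rule[of z "c 1" "c 0" "c 2"] z by blast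
  then show False using ecyc_not_nb[OF c(1), of 0 2] c(2) by auto
qed

text \<open>The distance is \<open>k\<close> or \<open>k - 1\<close>. In the second case the
  triangle condition gives a common neighbour of \<open>z\<close> and \<open>c 1\<close> on a
  geodesic from \<open>c k\<close> to \<open>c 1\<close>, hence on the cycle; but \<open>c 2\<close>
  is not adjacent to \<open>z\<close>, and \<open>c 0\<close> is too far from
  \<open>c k\<close>.\<close>

lemma long_apex_d:
  assumes c: "ecyc k c" "3 \<le> k" and z: "z \<sim> c 0" "z \<sim> c 1"
  shows "int (d (c k) z) = k"
proof -
  note V = ecyc_V[OF c(1)]
  have d0: "int (d (c k) (c 0)) = k" and d1: "int (d (c k) (c 1)) = k - 1"
    using ecyc_d(2)[OF c(1), of k k] ecyc_d(2)[OF c(1), of "k - 1" k] c(2) by auto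
  have "d (c k) z \<noteq> d (c k) (c 1)"
  proof
    assume "d (c k) z = d (c k) (c 1)"
    then obtain t where t: "z \<sim> t" "c 1 \<sim> t" "d (c k) z = d (c k) t + 1" "t \<in> V"
      using triangle_rule[OF V z(2)] by metis
    have "d (c k) (c 1) = d (c k) t + d t (c 1)"
      using t d_nb[OF nb_sym[OF t(2)]] \<open>d (c k) z = d (c k) (c 1)\<close> by simp
    then have "t \<in> range c" using convexD[OF ecyc_convex[OF c(1)], of "c k" "c 1" t] t by auto
    then have "t = c (1 + 1) \<or> t = c (1 - 1)" using ecyc_nbE[OF c(1) _ t(2)] by blast
    then show False
    proof
      assume "t = c (1 + 1)"
      then show False using long_apex_not_nb[OF c z] t by simp
    next
      assume "t = c (1 - 1)"
      then show False using d0 d1 \<open>d (c k) (c 1) = d (c k) t + d t (c 1)\<close> by simp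
    qed
  qed
  moreover have "d (c k) z \<le> d (c k) (c 1) + 1" "d (c k) (c 0) \<le> d (c k) z + 1"
    using d_nb_le[OF z(1) V, of k] d_nb_le[OF z(2) V, of k] by auto
  ultimately show ?thesis using d0 d1 by linarith
qed

text \<open>A hypothetical triangle on one edge spreads to a square on the next: \<open>z\<close> is
  equally far from both ends of the opposite edge, so the triangle condition applies there, and a
  step \<open>u\<close> from \<open>z\<close> towards the vertex found is level with
  \<open>c 1\<close> as seen from \<open>c k\<close>. The cycle condition at \<open>z\<close> then
  gives a cycle, which must be a square through \<open>c 2\<close>.\<close>

lemma long_apex_square:
  assumes c: "ecyc k c" "3 \<le> k" and z: "z \<sim> c 0" "z \<sim> c 1"
  obtains u where "z \<sim> u" "u \<sim> c 2" "u \<noteq> c 1" "\<not> u \<sim> c 1"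
proof -
  note V = ecyc_V[OF c(1)]
  have zV: "z \<in> V" using nb_V z by blast
  \<comment> \<open>The same edge read backwards: \<open>r\<close> exchanges \<open>c 0\<close> and
    \<open>c 1\<close>, so \<open>z\<close> is also at distance \<open>k\<close> from
    \<open>r k\<close>, which is \<open>c (k + 1)\<close>.\<close>
  define r where "r = (\<lambda>i. c (1 - i))"
  have r: "ecyc k r" using ecyc_reflect[OF ecyc_shift[OF c(1), of 1]] by (simp add: r_def)
  have z0: "int (d (c k) z) = k" by (rule long_apex_d[OF c z])
  have "int (d (r k) z) = k" by (rule long_apex_d[OF r c(2)]) (use z in \<open>simp_all add: r_def\<close>)
  moreover have "r k = c (k + 1)" using ecyc_periodic(1)[OF c(1), of "1 - k"] by (simp add: r_def)
  ultimately have "d z (c k) = d z (c (k + 1))" using z0 d_sym[OF zV V] by (metis of_nat_eq_iff)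
  then obtain z' where z': "c k \<sim> z'" "c (k + 1) \<sim> z'" "d z (c k) = d z z' + 1" "z' \<in> V"
    using triangle_rule[OF zV ecyc_nb(1)[OF c(1)]] by metis
  have dzz': "int (d z z') = k - 1" using z'(3) z0 d_sym[OF zV V, of k] by simp
  have "z' \<noteq> z" using dzz' c(2) by auto
  \<comment> \<open>The first vertex on a geodesic from \<open>z\<close> to \<open>z'\<close>,
    candidate for the fourth vertex of the square.\<close>
  then obtain u where u: "z \<sim> u" "d z' z = d z' u + 1" "u \<in> V"
    using d_step[OF z'(4) zV] by metis
  have dz'u: "int (d z' u) = k - 2" using u(2) dzz' d_sym[OF zV z'(4)] by simp
  have "int (d (c k) u) = k - 1"
  proof -
    have "d (c k) u \<le> 1 + d z' u" using d_triangle[OF V z'(4) u(3), of k] d_nb[OF z'(1)] by simp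
    then show ?thesis using dz'u z0 d_nb_le(1)[OF u(1) V, of k] by linarith
  qed
  moreover have d1: "int (d (c k) (c 1)) = k - 1"
    using ecyc_d(2)[OF c(1), of "k - 1" k] c(2) by auto
  moreover have "u \<noteq> c 1"
  proof
    assume "u = c 1"
    then have "int (d z' (c 1)) = k - 2" using dz'u by simp
    then have "d (c k) (c 1) = d (c k) z' + d z' (c 1)" using d1 d_nb[OF z'(1)] by linarith
    then have "z' \<in> range c" using convexD[OF ecyc_convex[OF c(1)], of "c k" "c 1" z'] z' by auto
    then show False using long_apex_outside[OF c, of z' k] z' nb_sym by blast
  qed
  ultimately have eqs: "d (c k) (c 1) = d (c k) u" "d (c k) z = d (c k) (c 1) + 1" "u \<noteq> c 1"
    using z0 by linarith+
  obtain l c' where c': "ecyc l c'" "c' l = z" "c' (l - 1) = c 1" "c' (l + 1) = u"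
    "c' 0 \<in> ival X (c k) (c 1)"
    using cycle_rule[OF V nb_sym[OF z(2)] nb_sym[OF u(1)] eqs(3)[symmetric] eqs(1,2)] by metis
  have znot: "z \<notin> range c" using long_apex_outside[OF c, of z 0] z by simp
  have c0: "c' 0 \<in> range c"
    using convexD[OF ecyc_convex[OF c(1)], of "c k" "c 1" "c' 0"] c'(5) by (auto simp: ival_iff)
  \<comment> \<open>One descending half of the new cycle is a geodesic from \<open>c 1\<close> to a
    vertex of the old cycle, so convexity puts it on the old cycle. If \<open>l \<ge> 3\<close> it
    contains two edges, and the two cycles coincide although \<open>z\<close> lies on only one of
    them.\<close>
  have in_c: "c' j \<in> range c" if "0 \<le> j" "j \<le> l - 1" for j
  proof -
    have "int (d (c' 0) (c' (l - 1))) = l - 1" "int (d (c' 0) (c' j)) = j" "int (d (c' j) (c' (l - 1))) = l - 1 - j"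
      using ecyc_d(1)[OF c'(1), of "l - 1" 0] ecyc_d(1)[OF c'(1), of j 0]
        ecyc_d(1)[OF c'(1), of "l - 1 - j" j] that by auto
    then show ?thesis using convexD[OF ecyc_convex[OF c(1)] c0, of "c 1" "c' j"] ecyc_V[OF c'(1)] c'(3)
      by simp
  qed
  have l: "l = 2"
  proof (rule ccontr)
    assume "l \<noteq> 2"
    then have l3: "l \<ge> 3" using ecyc_k[OF c'(1)] by simp
    have "range c' = range c"
      by (rule ecyc_same[OF c'(1) c(1), of "{c' (l - 3), c' (l - 3 + 1)}" "{c' (l - 2), c' (l - 2 + 1)}"])
       (use ecyc_nb(1)[OF c'(1), of "l - 3"] ecyc_nb(1)[OF c'(1), of "l - 2"] in_c l3 ecyc_ne[OF c'(1), of "l - 3" "l - 2"] ecyc_ne[OF c'(1), of "l - 3" "l - 1"]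
          in \<open>auto simp: doubleton_eq_iff\<close>)
    then show False using c'(2) znot by blast
  qed
  then have "c 1 \<sim> c' 0" using ecyc_nb(2)[OF c'(1), of 0] c'(3) by simp
  then have "c' 0 = c (1 + 1) \<or> c' 0 = c (1 - 1)" using ecyc_nbE[OF c(1) c0] by blast
  moreover have "c' 0 \<noteq> c 0"
    using c'(5) d1 ecyc_d(2)[OF c(1), of k k] c(2) by (auto simp: ival_iff)
  ultimately have "c' 0 = c 2" by auto
  moreover have "u \<sim> c' 0"
    using ecyc_nb(1)[OF c'(1), of "l + 1"] c'(4) l ecyc_periodic(1)[OF c'(1), of 0] by simp
  moreover have "\<not> u \<sim> c 1"
    using ecyc_not_nb[OF c'(1), of "l + 1" "l - 1"] c' l by auto
  ultimately show thesis using that[of u] u eqs by simp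
qed

text \<open>Everything is measured from \<open>w = c 2\<close>, where \<open>k \<ge> 3\<close> puts
  \<open>w2 = c (-1)\<close> at distance three. \<open>long_apex_square\<close> completes
  \<open>w2, x, z\<close> to a square by a vertex \<open>u2\<close>, which \<open>square_top\<close>
  forces to distance three. The triangle condition then gives \<open>t\<close> below the edge from
  \<open>w2\<close> to \<open>u2\<close>, and the square \<open>x, w2, t, s\<close> built on it
  contradicts \<open>square_top\<close>.\<close>

lemma long_no_apex0:
  assumes c: "ecyc k c" "3 \<le> k" and z: "z \<sim> c 0" "z \<sim> c 1"
  shows False
proof -
  note V = ecyc_V[OF c(1)]
  define x y w w2 where d: "x = c 0" "y = c 1" "w = c 2" "w2 = c (-1)"
  have nb: "x \<sim> y" "y \<sim> w" "w2 \<sim> x" "\<not> x \<sim> w" "\<not> w2 \<sim> y" "w2 \<noteq> y" "x \<noteq> w"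
    using ecyc_nb(1)[OF c(1), of 0] ecyc_nb(1)[OF c(1), of 1] ecyc_nb(1)[OF c(1), of "-1"]
      ecyc_not_nb[OF c(1), of 0 2] ecyc_not_nb[OF c(1), of "-1" 1]
      ecyc_ne[OF c(1), of "-1" 1] ecyc_ne[OF c(1), of "0" 2] c(2) by (auto simp: d)
  have Vs: "x \<in> V" "y \<in> V" "w \<in> V" "w2 \<in> V" "z \<in> V" using V nb_V z by (auto simp: d)
  have dw: "d w x = 2" "d w y = 1" "d w w2 = 3"
    using ecyc_d(2)[OF c(1), of 2 2] ecyc_d(2)[OF c(1), of 1 2] ecyc_d(2)[OF c(1), of 3 2] c(2)
    by (auto simp: d)
  define r where "r = (\<lambda>i. c (1 - i))"
  have r: "ecyc k r" using ecyc_reflect[OF ecyc_shift[OF c(1), of 1]] by (simp add: r_def)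
  have rz: "z \<sim> r 0" "z \<sim> r 1" using z by (simp_all add: r_def)
  obtain u2 where u2: "z \<sim> u2" "u2 \<sim> w2" "u2 \<noteq> x" "\<not> u2 \<sim> x"
    using long_apex_square[OF r c(2) rz] by (auto simp: r_def d)
  have zw: "\<not> z \<sim> w" "\<not> z \<sim> w2"
    using long_apex_not_nb[OF c z] long_apex_not_nb[OF r c(2) rz] by (auto simp: r_def d)
  have zne: "z \<noteq> w" "z \<noteq> w2" "z \<noteq> x" "z \<noteq> y"
    using long_apex_outside[OF c, of z 0] z by (auto simp: d)
  have zx: "z \<sim> x" "z \<sim> y" using z by (auto simp: d)
  have dwz: "d w z = 2" using not_nb[of y w z] nb zx zw zne nb_sym by metis
  have u2V: "u2 \<in> V" using nb_V u2 by blast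
  have "d w u2 \<noteq> 2"
  proof
    assume "d w u2 = 2"
    then have eq: "d w x = d w u2" "d w w2 = d w x + 1" using dw by auto
    have "d w x = d w z + 1"
      by (rule square_top[of x w2 u2 z w]) (use nb u2 zx zw zne Vs eq nb_sym in metis)+
    then show False using dw dwz by simp
  qed
  moreover have "d w u2 \<le> 3" using d_nb_le(2)[OF u2(1) Vs(3)] dwz by simp
  moreover have "d w w2 \<le> d w u2 + 1" using d_nb_le(2)[OF u2(2) Vs(3)] .
  ultimately have dwu2: "d w u2 = 3" using dw by linarith
  then have "d w w2 = d w u2" using dw by simp
  then obtain t where t: "w2 \<sim> t" "u2 \<sim> t" "d w w2 = d w t + 1" "t \<in> V"
    using triangle_rule[OF Vs(3) nb_sym[OF u2(2)]] by metis
  have dt: "d w t = 2" using t(3) dw by simp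
  have sq: "w2 \<sim> u2" "u2 \<sim> z" "z \<sim> x" "x \<sim> w2" "\<not> w2 \<sim> z" "\<not> u2 \<sim> x" "w2 \<noteq> z" "u2 \<noteq> x"
    using u2 nb zx zw zne nb_sym by metis+
  \<comment> \<open>The matching of \<open>prism\<close> sends \<open>t\<close> to a vertex
    \<open>s\<close> of the clique of \<open>x\<close> and \<open>z\<close>; that clique also
    contains \<open>y\<close>.\<close>
  have "t \<in> ecl w2 u2" using t nb_sym by (auto simp: ecl_def)
  then obtain s where s: "s \<in> ecl x z" "t \<sim> s" using prism(1)[OF sq] by blast
  have nt: "\<not> t \<sim> x" "\<not> t \<sim> z"
    using K4_rule[of t w2 x u2] K4_rule[of t u2 z w2] t sq nb_sym by metis+
  have s': "s \<sim> x" "s \<sim> z" using s nt by (auto simp: ecl_def)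
  \<comment> \<open>Otherwise \<open>t\<close> would lie on a geodesic from \<open>y\<close> to
    \<open>w2\<close>, hence on the cycle, hence be \<open>c 2\<close> or \<open>c 0\<close>;
    distances and adjacencies exclude both.\<close>
  have sy: "s \<noteq> y"
  proof
    assume "s = y"
    then have "t \<sim> y" using s by simp
    have "d y w2 = 2" using not_nb[of x y w2] nb nb_sym by metis
    then have "d y w2 = d y t + d t w2" using d_nb nb_sym \<open>t \<sim> y\<close> t by simp
    then have "t \<in> range c" using convexD[OF ecyc_convex[OF c(1)], of y w2 t] t by (auto simp: d)
    then have "t = c 2 \<or> t = c 0"
      using ecyc_nbE[OF c(1), of t 1] nb_sym[OF \<open>t \<sim> y\<close>] by (auto simp: d)
    then show False
    proof
      assume "t = c 2"
      then show False using dt by (auto simp: d)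
    next
      assume "t = c 0"
      then show False using t(2) u2 by (auto simp: d)
    qed
  qed
  have K: "y \<in> ecl x z" using nb zx nb_sym by (auto simp: ecl_def)
  have xz: "x \<sim> z" using nb_sym zx by blast
  obtain g where g: "gate (ecl x z) w g" using gate_ex[OF xz Vs(3)] by blast
  \<comment> \<open>\<open>w\<close> is adjacent to \<open>y\<close> and lies outside the clique, so
    \<open>y\<close> is its gate, and \<open>s\<close> is at distance two like
    \<open>x\<close>.\<close>
  have "g = y"
  proof (rule ccontr)
    assume "g \<noteq> y"
    then have "d w y = d w g + 1" using g K by (auto simp: gate_def)
    then have "d w g = 0" using dw by simp
    then have "g = w" using d_eq_0 Vs g ecl_V[OF xz] by (auto simp: gate_def)
    then show False using g nb zw zne nb_sym unfolding gate_def ecl_def by blast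
  qed
  then have ws: "d w s = 2" using g s sy dw by (auto simp: gate_def)
  have nsw: "\<not> s \<sim> w2"
    using K4_rule[of s x w2 y] ecl_nb[OF xz s(1) K sy] s' nb nb_sym by metis
  have "s \<noteq> w2" using sy ecl_nb[OF xz s(1) K sy] nb by blast
  have "x \<noteq> t" using nt t(2) u2 by blast
  have eq: "d w x = d w t" "d w w2 = d w x + 1" using dw dt by auto
  have "d w x = d w s + 1"
    by (rule square_top[of x w2 t s w]) (use nt nsw s s' sq t Vs eq \<open>s \<noteq> w2\<close> \<open>x \<noteq> t\<close> nb_sym in metis)+
  then show False using ws dw by simp
qed

lemma long_no_apex:
  assumes "ecyc k c" "3 \<le> k" "z \<sim> c i" "z \<sim> c (i + 1)"
  shows False
  using long_no_apex0[OF ecyc_shift[OF assms(1), of i] assms(2), of z] assms(3,4)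
  by (simp add: add.commute)

lemma long_ecl: "ecyc k c \<Longrightarrow> 3 \<le> k \<Longrightarrow> ecl (c i) (c (i + 1)) = {c i, c (i + 1)}"
  using long_no_apex by (auto simp: ecl_def)

text \<open>An enumeration is determined by two consecutive values, since the next vertex is the
  neighbour that was not just left. Each period is then a period of the other enumeration too, which
  gives \<open>l = k\<close>.\<close>

lemma ecyc_match:
  assumes c: "ecyc k c" and c': "ecyc l c'" and R: "range c' \<subseteq> range c"
    and 0: "c' 0 = c 0" and 1: "c' 1 = c 1"
  shows "c' = c" "l = k"
proof -
  have step: "c' (int j) = c (int j) \<and> c' (int j + 1) = c (int j + 1)" for j
  proof (induction j)
    case (Suc j)
    have "c (int j + 1) \<sim> c' (int j + 1 + 1)" using Suc ecyc_nb(1)[OF c', of "int j + 1"] by simp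
    then have "c' (int j + 1 + 1) = c (int j + 1 + 1) \<or> c' (int j + 1 + 1) = c (int j + 1 - 1)"
      using ecyc_nbE[OF c] R by blast
    moreover have "c' (int j + 1 + 1) \<noteq> c' (int j)"
      using ecyc_ne[OF c', of "int j + 1 + 1" "int j"] ecyc_k[OF c'] by auto
    ultimately show ?case using Suc by (auto simp: algebra_simps)
  qed (use 0 1 in auto)
  have pos: "c' j = c j" if "0 \<le> j" for j using step[of "nat j"] that by simp
  have k: "0 < k" "0 < l" using ecyc_k c c' by fastforce+
  have "c (2 * l) = c 0" using pos[of "2 * l"] k 0 ecyc_periodic(1)[OF c', of 0] by simp
  then have "k dvd l" unfolding ecyc_eq[OF c] by simp
  moreover have "c' (2 * k) = c' 0" using pos[of "2 * k"] k 0 ecyc_periodic(1)[OF c, of 0] by simp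
  then have "l dvd k" unfolding ecyc_eq[OF c'] by simp
  ultimately show lk: "l = k" using k zdvd_antisym_nonneg[of l k] by simp
  show "c' = c"
  proof
    fix j :: int
    define m where "m = j + 2 * k * \<bar>j\<bar>"
    have "\<bar>j\<bar> \<le> 2 * k * \<bar>j\<bar>" using k mult_right_mono[of 1 "2 * k" "\<bar>j\<bar>"] by simp
    then have "0 \<le> m" unfolding m_def by linarith
    moreover have "c' j = c' m" "c j = c m" by (simp_all add: ecyc_eq[OF c] ecyc_eq[OF c'] lk m_def)
    ultimately show "c' j = c j" using pos by simp
  qed
qed

text \<open>Cliques along a long cycle are single edges, so consecutive distances differ by exactly
  one. At a vertex of maximal distance the cycle condition produces a convex cycle sharing two edges
  with the given one; so it is the given one, and its lowest vertex is opposite to its top.\<close>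

lemma long_levels:
  assumes c: "ecyc k c" "3 \<le> k" and v: "v \<in> V"
  shows "\<exists>b. \<forall>j. 0 \<le> j \<and> j \<le> k \<longrightarrow>
    int (d v (c (b + j))) = int (d v (c b)) + j \<and> int (d v (c (b - j))) = int (d v (c b)) + j"
proof -
  note V = ecyc_V[OF c(1)]
  have step: "d v (c i) = d v (c (i + 1)) + 1 \<or> d v (c (i + 1)) = d v (c i) + 1" for i
  proof -
    obtain p where "gate (ecl (c i) (c (i + 1))) v p" using gate_ex[OF ecyc_nb(1)[OF c(1)] v] by blast
    then show ?thesis unfolding long_ecl[OF c] gate_def using ecyc_ne[OF c(1), of i "i + 1"] c(2) by auto
  qed
  have "finite (range (\<lambda>i. d v (c i)))"
  proof (rule finite_subset)
    show "range (\<lambda>i. d v (c i)) \<subseteq> (\<lambda>i. d v (c i)) ` {0..<2 * k}"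
    proof safe
      fix i
      have "c i = c (i mod (2 * k))" using ecyc_eq[OF c(1)] by (simp add: mod_eq_dvd_iff[symmetric])
      then show "d v (c i) \<in> (\<lambda>i. d v (c i)) ` {0..<2 * k}" using c(2) by (auto intro!: image_eqI)
    qed
  qed simp
  then have M: "Max (range (\<lambda>i. d v (c i))) \<in> range (\<lambda>i. d v (c i))"
    "\<And>j. d v (c j) \<le> Max (range (\<lambda>i. d v (c i)))" by auto
  then obtain i where "Max (range (\<lambda>i. d v (c i))) = d v (c i)" by blast
  with M(2) have i: "\<And>j. d v (c j) \<le> d v (c i)" by metis
  have "d v (c i) = d v (c (i - 1)) + 1" "d v (c i) = d v (c (i + 1)) + 1"
    using step[of "i - 1"] step[of i] i[of "i - 1"] i[of "i + 1"] by auto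
  moreover have "c (i - 1) \<noteq> c (i + 1)" using ecyc_ne[OF c(1), of "i - 1" "i + 1"] c(2) by auto
  ultimately obtain l c' where c': "ecyc l c'" "c' l = c i" "c' (l - 1) = c (i - 1)"
    "c' (l + 1) = c (i + 1)" "c' 0 \<in> ival X v (c (i - 1))"
    using cycle_rule[OF v ecyc_nb(4)[OF c(1), of i] ecyc_nb(2)[OF c(1), of i]] by (metis add_right_cancel)
  have ne: "{c (i - 1), c i} \<noteq> {c i, c (i + 1)}"
    using \<open>c (i - 1) \<noteq> c (i + 1)\<close> by (auto simp: doubleton_eq_iff)
  have sub: "{c (i - 1), c i} \<subseteq> range c'" "{c i, c (i + 1)} \<subseteq> range c'"
    using c' by (metis empty_subsetI insert_subset rangeI)+
  have R: "range c = range c'"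
    by (rule ecyc_same[OF c(1) c'(1) _ _ ne])
      (use sub ecyc_nb(1)[OF c(1), of i] ecyc_nb(4)[OF c(1), of i] in auto)
  \<comment> \<open>Both enumerations are recentred at the top vertex \<open>c i\<close> to compare
    them by \<open>ecyc_match\<close>.\<close>
  define e e' where "e = (\<lambda>j. c (j + i))" and "e' = (\<lambda>j. c' (j + l))"
  have ee: "ecyc k e" "ecyc l e'" using ecyc_shift c c' by (simp_all add: e_def e'_def)
  have "range e' \<subseteq> range e"
  proof safe
    fix j
    obtain m where "c' (j + l) = c m" using R by blast
    then have "e' j = e (m - i)" by (simp add: e_def e'_def)
    then show "e' j \<in> range e" by simp
  qed
  moreover have "e' 0 = e 0" using c'(2) by (simp add: e_def e'_def)
  moreover have "e' 1 = e 1" using c'(4) by (simp add: e_def e'_def add.commute[of 1])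
  ultimately have eq: "e' = e" "l = k" using ecyc_match[OF ee] by blast+
  have cc: "c' j = c (i - k + j)" for j using fun_cong[OF eq(1), of "j - k"] eq(2)
    by (simp add: e_def e'_def algebra_simps)
  have "d v (c' (k - 1)) = d v (c' 0) + d (c' 0) (c' (k - 1))" using c' eq by (simp add: ival_iff)
  moreover have "int (d (c' 0) (c' (k - 1))) = k - 1" using ecyc_d(1)[OF c'(1), of "k - 1" 0] eq c(2) by simp
  ultimately have top: "int (d v (c' k)) = int (d v (c' 0)) + k"
    using \<open>d v (c i) = d v (c (i - 1)) + 1\<close> c' eq by simp
  have c'k: "ecyc k c'" using c' eq by simp
  show ?thesis
    by (rule exI[of _ "i - k"]) (use cycle_levels[OF c'k v top] in \<open>simp add: cc\<close>)
qed

text \<open>By \<open>long_levels\<close> the distance to \<open>v\<close> rises along both halves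
  issuing from a lowest vertex \<open>b\<close>. Opposite edges lie in different halves, and a full
  turn traverses one half upwards and the other downwards.\<close>

lemma long_opposite:
  assumes c: "ecyc k c" "3 \<le> k" and v: "v \<in> V"
  shows "d v (c i) < d v (c (i + 1)) \<longleftrightarrow> d v (c (i + k + 1)) < d v (c (i + k))"
proof -
  obtain b where b: "\<And>j. 0 \<le> j \<Longrightarrow> j \<le> k \<Longrightarrow> int (d v (c (b + j))) = int (d v (c b)) + j"
    "\<And>j. 0 \<le> j \<Longrightarrow> j \<le> k \<Longrightarrow> int (d v (c (b - j))) = int (d v (c b)) + j"
    using long_levels[OF c v] by blast
  define m where "m = (i - b) mod (2 * k)"
  have m: "0 \<le> m" "m < 2 * k" using c(2) by (auto simp: m_def)
  have dv: "2 * k dvd i - b - m" unfolding m_def using dvd_minus_mod by blast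
  have e: "c (i + s) = c (b + m + s)" for s using dv by (simp add: ecyc_eq[OF c(1)] algebra_simps)
  have p: "c (j + 2 * k) = c j" "c (j - 2 * k) = c j" for j using ecyc_periodic[OF c(1)] by auto
  have q: "c (b + j) = c (b - (2 * k - j))" for j using p(1)[of "b - (2 * k - j)"] by simp
  show ?thesis
  proof (cases "m < k")
    case True
    have "c (i + k) = c (b - (k - m))" "c (i + k + 1) = c (b - (k - m - 1))"
      using e[of k] e[of "k + 1"] q[of "m + k"] q[of "m + k + 1"] by (simp_all add: algebra_simps)
    then show ?thesis
      using e[of 0] e[of 1] b(1)[of m] b(1)[of "m + 1"] b(2)[of "k - m"] b(2)[of "k - m - 1"] True m
      by (simp add: algebra_simps)
  next
    case False
    have "c i = c (b - (2 * k - m))" "c (i + 1) = c (b - (2 * k - m - 1))"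
      using e[of 0] e[of 1] q[of m] q[of "m + 1"] by (simp_all add: algebra_simps)
    moreover have "c (i + k) = c (b + (m - k))" "c (i + k + 1) = c (b + (m - k + 1))"
      using e[of "k"] e[of "k + 1"] p(1)[of "b + (m - k)"] p(1)[of "b + (m - k + 1)"]
      by (simp_all add: algebra_simps)
    ultimately show ?thesis
      using b(2)[of "2 * k - m"] b(2)[of "2 * k - m - 1"] b(1)[of "m - k"] b(1)[of "m - k + 1"] False m
      by (simp add: algebra_simps)
  qed
qed

lemma same_long:
  assumes c: "ecyc k c" "3 \<le> k" and v: "v \<in> V" "w \<in> V"
  shows "same (ecl (c i) (c (i + 1))) v w \<longleftrightarrow>
    (d v (c i) < d v (c (i + 1)) \<longleftrightarrow> d w (c i) < d w (c (i + 1)))"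
proof -
  have ne: "c i \<noteq> c (i + 1)" using ecyc_ne[OF c(1), of i "i + 1"] c(2) by auto
  obtain p q where pq: "gate (ecl (c i) (c (i + 1))) v p" "gate (ecl (c i) (c (i + 1))) w q"
    using gate_ex[OF ecyc_nb(1)[OF c(1)]] v by metis
  have *: "same (ecl (c i) (c (i + 1))) v w \<longleftrightarrow> p = q"
    using pq gate_unique unfolding same_def by blast
  show ?thesis
    unfolding * using pq ne unfolding long_ecl[OF c] gate_def by auto
qed

text \<open>The edges of a square may lie in larger cliques, which \<open>prism\<close> matches. In
  a longer cycle the cliques are the edges themselves, and the nearer ends correspond by
  \<open>long_opposite\<close>.\<close>

lemma same_opposite:
  assumes c: "ecyc k c" and v: "v \<in> V" "w \<in> V"
  shows "same (ecl (c i) (c (i + 1))) v w \<longleftrightarrow> same (ecl (c (i + k)) (c (i + k + 1))) v w"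
proof (cases "k = 2")
  case True
  have "same (ecl (c i) (c (i + 1))) v w \<longleftrightarrow> same (ecl (c (i + 3)) (c (i + 2))) v w"
    by (rule square_same[OF _ _ _ _ _ _ _ _ v])
     (use ecyc_nb(1)[OF c, of i] ecyc_nb(1)[OF c, of "i + 1"] ecyc_nb(1)[OF c, of "i + 2"]
      ecyc_nb(1)[OF c, of "i + 3"] ecyc_not_nb[OF c, of i "i + 2"] ecyc_not_nb[OF c, of "i + 1" "i + 3"]
      ecyc_ne[OF c, of i "i + 2"] ecyc_ne[OF c, of "i + 1" "i + 3"] ecyc_periodic(1)[OF c, of i] True
      in \<open>simp_all add: algebra_simps\<close>)
  then show ?thesis using True ecl_sym by (simp add: algebra_simps)
next
  case False
  then have k: "3 \<le> k" using ecyc_k[OF c] by simp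
  have ne: "d v (c (i + k)) \<noteq> d v (c (i + k + 1))" if "v \<in> V" for v
    using gate_ex[OF ecyc_nb(1)[OF c, of "i + k"] that] ecyc_ne[OF c, of "i + k" "i + k + 1"] k
    unfolding long_ecl[OF c k] gate_def by auto
  show ?thesis
    unfolding same_long[OF c k v]
    using long_opposite[OF c k v(1), of i] long_opposite[OF c k v(2), of i] ne[OF v(1)] ne[OF v(2)]
    by linarith
qed

subsection \<open>Hyperplanes\<close>

definition esame :: "'v set \<Rightarrow> 'v \<Rightarrow> 'v \<Rightarrow> bool" where
  "esame e v w \<longleftrightarrow> (\<exists>x y. e = {x, y} \<and> same (ecl x y) v w)"

lemma esame_iff: "esame {x, y} v w \<longleftrightarrow> same (ecl x y) v w"
  unfolding esame_def doubleton_eq_iff using ecl_sym[of x y] by auto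

lemma triangle_param:
  assumes "x \<sim> y" "y \<sim> z" "x \<sim> z"
  shows "\<exists>c. cycle_param X 3 c {x, y, z}"
proof -
  define f where "f = (\<lambda>i::nat. if i = 0 then x else if i = 1 then y else z)"
  have ne: "x \<noteq> y" "x \<noteq> z" "y \<noteq> z" "{x, y, z} \<subseteq> V" using nb_V assms by auto
  have lt: "{..<3::nat} = {0, 1, 2}" by auto
  have "edges (cycle_graph 3) = (\<lambda>i. {i, Suc i mod 3}) ` {..<3}" by (auto simp: cycle_graph_def)
  then have E: "edges (cycle_graph 3) = {{0, 1}, {1, 2}, {2, 0}}"
    unfolding lt by (simp add: insert_commute numeral_2_eq_2)
  have "cycle_param X 3 f {x, y, z}"
    unfolding cycle_param_def graph_iso_def
  proof (intro conjI ballI)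
    show "bij_betw f (verts (cycle_graph 3)) (verts (induced X {x, y, z}))"
      using ne by (auto simp: cycle_graph_def induced_def bij_betw_def inj_on_def f_def lt)
    fix i j assume "i \<in> verts (cycle_graph 3)" "j \<in> verts (cycle_graph 3)"
    then have "i \<in> {0, 1, 2}" "j \<in> {0, 1, 2}" using lt by (auto simp: cycle_graph_def)
    then show "{i, j} \<in> edges (cycle_graph 3) \<longleftrightarrow> {f i, f j} \<in> edges (induced X {x, y, z})"
      unfolding E induced_def using assms by (auto simp: f_def doubleton_eq_iff nb_irrefl dest: nb_sym)
  qed (use ne in auto)
  then show ?thesis by blast
qed

lemma triangle_complete:
  assumes "cycle_param X 3 c C" "x \<in> C" "y \<in> C" "x \<noteq> y"
  shows "x \<sim> y"
proof -
  have b: "bij_betw c {..<3} C" and E: "\<And>i j. i < 3 \<Longrightarrow> j < 3 \<Longrightarrow>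
     {i, j} \<in> edges (cycle_graph 3) \<Longrightarrow> c i \<sim> c j"
    using assms by (auto simp: cycle_param_def graph_iso_def cycle_graph_def induced_def)
  obtain i j where ij: "i < 3" "j < 3" "x = c i" "y = c j"
    using b assms(2,3) by (auto simp: bij_betw_def)
  moreover have "i \<noteq> j" using ij assms by auto
  then have "(i, j) \<in> {(0, 1), (1, 2), (2, 0), (1, 0), (2, 1), (0, 2)}"
    using ij(1,2) by auto
  then have "j = Suc i mod 3 \<or> i = Suc j mod 3" by auto
  then have "{i, j} = {i, Suc i mod 3} \<or> {i, j} = {j, Suc j mod 3}" by auto
  then have "{i, j} \<in> edges (cycle_graph 3)" using ij(1,2) unfolding cycle_graph_def by auto
  ultimately show ?thesis using E by blast
qed

lemma edge_rel_cases:
  assumes "(e, f) \<in> edge_rel X"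
  obtains x y u v where "e = {x, y}" "x \<sim> y" "f = {u, v}" "u \<in> ecl x y" "v \<in> ecl x y" "u \<noteq> v"
  | k c i where "ecyc k c" "e = {c i, c (i + 1)}" "f = {c (i + k), c (i + k + 1)}"
proof -
  have "(\<exists>x y u v. e = {x, y} \<and> x \<sim> y \<and> f = {u, v} \<and> u \<in> ecl x y \<and> v \<in> ecl x y \<and> u \<noteq> v) \<or>
    (\<exists>k c i. ecyc k c \<and> e = {c i, c (i + 1)} \<and> f = {c (i + k), c (i + k + 1)})"
    using assms unfolding edge_rel_def mem_Collect_eq case_prod_conv
  proof (elim disjE exE conjE)
    fix C c assume C: "cycle_param X 3 c C" "e \<in> edges (induced X C)" "f \<in> edges (induced X C)"
    then have "e \<in> edges X" "f \<in> edges X" "e \<subseteq> C" "f \<subseteq> C" by (auto simp: induced_def)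
    obtain x y where xy: "e = {x, y}" "x \<sim> y" using edgeE[OF \<open>e \<in> edges X\<close>] .
    obtain u v where uv: "f = {u, v}" "u \<sim> v" using edgeE[OF \<open>f \<in> edges X\<close>] .
    have e: "e = {x, y}" "x \<sim> y" "f = {u, v}" "u \<sim> v" "x \<in> C" "y \<in> C" "u \<in> C" "v \<in> C"
      using xy uv \<open>e \<subseteq> C\<close> \<open>f \<subseteq> C\<close> by auto
    then have "u \<in> ecl x y" "v \<in> ecl x y" "u \<noteq> v"
      using triangle_complete[OF C(1)] nb_V by (auto simp: ecl_def)
    then show ?thesis using e by blast
  next
    fix C assume C: "even_convex_cycle X C" "opposite_edges X C e f"
    then obtain n c0 i where n: "even n" "cycle_param X n c0 C" "i < n" "e = {c0 i, c0 (Suc i mod n)}"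
      "f = {c0 ((i + n div 2) mod n), c0 (Suc (i + n div 2) mod n)}"
      unfolding opposite_edges_def by blast
    have cv: "convex_subgraph X C" using C(1) by (auto simp: even_convex_cycle_def)
    define k c where "k = int n div 2" and "c = (\<lambda>i::int. c0 (nat (i mod int n)))"
    have c: "ecyc k c" using ecyc_of_param[OF n(1,2) cv] by (simp add: c_def k_def)
    have N: "c0 (m mod n) = c (int m)" for m by (simp add: c_def zmod_int[symmetric])
    have "c0 i = c (int i)" using N[of i] n(3) by simp
    moreover have "c0 (Suc i mod n) = c (int i + 1)" using N[of "Suc i"] by (simp add: add.commute)
    moreover have "c0 ((i + n div 2) mod n) = c (int i + k)"
      using N[of "i + n div 2"] by (simp add: k_def zdiv_int)
    moreover have "c0 (Suc (i + n div 2) mod n) = c (int i + k + 1)"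
      using N[of "Suc (i + n div 2)"] by (simp add: k_def zdiv_int algebra_simps)
    ultimately have "e = {c (int i), c (int i + 1)}" "f = {c (int i + k), c (int i + k + 1)}"
      using n(4,5) by auto
    then show ?thesis using c by blast
  qed
  then show thesis using that by blast
qed

lemma edge_rel_same:
  assumes "(e, f) \<in> edge_rel X"
  shows "e \<in> edges X" "f \<in> edges X" "\<And>v w. v \<in> V \<Longrightarrow> w \<in> V \<Longrightarrow> esame e v w \<longleftrightarrow> esame f v w"
proof -
  have "e \<in> edges X \<and> f \<in> edges X \<and> (\<forall>v\<in>V. \<forall>w\<in>V. esame e v w \<longleftrightarrow> esame f v w)"
    using assms
  proof (cases rule: edge_rel_cases)
    case (1 x y u v)
    then show ?thesis using ecl_eq[of x y u v] ecl_nb[of x y u v] by (simp add: esame_iff)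
  next
    case (2 k c i)
    then show ?thesis
      using same_opposite[OF 2(1), of _ _ i] ecyc_nb(1)[OF 2(1), of i] ecyc_nb(1)[OF 2(1), of "i + k"]
      by (simp add: esame_iff)
  qed
  then show "e \<in> edges X" "f \<in> edges X" "\<And>v w. v \<in> V \<Longrightarrow> w \<in> V \<Longrightarrow> esame e v w \<longleftrightarrow> esame f v w"
    by auto
qed

lemma edge_rel_opposite:
  assumes c: "ecyc k c"
  shows "({c i, c (i + 1)}, {c (i + k), c (i + k + 1)}) \<in> edge_rel X"
proof -
  define c' where "c' = (\<lambda>j. c (j + i))"
  have c': "ecyc k c'" using ecyc_shift[OF c] by (simp add: c'_def)
  define n where "n = nat (2 * k)"
  have k: "2 \<le> k" using ecyc_k[OF c] .
  have n: "n div 2 = nat k" "Suc 0 < n" "nat k < n" "Suc (nat k) < n" using k by (auto simp: n_def)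
  have "opposite_edges X (range c') {c' 0, c' 1} {c' k, c' (k + 1)}"
    unfolding opposite_edges_def
  proof (intro exI conjI)
    show "even n" "cycle_param X n (\<lambda>i. c' (int i)) (range c')"
      using param_of_ecyc[OF c'] by (auto simp: n_def)
    show "0 < n" using n by simp
    show "{c' 0, c' 1} = {c' (int 0), c' (int (Suc 0 mod n))}" using n by simp
    show "{c' k, c' (k + 1)} = {c' (int ((0 + n div 2) mod n)), c' (int (Suc (0 + n div 2) mod n))}"
      using n k by (simp add: add.commute)
  qed
  then have "({c' 0, c' 1}, {c' k, c' (k + 1)}) \<in> edge_rel X"
    using param_of_ecyc(3)[OF c'] unfolding edge_rel_def by blast
  then show ?thesis by (simp add: c'_def algebra_simps)
qed

lemma edge_rel_triangle: "x \<sim> y \<Longrightarrow> y \<sim> z \<Longrightarrow> x \<sim> z \<Longrightarrow> ({x, y}, {y, z}) \<in> edge_rel X"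
proof -
  assume "x \<sim> y" "y \<sim> z" "x \<sim> z"
  then obtain c where "cycle_param X 3 c {x, y, z}" using triangle_param by blast
  moreover have "{x, y} \<in> edges (induced X {x, y, z})" "{y, z} \<in> edges (induced X {x, y, z})"
    using \<open>x \<sim> y\<close> \<open>y \<sim> z\<close> by (auto simp: induced_def)
  ultimately show ?thesis unfolding edge_rel_def by blast
qed

lemma edge_rel_star_same:
  assumes "(e, f) \<in> (edge_rel X)\<^sup>*" "e \<in> edges X"
  shows "f \<in> edges X \<and> (\<forall>v\<in>V. \<forall>w\<in>V. esame e v w \<longleftrightarrow> esame f v w)"
  using assms
proof (induction rule: rtrancl_induct)
  case (step f g)
  then show ?case using edge_rel_same[OF step.hyps(2)] by blast
qed simp

lemma clique_edges_rel:
  assumes xy: "x \<sim> y" and p: "p \<in> ecl x y" "q \<in> ecl x y" "p \<noteq> q"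
  shows "({x, y}, {p, q}) \<in> (edge_rel X)\<^sup>*"
proof -
  have *: "({a, b}, {b, e}) \<in> (edge_rel X)\<^sup>*" if "a \<in> ecl x y" "b \<in> ecl x y" "e \<in> ecl x y" "a \<noteq> b" "b \<noteq> e" for a b e
  proof (cases "a = e")
    case True
    then have "{a, b} = {b, e}" by blast
    then show ?thesis by simp
  next
    case False
    then have "({a, b}, {b, e}) \<in> edge_rel X"
      by (intro edge_rel_triangle ecl_nb[OF xy]) (use that in auto)
    then show ?thesis by (rule r_into_rtrancl)
  qed
  show ?thesis
  proof (cases "y = p")
    case True
    then show ?thesis using *[of x y q] ecl_self p nb_V(3)[OF xy] by metis
  next
    case False
    have "({x, y}, {y, p}) \<in> (edge_rel X)\<^sup>*"
      by (rule *[OF ecl_self p(1) nb_V(3)[OF xy] False])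
    moreover have "({y, p}, {p, q}) \<in> (edge_rel X)\<^sup>*"
      by (rule *[OF ecl_self(2) p(1,2) False p(3)])
    ultimately show ?thesis by (rule rtrancl_trans)
  qed
qed

lemma same_refl: "x \<sim> y \<Longrightarrow> v \<in> V \<Longrightarrow> same (ecl x y) v v"
  using gate_ex unfolding same_def by blast

lemma same_sym: "same K v w \<Longrightarrow> same K w v"
  unfolding same_def by blast

lemma same_trans: "same K u v \<Longrightarrow> same K v w \<Longrightarrow> same K u w"
  unfolding same_def using gate_unique by metis

text \<open>By \<open>hsame_iff\<close> a single edge of \<open>J\<close> decides; quantifying over
  all of them avoids the choice of a representative.\<close>

definition hsame :: "'v set set \<Rightarrow> 'v \<Rightarrow> 'v \<Rightarrow> bool" where
  "hsame J v w \<longleftrightarrow> (\<forall>e\<in>J. esame e v w)"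

abbreviation hyps where "hyps \<equiv> hyperplanes X"

lemma hyp_rel:
  assumes "J \<in> hyps"
  shows "\<exists>e\<in>edges X. e \<in> J \<and> (\<forall>f. f \<in> J \<longleftrightarrow> (e, f) \<in> (edge_rel X)\<^sup>*)"
  using assms unfolding hyperplanes_def quotient_def by blast

lemma hyp_edge: "J \<in> hyps \<Longrightarrow> e \<in> J \<Longrightarrow> e \<in> edges X"
  using hyp_rel[of J] edge_rel_star_same by blast

lemma hyp_nonempty:
  assumes "J \<in> hyps" obtains x y where "x \<sim> y" "{x, y} \<in> J"
  using hyp_rel[OF assms] edgeE that by metis

lemma hsame_iff:
  assumes J: "J \<in> hyps" "{x, y} \<in> J" and v: "v \<in> V" "w \<in> V"
  shows "hsame J v w \<longleftrightarrow> same (ecl x y) v w"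
proof -
  obtain e where e: "e \<in> edges X" "e \<in> J" "\<And>f. f \<in> J \<longleftrightarrow> (e, f) \<in> (edge_rel X)\<^sup>*"
    using hyp_rel[OF J(1)] by blast
  have "esame e v w \<longleftrightarrow> esame f v w" if "f \<in> J" for f
    using edge_rel_star_same[of e f] e that v by blast
  then show ?thesis using J(2) unfolding hsame_def esame_iff[symmetric] by blast
qed

lemma hsame_refl: "J \<in> hyps \<Longrightarrow> v \<in> V \<Longrightarrow> hsame J v v"
proof -
  assume J: "J \<in> hyps" and v: "v \<in> V"
  obtain x y where xy: "x \<sim> y" "{x, y} \<in> J" using hyp_nonempty[OF J] .
  show ?thesis using hsame_iff[OF J xy(2) v v] same_refl[OF xy(1) v] by blast
qed

lemma hsame_sym: "hsame J v w \<Longrightarrow> hsame J w v"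
  unfolding hsame_def esame_def using same_sym[of _ v w] by blast

lemma hsame_trans:
  assumes "J \<in> hyps" "u \<in> V" "v \<in> V" "w \<in> V" "hsame J u v" "hsame J v w" shows "hsame J u w"
proof -
  obtain x y where xy: "x \<sim> y" "{x, y} \<in> J" using hyp_nonempty[OF assms(1)] .
  show ?thesis
    using assms(5,6) same_trans
    unfolding hsame_iff[OF assms(1) xy(2) assms(2,3)] hsame_iff[OF assms(1) xy(2) assms(3,4)]
      hsame_iff[OF assms(1) xy(2) assms(2,4)] by blast
qed

section \<open>Edges crossed by the partition of a clique\<close>

lemma gate_step:
  assumes xy: "x \<sim> y" and g: "gate (ecl x y) v p" and v: "v \<in> V" and w: "w \<in> V" "d v p = d v w + d w p"
  shows "gate (ecl x y) w p"
proof -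
  obtain q where q: "gate (ecl x y) w q" using gate_ex[OF xy w(1)] by blast
  have "q = p"
  proof (rule ccontr)
    assume ne: "q \<noteq> p"
    then have *: "d w p = d w q + 1" "d v q = d v p + 1" using q g by (auto simp: gate_def)
    have "d v q \<le> d v w + d w q"
      using d_triangle v w ecl_V[OF xy] q by (auto simp: gate_def)
    then show False using * w by simp
  qed
  then show ?thesis using q by simp
qed

text \<open>Each end is one step further from the gate of the other than from its own, while its
  distances to a fixed gate differ by at most one between the two ends.\<close>

lemma adj_gates:
  assumes "x \<sim> y" "u \<sim> v" "gate (ecl x y) u p" "gate (ecl x y) v q" "p \<noteq> q"
  shows "d v q = d u p"
proof -
  have V: "u \<in> V" "v \<in> V" "p \<in> V" "q \<in> V" using nb_V assms(2) ecl_V[OF assms(1)] assms(3,4)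
    by (auto simp: gate_def)
  have "d v p = d v q + 1" "d u q = d u p + 1" using assms by (auto simp: gate_def)
  moreover have "d v p \<le> d u p + 1" "d u q \<le> d v q + 1"
    using d_triangle[of v u p] d_triangle[of u v q] V d_nb[OF assms(2)] d_nb[OF nb_sym[OF assms(2)]] by auto
  ultimately show ?thesis by linarith
qed

text \<open>An edge separated by the partition of a clique is moved towards the clique, from side to
  opposite side of convex even cycles.\<close>
lemma crossing_rel:
  assumes xy: "x \<sim> y"
  shows "u \<sim> v \<Longrightarrow> gate (ecl x y) u p \<Longrightarrow> gate (ecl x y) v q \<Longrightarrow> p \<noteq> q \<Longrightarrow>
    ({x, y}, {u, v}) \<in> (edge_rel X)\<^sup>*"
proof (induction "d u p" arbitrary: u v q rule: less_induct)
  case less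
  have V: "u \<in> V" "v \<in> V" "p \<in> V" "q \<in> V" using nb_V less.prems(1) ecl_V[OF xy] less.prems(2,3)
    by (auto simp: gate_def)
  have pq: "p \<in> ecl x y" "q \<in> ecl x y" using less.prems by (auto simp: gate_def)
  have dvq: "d v q = d u p" using adj_gates[OF xy less.prems] .
  have dd: "d v p = d v q + 1" "d u q = d u p + 1" using less.prems by (auto simp: gate_def)
  show ?case
  proof (cases "d u p = 0")
    case True
    then have "u = p" "v = q" using V d_eq_0 dvq by auto
    then show ?thesis using clique_edges_rel[OF xy pq less.prems(4)] by simp
  next
    case False
    then obtain v1 where v1: "v \<sim> v1" "d q v = d q v1 + 1" "v1 \<in> V"
      using d_step[of q v] V dvq by (metis d_refl)
    have dv1: "d v q = d v1 q + 1" using v1 d_sym V by simp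
    have "gate (ecl x y) v1 q" using gate_step[OF xy less.prems(3) V(2) v1(3)] dv1 d_nb[OF v1(1)] by simp
    then have g1: "gate (ecl x y) v1 q" "d v1 p = d v1 q + 1" using less.prems(4) pq by (auto simp: gate_def)
    \<comment> \<open>Seen from \<open>p\<close>, the vertex \<open>v\<close> lies just above both
      \<open>u\<close> and \<open>v1\<close>, as the cycle condition requires.\<close>
    have ds: "d p v1 = d p u" "d p v = d p u + 1" "u \<noteq> v1"
      using g1 dv1 dvq dd d_sym V v1(3) by auto
    obtain k c where c: "ecyc k c" "c k = v" "c (k - 1) = u" "c (k + 1) = v1"
      "c 0 \<in> ival X p u" "c 0 \<in> ival X p v1"
      using cycle_rule[OF V(3) less.prems(1) nb_sym[OF v1(1)] ds(3) ds(1)[symmetric] ds(2)] by metis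
    note CV = ecyc_V[OF c(1)]
    have k: "2 \<le> k" using ecyc_k[OF c(1)] .
    have w: "d p u = d p (c 0) + d (c 0) u" using c(5) by (simp add: ival_iff)
    have "int (d (c 0) u) = k - 1" using ecyc_d(1)[OF c(1), of "k - 1" 0] c(3) k by simp
    then have less_w: "d (c 0) p < d u p" using w d_sym CV V k by (smt (verit) of_nat_0_less_iff add_diff_cancel_left' diff_is_0_eq less_imp_le_nat linorder_not_le of_nat_0)
    have gw: "gate (ecl x y) (c 0) p"
      using gate_step[OF xy less.prems(2) V(1) CV[of 0]] w d_sym CV[of 0] V by simp
    obtain q' where q': "gate (ecl x y) (c (- 1)) q'" using gate_ex[OF xy CV] by blast
    have "q' \<noteq> p"
    proof (cases "k = 2")
      case True
      then have "c (- 1) = v1" using ecyc_periodic(1)[OF c(1), of "-1"] c(4) by simp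
      then show ?thesis using q' g1 gate_unique less.prems(4) by blast
    next
      case False
      then have "3 \<le> k" using k by simp
      then have "d q (c (- 1)) < d q (c 0)"
        using long_opposite[OF c(1) _ V(4), of "-1"] c(2,3) dd dvq d_sym V by simp
      then have lt: "d (c (- 1)) q < d (c 0) q" using d_sym V CV by simp
      have "d (c 0) q = d (c 0) p + 1" using gw pq less.prems(4) by (auto simp: gate_def)
      moreover have "d (c (- 1)) q = d (c (- 1)) p + 1" if "q' = p"
        using q' pq less.prems(4) that by (auto simp: gate_def)
      moreover have "d p (c (- 1)) = d p (c 0) + 1"
      proof -
        have "int (d p (c k)) = int (d p (c 0)) + k"
          using ds(2) w \<open>int (d (c 0) u) = k - 1\<close> c(2) by simp
        from cycle_levels(2)[OF c(1) V(3) this, of 1] show ?thesis using k by simp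
      qed
      ultimately show ?thesis using lt d_sym V CV by fastforce
    qed
    then have "({x, y}, {c 0, c (- 1)}) \<in> (edge_rel X)\<^sup>*"
      using less.hyps[OF less_w _ gw q'] ecyc_nb(3)[OF c(1), of 0] by simp
    moreover have "({c 0, c (- 1)}, {u, v}) \<in> edge_rel X"
      using edge_rel_opposite[OF c(1), of "-1"] c(2,3) by (simp add: insert_commute)
    ultimately show ?thesis by (rule rtrancl_into_rtrancl)
  qed
qed

text \<open>The ends of an edge are their own gates in its clique, so the edge crosses the partition
  it induces; the converse is \<open>crossing_rel\<close>.\<close>

lemma hyp_crossing:
  assumes J: "J \<in> hyps" and uv: "u \<sim> v"
  shows "{u, v} \<in> J \<longleftrightarrow> \<not> hsame J u v"
proof
  have V: "u \<in> V" "v \<in> V" using nb_V uv by auto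
  show "\<not> hsame J u v" if "{u, v} \<in> J"
  proof
    assume "hsame J u v"
    then have "same (ecl u v) u v" using hsame_iff[OF J that V] by simp
    then show False using gate_self[OF uv ecl_self(1)] gate_self[OF uv ecl_self(2)] gate_unique nb_V(3)[OF uv]
      unfolding same_def by metis
  qed
  assume n: "\<not> hsame J u v"
  obtain e where e: "e \<in> edges X" "e \<in> J" "\<And>f. f \<in> J \<longleftrightarrow> (e, f) \<in> (edge_rel X)\<^sup>*"
    using hyp_rel[OF J(1)] by blast
  obtain x y where xy: "e = {x, y}" "x \<sim> y" using edgeE[OF e(1)] .
  obtain p q where pq: "gate (ecl x y) u p" "gate (ecl x y) v q" using gate_ex[OF xy(2)] V by metis
  have "p \<noteq> q" using n pq hsame_iff[OF J, of x y] e(2) xy V unfolding same_def by blast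
  then show "{u, v} \<in> J" using crossing_rel[OF xy(2) uv pq] e(3) xy by simp
qed

text \<open>One edge determines the partition, and the partition determines the hyperplane through
  \<open>hyp_crossing\<close>.\<close>

lemma hyp_unique:
  assumes "J \<in> hyps" "J' \<in> hyps" "e \<in> J" "e \<in> J'" shows "J = J'"
proof -
  obtain x y where e: "e = {x, y}" using hyp_edge[OF assms(1,3)] edgeE by metis
  have "f \<in> J \<longleftrightarrow> f \<in> J'" if ff: "f \<in> edges X" for f
  proof -
    obtain u v where f: "f = {u, v}" "u \<sim> v" using edgeE[OF ff] .
    have "hsame J u v \<longleftrightarrow> hsame J' u v"
      using hsame_iff[of J x y u v] hsame_iff[of J' x y u v] assms e nb_V[OF f(2)] by simp
    then show ?thesis using hyp_crossing assms f by simp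
  qed
  then show ?thesis using hyp_edge assms by blast
qed

lemma hyp_clique:
  assumes "J \<in> hyps" "{x, y} \<in> J" "p \<in> ecl x y" "q \<in> ecl x y" "p \<noteq> q"
  shows "{p, q} \<in> J"
proof -
  have xy: "x \<sim> y" using hyp_edge assms by blast
  have pq: "p \<sim> q" using ecl_nb[OF xy assms(3-5)] .
  have "\<not> same (ecl x y) p q"
    using gate_self[OF xy] gate_unique assms unfolding same_def by metis
  then show ?thesis using hyp_crossing[OF assms(1) pq] hsame_iff[OF assms(1,2)] nb_V[OF pq] by blast
qed

text \<open>\<open>u\<close> is its own gate in the clique of the edge. A vertex on its side has the
  same gate and is nearer to \<open>u\<close> than to \<open>v\<close>; so a geodesic whose first
  edge is in \<open>J\<close> does not come back to the side where it started.\<close>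

lemma geodesic_cross:
  assumes J: "J \<in> hyps" "{u, v} \<in> J" and b: "b \<in> V" "d b u = d b v + 1"
  shows "\<not> hsame J u b"
proof
  have uv: "u \<sim> v" using hyp_edge J by blast
  assume "hsame J u b"
  then have "same (ecl u v) u b" using hsame_iff[OF J] nb_V[OF uv] b by blast
  then have "gate (ecl u v) b u" using gate_self[OF uv ecl_self(1)] gate_unique unfolding same_def by blast
  then show False using b(2) ecl_self(2) nb_V(3)[OF uv] unfolding gate_def by fastforce
qed

text \<open>By \<open>geodesic_cross\<close>, the first edge of a geodesic between two vertices of
  one side is not in \<open>J\<close>, so the induction can continue from its second vertex.\<close>

lemma hsame_convex:
  assumes J: "J \<in> hyps" and b: "b \<in> V" and z: "z \<in> V"
  shows "a \<in> V \<Longrightarrow> hsame J a b \<Longrightarrow> d a b = d a z + d z b \<Longrightarrow> hsame J a z"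
proof (induction "d a z" arbitrary: a)
  case 0
  then have "a = z" using d_eq_0 z by auto
  then show ?case using hsame_refl J z by blast
next
  case (Suc n)
  have "d z a = Suc n" using Suc d_sym z by simp
  then obtain a' where a': "a \<sim> a'" "d z a' = n" "a' \<in> V" using d_step_nb[OF z Suc.prems(1)] by metis
  have daz: "n = d a' z" using a' d_sym z by simp
  have le: "d a' b \<le> n + d z b" "d a b \<le> d a' b + 1"
    using d_triangle[OF a'(3) z b] daz d_nb_le(1)[OF a'(1) b] d_sym Suc.prems(1) a'(3) b by auto
  then have dab: "d a b = d a' b + 1" "d a' b = d a' z + d z b" using Suc daz by linarith+
  have "{a, a'} \<notin> J" using geodesic_cross[OF J _ b, of a a'] dab(1) Suc.prems d_sym a' b by auto
  then have aa': "hsame J a a'" using hyp_crossing[OF J a'(1)] by blast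
  then have "hsame J a' b" using hsame_trans[OF J a'(3) Suc.prems(1) b] hsame_sym Suc.prems(2) by blast
  then have "hsame J a' z" using Suc.hyps(1)[OF daz a'(3)] dab by blast
  then show ?case using hsame_trans[OF J Suc.prems(1) a'(3) z aa'] by blast
qed

lemma separated_edge:
  assumes J: "J \<in> hyps" and b: "b \<in> V"
  shows "a \<in> V \<Longrightarrow> \<not> hsame J a b \<Longrightarrow> \<exists>u v. {u, v} \<in> J \<and> u \<in> V \<and> d a b = d a u + d u b"
proof (induction "d a b" arbitrary: a rule: less_induct)
  case less
  have "a \<noteq> b" using less.prems hsame_refl J b by blast
  then obtain a' where a': "a \<sim> a'" "d b a = d b a' + 1" "a' \<in> V" using d_step[OF b less.prems(1)] by metis
  have dab: "d a b = d a' b + 1" using a' d_sym b less.prems by simp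
  show ?case
  proof (cases "hsame J a a'")
    case True
    then have "\<not> hsame J a' b" using less.prems hsame_trans[OF J less.prems(1) a'(3) b] by blast
    then obtain u v where uv: "{u, v} \<in> J" "u \<in> V" "d a' b = d a' u + d u b"
      using less.hyps[of a'] dab a' by force
    have "d a u \<le> 1 + d a' u" "d a b \<le> d a u + d u b"
      using d_triangle[OF less.prems(1) a'(3) uv(2)] d_triangle[OF less.prems(1) uv(2) b] d_nb[OF a'(1)] by auto
    then have "d a b = d a u + d u b" using dab uv(3) by linarith
    then show ?thesis using uv by blast
  next
    case False
    then have "{a, a'} \<in> J" using hyp_crossing[OF J a'(1)] by blast
    then show ?thesis using less.prems(1) by (intro exI[of _ a] exI[of _ a']) simp
  qed
qed

subsection \<open>Sectors\<close>

definition sec :: "'v set set \<Rightarrow> 'v \<Rightarrow> 'v set" where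
  "sec J v = {w \<in> V. hsame J v w}"

lemma sec_eq_iff: "J \<in> hyps \<Longrightarrow> v \<in> V \<Longrightarrow> w \<in> V \<Longrightarrow> sec J v = sec J w \<longleftrightarrow> hsame J v w"
  unfolding sec_def using hsame_refl hsame_sym hsame_trans by blast

lemma gate_reach:
  assumes J: "J \<in> hyps" "{x, y} \<in> J"
  shows "v \<in> V \<Longrightarrow> gate (ecl x y) v p \<Longrightarrow> (v, p) \<in> (adj (X\<lparr>edges := edges X - J\<rparr>))\<^sup>*"
proof (induction "d p v" arbitrary: v)
  case 0
  have xy: "x \<sim> y" using hyp_edge J by blast
  have "p \<in> V" using 0 ecl_V[OF xy] by (auto simp: gate_def)
  then have "p = v" using d_eq_0 0 by auto
  then show ?case by simp
next
  case (Suc n)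
  have xy: "x \<sim> y" using hyp_edge J by blast
  have pV: "p \<in> V" using Suc ecl_V[OF xy] by (auto simp: gate_def)
  obtain w where w: "v \<sim> w" "d p w = n" "w \<in> V" using d_step_nb[OF pV Suc.prems(1)] Suc.hyps(2) by metis
  have g: "gate (ecl x y) w p"
    using gate_step[OF xy Suc.prems(2,1) w(3)] w Suc.hyps(2) d_sym pV Suc.prems(1) d_nb[OF w(1)] by simp
  then have "(w, p) \<in> (adj (X\<lparr>edges := edges X - J\<rparr>))\<^sup>*" using Suc.hyps(1)[of w] w by simp
  moreover have "hsame J v w" using hsame_iff[OF J Suc.prems(1) w(3)] g Suc.prems(2) unfolding same_def by blast
  then have "(v, w) \<in> adj (X\<lparr>edges := edges X - J\<rparr>)"
    using hyp_crossing[OF J(1) w(1)] w(1) by (simp add: adj_def)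
  ultimately show ?case by (rule converse_rtrancl_into_rtrancl[rotated])
qed

text \<open>Edges outside \<open>J\<close> do not change the side. Conversely, two vertices on one
  side have a common gate, and by \<open>gate_reach\<close> both are joined to it without using
  edges of \<open>J\<close>.\<close>

lemma sectors_eq:
  assumes J: "J \<in> hyps" shows "sectors X J = sec J ` V"
proof -
  define Z where "Z = X\<lparr>edges := edges X - J\<rparr>"
  have "(adj Z)\<^sup>* `` {v} = sec J v" if v: "v \<in> V" for v
  proof safe
    fix w assume "(v, w) \<in> (adj Z)\<^sup>*"
    then show "w \<in> sec J v"
    proof (induction rule: rtrancl_induct)
      case base
      then show ?case using v hsame_refl J by (simp add: sec_def)
    next
      case (step w u)
      then have wu: "w \<sim> u" "{w, u} \<notin> J" by (auto simp: adj_def Z_def)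
      then have "hsame J w u" using hyp_crossing[OF J] by blast
      moreover have "hsame J v w" using step.IH by (simp add: sec_def)
      ultimately have "hsame J v u" using hsame_trans[OF J v nb_V(1)[OF wu(1)] nb_V(2)[OF wu(1)]] by blast
      then show ?case using nb_V[OF wu(1)] by (simp add: sec_def)
    qed
  next
    fix w assume w: "w \<in> sec J v"
    obtain x y where xy: "x \<sim> y" "{x, y} \<in> J" using hyp_nonempty[OF J] .
    obtain p where p: "gate (ecl x y) v p" "gate (ecl x y) w p"
      using w hsame_iff[OF J xy(2) v] by (auto simp: sec_def same_def)
    have "sym (adj Z)" by (auto simp: sym_def adj_def insert_commute)
    then have "sym ((adj Z)\<^sup>*)" by (rule sym_rtrancl)
    then have "(p, w) \<in> (adj Z)\<^sup>*"
      using gate_reach[OF J xy(2) _ p(2)] w unfolding sym_def Z_def by (auto simp: sec_def)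
    then show "(v, w) \<in> (adj Z)\<^sup>*"
      using gate_reach[OF J xy(2) v p(1)] unfolding Z_def by (meson rtrancl_trans)
  qed
  then show ?thesis unfolding sectors_def connected_components_def quotient_def Z_def[symmetric]
    by (auto simp: Z_def)
qed

subsection \<open>Cliques in a hyperplane\<close>

lemma clique_ecl:
  assumes J: "J \<in> hyps" "{x, y} \<in> J"
  shows "clique X (ecl x y)" "edges (induced X (ecl x y)) \<subseteq> J"
proof -
  have xy: "x \<sim> y" using hyp_edge J by blast
  show "clique X (ecl x y)"
    unfolding clique_def Let_def
  proof (intro conjI allI impI)
    show "ecl x y \<subseteq> V" using ecl_V[OF xy] by blast
    show "\<forall>u\<in>ecl x y. \<forall>v\<in>ecl x y. u \<noteq> v \<longrightarrow> u \<sim> v" using ecl_nb[OF xy] by blast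
    fix D assume D: "(D \<subseteq> V \<and> (\<forall>x\<in>D. \<forall>y\<in>D. x \<noteq> y \<longrightarrow> x \<sim> y)) \<and> ecl x y \<subseteq> D"
    then have "x \<in> D" "y \<in> D" using ecl_self[where x = x and y = y] by blast+
    then have "D \<subseteq> ecl x y" using D by (auto simp: ecl_def)
    then show "D = ecl x y" using D by blast
  qed
  show "edges (induced X (ecl x y)) \<subseteq> J"
  proof
    fix e assume "e \<in> edges (induced X (ecl x y))"
    then have e: "e \<in> edges X" "e \<subseteq> ecl x y" by (auto simp: induced_def)
    obtain p q where "e = {p, q}" "p \<sim> q" using edgeE[OF e(1)] .
    then show "e \<in> J" using hyp_clique[OF J, of p q] e(2) nb_V(3)[of p q] by simp
  qed
qed

text \<open>A chain of elementary steps joins the two edges of \<open>J2\<close>; the step that changes sides of \<open>J1\<close> takes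
  place in a convex even cycle, as the edges of a triangle lie on the same side.\<close>
lemma crossing_cycle:
  assumes J1: "J1 \<in> hyps" and J2: "J2 \<in> hyps" "J1 \<noteq> J2"
    and e: "{x, y} \<in> J2" "{u, v} \<in> J2" and n: "\<not> hsame J1 x u"
  obtains k c i j where "ecyc k c" "{c i, c (i + 1)} \<in> J1" "{c j, c (j + 1)} \<in> J2"
proof -
  have in_J1: "hsame J1 a b" if "{a, b} \<in> J2" for a b
  proof -
    have "a \<sim> b" using hyp_edge J2 that by blast
    moreover have "{a, b} \<notin> J1" using hyp_unique[OF J1 J2(1)] J2(2) that by blast
    ultimately show ?thesis using hyp_crossing[OF J1] by blast
  qed
  obtain e0 where e0: "e0 \<in> edges X" "e0 \<in> J2" "\<And>f. f \<in> J2 \<longleftrightarrow> (e0, f) \<in> (edge_rel X)\<^sup>*"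
    using hyp_rel[OF J2(1)] by blast
  obtain x0 y0 where x0: "e0 = {x0, y0}" "x0 \<sim> y0" using edgeE[OF e0(1)] .
  have x0V: "x0 \<in> V" using nb_V x0 by blast
  have xuV: "x \<in> V" "u \<in> V" using hyp_edge[OF J2(1)] e nb_V by blast+
  define side where "side = (\<lambda>f. \<forall>a\<in>f. hsame J1 x0 a)"
  have "\<exists>f f'. (f, f') \<in> edge_rel X \<and> f \<in> J2 \<and> f' \<in> J2 \<and> side f \<and> \<not> side f'"
  proof (rule ccontr)
    assume no: "\<not> (\<exists>f f'. (f, f') \<in> edge_rel X \<and> f \<in> J2 \<and> f' \<in> J2 \<and> side f \<and> \<not> side f')"
    have "side f" if "(e0, f) \<in> (edge_rel X)\<^sup>*" for f
      using that
    proof (induction rule: rtrancl_induct)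
      case base
      then show ?case using in_J1 e0(2) x0 x0V hsame_refl[OF J1] by (auto simp: side_def)
    next
      case (step f f')
      then have "f \<in> J2" "f' \<in> J2" using e0(3) by (auto intro: rtrancl_into_rtrancl)
      then show ?case using no step by blast
    qed
    then have "hsame J1 x0 x" "hsame J1 x0 u" using e0(3) e by (auto simp: side_def)
    then show False using n hsame_trans[OF J1 xuV(1) x0V xuV(2)] hsame_sym by blast
  qed
  then obtain f f' where f: "(f, f') \<in> edge_rel X" "f \<in> J2" "f' \<in> J2" "side f" "\<not> side f'" by blast
  from f(1) show thesis
  proof (cases rule: edge_rel_cases)
    case (1 a b p q)
    have K: "hsame J1 a p" if "p \<in> ecl a b" for p
    proof (cases "p = a")
      case True
      then show ?thesis using hsame_refl[OF J1] nb_V 1 by blast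
    next
      case False
      then show ?thesis using in_J1 hyp_clique[OF J2(1), of a b a p] f(2) 1 that ecl_self by blast
    qed
    have "hsame J1 x0 a" using f(4) 1 by (simp add: side_def)
    then have "hsame J1 x0 p" if "p \<in> ecl a b" for p
      using hsame_trans[OF J1 x0V _ _ _ K[OF that]] nb_V[OF 1(2)] ecl_V[OF 1(2) that] by blast
    then show thesis using f(5) 1 by (auto simp: side_def)
  next
    case (2 k c i)
    note CV = ecyc_V[OF 2(1)]
    have s: "hsame J1 x0 (c i)" using f(4) 2 by (simp add: side_def)
    have ex: "\<exists>j. {c j, c (j + 1)} \<in> J1"
    proof (rule ccontr)
      assume "\<not> (\<exists>j. {c j, c (j + 1)} \<in> J1)"
      then have st: "hsame J1 (c j) (c (j + 1))" for j using hyp_crossing[OF J1 ecyc_nb(1)[OF 2(1)]] by blast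
      have all: "hsame J1 x0 (c (i + int m))" for m
      proof (induction m)
        case (Suc m)
        have "i + int (Suc m) = i + int m + 1" by simp
        then show ?case using hsame_trans[OF J1 x0V CV CV Suc st] by metis
      qed (use s in simp)
      have "side f'"
        using all[of "nat k"] all[of "nat (k + 1)"] ecyc_k[OF 2(1)] 2(3) by (simp add: side_def algebra_simps)
      then show False using f by blast
    qed
    then show thesis using that[OF 2(1)] f(2) 2 by blast
  qed
qed

section \<open>How hyperplanes and convex sets meet a convex even cycle\<close>

lemma hyp_opposite:
  assumes "J \<in> hyps" "ecyc k c" "{c i, c (i + 1)} \<in> J"
  shows "{c (i + k), c (i + k + 1)} \<in> J"
proof -
  obtain e where e: "\<And>f. f \<in> J \<longleftrightarrow> (e, f) \<in> (edge_rel X)\<^sup>*"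
    using hyp_rel[OF assms(1)] by blast
  then have "(e, {c i, c (i + 1)}) \<in> (edge_rel X)\<^sup>*" using assms(3) by blast
  then have "(e, {c (i + k), c (i + k + 1)}) \<in> (edge_rel X)\<^sup>*"
    using edge_rel_opposite[OF assms(2)] by (rule rtrancl_into_rtrancl)
  then show ?thesis using e by blast
qed

lemma hyps_disjoint: "J \<in> hyps \<Longrightarrow> J' \<in> hyps \<Longrightarrow> J \<noteq> J' \<Longrightarrow> {u, v} \<in> J \<Longrightarrow> hsame J' u v"
  using hyp_unique hyp_crossing hyp_edge by metis

text \<open>A cycle that leaves \<open>C\<close> after index \<open>a\<close> cannot be in
  \<open>C\<close> again at most \<open>k\<close> steps later: that arc is a geodesic, so convexity
  would put \<open>c (a + 1)\<close> into \<open>C\<close>. Of two distinct exits, one follows the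
  other within \<open>k\<close> steps of the cyclic order.\<close>

lemma exit_unique:
  assumes c: "ecyc k c" and C: "convex_subgraph X C"
    and i: "c i \<in> C" "c (i + 1) \<notin> C" "c i' \<in> C" "c (i' + 1) \<notin> C"
  shows "c i' = c i" "c (i' + 1) = c (i + 1)"
proof -
  note V = ecyc_V[OF c]
  have k: "2 \<le> k" using ecyc_k[OF c] .
  have seg: False if s: "c a \<in> C" "c (a + 1) \<notin> C" "c (a + s) \<in> C" "1 \<le> s" "s \<le> k" for a s
  proof -
    have "int (d (c a) (c (a + s))) = s" "int (d (c a) (c (a + 1))) = 1" "int (d (c (a + 1)) (c (a + s))) = s - 1"
      using ecyc_d(1)[OF c, of s a] ecyc_d(1)[OF c, of 1 a] ecyc_d(1)[OF c, of "s - 1" "a + 1"] s k by auto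
    then have "d (c a) (c (a + s)) = d (c a) (c (a + 1)) + d (c (a + 1)) (c (a + s))" by linarith
    then show False using convexD[OF C s(1,3) V] s(2) by blast
  qed
  define t where "t = (i' - i) mod (2 * k)"
  have t: "0 \<le> t" "t < 2 * k" "2 * k dvd i' - (i + t)" using k
    unfolding t_def by (auto simp: diff_diff_add[symmetric])
  have e: "c (i' + s) = c (i + t + s)" for s using t(3) by (simp add: ecyc_eq[OF c])
  have "t = 0"
  proof (rule ccontr)
    assume "t \<noteq> 0"
    show False
    proof (cases "t \<le> k")
      case True
      then show False using seg[OF i(1,2), of t] e[of 0] i(3) t \<open>t \<noteq> 0\<close> by simp
    next
      case False
      have "c (i' + (2 * k - t)) = c i" using e[of "2 * k - t"] ecyc_periodic(1)[OF c, of i] by simp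
      then show False using seg[OF i(3,4), of "2 * k - t"] i(1) False t by simp
    qed
  qed
  then show "c i' = c i" "c (i' + 1) = c (i + 1)" using e[of 0] e[of 1] by auto
qed

lemma entry_unique:
  assumes c: "ecyc k c" and C: "convex_subgraph X C"
    and i: "c i \<notin> C" "c (i + 1) \<in> C" "c i' \<notin> C" "c (i' + 1) \<in> C"
  shows "c i' = c i" "c (i' + 1) = c (i + 1)"
  using exit_unique[OF ecyc_reflect[OF c] C, of "- (i + 1)" "- (i' + 1)"] i by (simp_all add: add.commute)

lemma exit_ex:
  assumes c: "ecyc k c" and i: "c 0 \<in> C" "c i \<notin> C"
  obtains j where "c j \<in> C" "c (j + 1) \<notin> C"
proof -
  have k: "0 < k" using ecyc_k[OF c] by simp
  \<comment> \<open>\<open>i\<close> is replaced by a nonnegative index of the same vertex, so that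
    induction on natural numbers applies.\<close>
  have "\<bar>i\<bar> \<le> 2 * k * \<bar>i\<bar>" using k mult_right_mono[of 1 "2 * k" "\<bar>i\<bar>"] by simp
  then have "0 \<le> i + 2 * k * \<bar>i\<bar>" by linarith
  then obtain m where m: "i + 2 * k * \<bar>i\<bar> = int m" using nonneg_int_cases by blast
  have "int m - i = 2 * k * \<bar>i\<bar>" using m by linarith
  then have "c (int m) = c i" using ecyc_eq[OF c] by simp
  then have "c (int m) \<notin> C" using i(2) by simp
  have "\<exists>j. c j \<in> C \<and> c (j + 1) \<notin> C"
  proof (rule ccontr)
    assume no: "\<not> (\<exists>j. c j \<in> C \<and> c (j + 1) \<notin> C)"
    have "c (int n) \<in> C" for n
    proof (induction n)
      case (Suc n)
      then show ?case using no by (auto simp: add.commute)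
    qed (use i in simp)
    then show False using \<open>c (int m) \<notin> C\<close> by blast
  qed
  then show thesis using that by blast
qed

end

section \<open>Rotative stabilisers\<close>

locale rot_action = mediangle_graph X + group G
  for X :: "'v sgraph" and G :: "'g monoid" (structure) +
  fixes \<phi> :: "'g \<Rightarrow> 'v \<Rightarrow> 'v" and \<J> :: "'v set set set"
  assumes act: "graph_action G X \<phi>"
    and \<J>_hyps: "\<J> \<subseteq> hyperplanes X"
    and \<J>_inv: "invariant_collection G \<phi> \<J>"
    and \<J>_rot: "\<And>J. J \<in> \<J> \<Longrightarrow> permutes_sectors_freely_transitively G X \<phi> J"
begin

abbreviation hact :: "'g \<Rightarrow> 'v set set \<Rightarrow> 'v set set" where "hact g J \<equiv> image (\<phi> g) ` J"
abbreviation R where "R J \<equiv> rot_stab G X \<phi> J"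

lemma ga: "group_action G V \<phi>"
  using act by (simp add: graph_action_def)

lemma act_V [simp]: "g \<in> carrier G \<Longrightarrow> v \<in> V \<Longrightarrow> \<phi> g v \<in> V"
  using group_action.element_image[OF ga] by blast

lemma act_mult: "g \<in> carrier G \<Longrightarrow> h \<in> carrier G \<Longrightarrow> v \<in> V \<Longrightarrow> \<phi> (g \<otimes> h) v = \<phi> g (\<phi> h v)"
  using group_action.composition_rule[OF ga] by blast

lemma act_one [simp]: "v \<in> V \<Longrightarrow> \<phi> \<one> v = v"
  using group_action.id_eq_one[OF ga] by (metis restrict_apply)

lemma act_inv [simp]: "g \<in> carrier G \<Longrightarrow> v \<in> V \<Longrightarrow> \<phi> (inv g) (\<phi> g v) = v"
  "g \<in> carrier G \<Longrightarrow> v \<in> V \<Longrightarrow> \<phi> g (\<phi> (inv g) v) = v"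
  using act_mult[of "inv g" g v] act_mult[of g "inv g" v] by simp_all

lemma act_inj: "g \<in> carrier G \<Longrightarrow> v \<in> V \<Longrightarrow> w \<in> V \<Longrightarrow> \<phi> g v = \<phi> g w \<longleftrightarrow> v = w"
  by (metis act_inv(1))

lemma act_nb: "g \<in> carrier G \<Longrightarrow> x \<in> V \<Longrightarrow> y \<in> V \<Longrightarrow> \<phi> g x \<sim> \<phi> g y \<longleftrightarrow> x \<sim> y"
  using act unfolding graph_action_def graph_iso_def by blast

lemma act_nbI: "g \<in> carrier G \<Longrightarrow> x \<sim> y \<Longrightarrow> \<phi> g x \<sim> \<phi> g y"
  using act_nb nb_V by blast

lemma act_d_le:
  assumes g: "g \<in> carrier G" and x: "x \<in> V"
  shows "y \<in> V \<Longrightarrow> d (\<phi> g x) (\<phi> g y) \<le> d x y"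
proof (induction "d x y" arbitrary: y)
  case 0
  then show ?case using d_eq_0 x by auto
next
  case (Suc n)
  then obtain z where z: "y \<sim> z" "d x z = n" "z \<in> V" using d_step_nb[OF x Suc.prems] by metis
  then have "d (\<phi> g x) (\<phi> g z) \<le> n" using Suc.hyps(1)[of z] by simp
  then show ?case using d_nb_le(1)[OF act_nbI[OF g z(1)], of "\<phi> g x"] g x Suc.hyps(2) by simp
qed

lemma act_d: "g \<in> carrier G \<Longrightarrow> x \<in> V \<Longrightarrow> y \<in> V \<Longrightarrow> d (\<phi> g x) (\<phi> g y) = d x y"
  using act_d_le[of g x y] act_d_le[of "inv g" "\<phi> g x" "\<phi> g y"] by (simp add: le_antisym)

lemma act_ecl_iff:
  assumes "g \<in> carrier G" "x \<in> V" "y \<in> V" "z \<in> V"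
  shows "\<phi> g z \<in> ecl (\<phi> g x) (\<phi> g y) \<longleftrightarrow> z \<in> ecl x y"
  using assms act_nb act_inj by (simp add: ecl_def)

lemma act_ecl:
  assumes "g \<in> carrier G" "x \<sim> y" shows "\<phi> g ` ecl x y = ecl (\<phi> g x) (\<phi> g y)"
proof safe
  note V = nb_V[OF assms(2)]
  show "\<phi> g z \<in> ecl (\<phi> g x) (\<phi> g y)" if "z \<in> ecl x y" for z
    using act_ecl_iff[OF assms(1) V(1,2), of z] ecl_V[OF assms(2)] that by blast
  fix z assume z: "z \<in> ecl (\<phi> g x) (\<phi> g y)"
  have zV: "z \<in> V" using ecl_V[OF act_nbI[OF assms] z] .
  then have "\<phi> (inv g) z \<in> ecl x y"
    using act_ecl_iff[OF assms(1) V(1,2), of "\<phi> (inv g) z"] z assms(1) by simp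
  then show "z \<in> \<phi> g ` ecl x y" using zV assms(1) by (metis act_inv(2) imageI)
qed

lemma act_gate:
  assumes g: "g \<in> carrier G" and xy: "x \<sim> y" and v: "v \<in> V" and p: "gate (ecl x y) v p"
  shows "gate (ecl (\<phi> g x) (\<phi> g y)) (\<phi> g v) (\<phi> g p)"
  using p ecl_V[OF xy] unfolding gate_def act_ecl[OF g xy, symmetric] by (auto simp: act_d g v)

lemma act_same:
  assumes "g \<in> carrier G" "x \<sim> y" "v \<in> V" "w \<in> V" "same (ecl x y) v w"
  shows "same (ecl (\<phi> g x) (\<phi> g y)) (\<phi> g v) (\<phi> g w)"
  using assms act_gate unfolding same_def by blast

lemma act_hact: "g \<in> carrier G \<Longrightarrow> J \<in> \<J> \<Longrightarrow> hact g J \<in> \<J>"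
  using \<J>_inv by (simp add: invariant_collection_def)

lemma \<J>_hyp: "J \<in> \<J> \<Longrightarrow> J \<in> hyps"
  using \<J>_hyps by blast

lemma hactI: "{x, y} \<in> J \<Longrightarrow> {\<phi> g x, \<phi> g y} \<in> hact g J"
  by (metis image_empty image_insert imageI)

lemma hact_mult:
  assumes "g \<in> carrier G" "h \<in> carrier G" "J \<in> \<J>" shows "hact (g \<otimes> h) J = hact g (hact h J)"
proof -
  have "\<phi> (g \<otimes> h) ` e = \<phi> g ` \<phi> h ` e" if e: "e \<in> J" for e
  proof -
    obtain x y where "e = {x, y}" "x \<sim> y" using edgeE[OF hyp_edge[OF \<J>_hyp[OF assms(3)] e]] .
    then show ?thesis using act_mult[OF assms(1,2)] nb_V by simp
  qed
  then show ?thesis by (auto simp: image_image image_iff)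
qed

lemma hact_one: assumes "J \<in> \<J>" shows "hact \<one> J = J"
proof -
  have "\<phi> \<one> ` e = e" if e: "e \<in> J" for e
  proof -
    obtain x y where "e = {x, y}" "x \<sim> y" using edgeE[OF hyp_edge[OF \<J>_hyp[OF assms] e]] .
    then show ?thesis using nb_V by simp
  qed
  then show ?thesis by (auto simp: image_iff)
qed

lemma hact_inv: "g \<in> carrier G \<Longrightarrow> J \<in> \<J> \<Longrightarrow> hact (inv g) (hact g J) = J"
  "g \<in> carrier G \<Longrightarrow> J \<in> \<J> \<Longrightarrow> hact g (hact (inv g) J) = J"
  using hact_mult[of "inv g" g J] hact_mult[of g "inv g" J] hact_one by simp_all

lemma act_hsame0:
  assumes g: "g \<in> carrier G" and J: "J \<in> \<J>" and v: "v \<in> V" "w \<in> V" and h: "hsame J v w"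
  shows "hsame (hact g J) (\<phi> g v) (\<phi> g w)"
proof -
  obtain x y where xy: "x \<sim> y" "{x, y} \<in> J" using hyp_nonempty[OF \<J>_hyp[OF J]] .
  have "same (ecl x y) v w" using hsame_iff[OF \<J>_hyp[OF J] xy(2) v] h by simp
  then have "same (ecl (\<phi> g x) (\<phi> g y)) (\<phi> g v) (\<phi> g w)" using act_same[OF g xy(1) v] by blast
  then show ?thesis
    using hsame_iff[OF \<J>_hyp[OF act_hact[OF g J]] hactI[OF xy(2)]] g v by simp
qed

lemma act_hsame:
  assumes g: "g \<in> carrier G" and J: "J \<in> \<J>" and v: "v \<in> V" "w \<in> V"
  shows "hsame (hact g J) (\<phi> g v) (\<phi> g w) \<longleftrightarrow> hsame J v w"
  using act_hsame0[OF g J v] act_hsame0[OF inv_closed[OF g] act_hact[OF g J], of "\<phi> g v" "\<phi> g w"]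
    hact_inv[OF g J] g v by auto

lemma hactD:
  assumes "g \<in> carrier G" "J \<in> \<J>" "x \<in> V" "y \<in> V" "{\<phi> g x, \<phi> g y} \<in> hact g J"
  shows "{x, y} \<in> J"
  using hactI[OF assms(5), of "inv g"] hact_inv[OF assms(1,2)] assms(1,3,4) by simp

lemma act_ecyc:
  assumes g: "g \<in> carrier G" and c: "ecyc k c" shows "ecyc k (\<lambda>i. \<phi> g (c i))"
proof -
  note V = ecyc_V[OF c]
  have "convex_subgraph X (range (\<lambda>i. \<phi> g (c i)))"
    unfolding convex_subgraph_def
  proof (intro conjI ballI subsetI)
    show "x \<in> V" if "x \<in> range (\<lambda>i. \<phi> g (c i))" for x using that V g by auto
    fix x y z assume "x \<in> range (\<lambda>i. \<phi> g (c i))" "y \<in> range (\<lambda>i. \<phi> g (c i))" "z \<in> ival X x y"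
    then obtain i j where ij: "x = \<phi> g (c i)" "y = \<phi> g (c j)" and z: "z \<in> V" "d x y = d x z + d z y"
      by (auto simp: ival_iff)
    have zz: "z = \<phi> g (\<phi> (inv g) z)" using g z by simp
    have "d (c i) (c j) = d (c i) (\<phi> (inv g) z) + d (\<phi> (inv g) z) (c j)"
      using z act_d[OF g V[of i] V[of j]] act_d[OF g V[of i], of "\<phi> (inv g) z"]
        act_d[OF g _ V[of j], of "\<phi> (inv g) z"] g unfolding ij by simp
    then have "\<phi> (inv g) z \<in> range c" using convexD[OF ecyc_convex[OF c] rangeI rangeI] g z by simp
    then show "z \<in> range (\<lambda>i. \<phi> g (c i))" using zz by (metis image_iff rangeI)
  qed
  then show ?thesis using c act_inj[OF g V V] act_nb[OF g V V] unfolding ecyc_def by blast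
qed

subsection \<open>The rotation groups\<close>

lemma R_iff: "r \<in> R J \<longleftrightarrow> r \<in> carrier G \<and>
    (\<forall>C. clique X C \<and> edges (induced X C) \<subseteq> J \<longrightarrow> \<phi> r ` C = C)"
  unfolding rot_stab_def set_stab_def stabilizer_def by auto

lemma R_carrier: "r \<in> R J \<Longrightarrow> r \<in> carrier G"
  by (simp add: R_iff)

lemma clique_V: "clique X C \<Longrightarrow> C \<subseteq> V"
  by (simp add: clique_def Let_def)

lemma R_subgroup: "subgroup (R J) G"
proof (rule subgroupI)
  show "R J \<subseteq> carrier G" using R_carrier by blast
  have "\<phi> \<one> ` C = C" if "clique X C" for C using clique_V[OF that] by (auto simp: image_iff subset_iff)
  then show "R J \<noteq> {}" using R_iff one_closed by (metis empty_iff)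
next
  fix a assume a: "a \<in> R J"
  have "\<phi> (inv a) ` C = C" if C: "clique X C" "edges (induced X C) \<subseteq> J" for C
  proof -
    have "\<phi> a ` C = C" using a C by (simp add: R_iff)
    then have "\<phi> (inv a) ` C = \<phi> (inv a) ` \<phi> a ` C" by simp
    also have "\<dots> = C" using clique_V[OF C(1)] R_carrier[OF a] by (force simp: image_iff)
    finally show ?thesis .
  qed
  then show "inv a \<in> R J" using R_carrier[OF a] by (simp add: R_iff)
next
  fix a b assume ab: "a \<in> R J" "b \<in> R J"
  have "\<phi> (a \<otimes> b) ` C = C" if C: "clique X C" "edges (induced X C) \<subseteq> J" for C
  proof -
    have "\<phi> (a \<otimes> b) ` C = \<phi> a ` \<phi> b ` C"
      using clique_V[OF C(1)] R_carrier ab act_mult[of a b] by (force simp: image_iff subset_iff)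
    then show ?thesis using ab C by (simp add: R_iff)
  qed
  then show "a \<otimes> b \<in> R J" using R_carrier ab by (simp add: R_iff)
qed

lemma R_one: "\<one> \<in> R J" and R_mult: "a \<in> R J \<Longrightarrow> b \<in> R J \<Longrightarrow> a \<otimes> b \<in> R J"
  and R_inv: "a \<in> R J \<Longrightarrow> inv a \<in> R J"
  using R_subgroup[of J] by (auto simp: subgroup.one_closed subgroup.m_closed subgroup.m_inv_closed)

lemma R_ecl:
  assumes "r \<in> R J" "J \<in> \<J>" "{x, y} \<in> J"
  shows "\<phi> r ` ecl x y = ecl x y"
  using assms clique_ecl[OF \<J>_hyp[OF assms(2)] assms(3)] by (simp add: R_iff)

lemma R_hact: assumes r: "r \<in> R J" and J: "J \<in> \<J>" shows "hact r J = J"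
proof -
  obtain x y where xy: "x \<sim> y" "{x, y} \<in> J" using hyp_nonempty[OF \<J>_hyp[OF J]] .
  have "\<phi> r x \<in> ecl x y" "\<phi> r y \<in> ecl x y"
    using R_ecl[OF r J xy(2)] ecl_self(1)[of x y] ecl_self(2)[of y x] by blast+
  moreover have "\<phi> r x \<noteq> \<phi> r y" using act_inj[OF R_carrier[OF r]] nb_V[OF xy(1)] by simp
  ultimately have "{\<phi> r x, \<phi> r y} \<in> J" using hyp_clique[OF \<J>_hyp[OF J] xy(2)] by blast
  then show ?thesis
    using hyp_unique[OF \<J>_hyp[OF act_hact[OF R_carrier[OF r] J]] \<J>_hyp[OF J] hactI[OF xy(2)]] by blast
qed

lemma R_sec:
  assumes r: "r \<in> R J" and J: "J \<in> \<J>" and v: "v \<in> V"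
  shows "\<phi> r ` sec J v = sec J (\<phi> r v)"
proof
  note rG = R_carrier[OF r]
  show "\<phi> r ` sec J v \<subseteq> sec J (\<phi> r v)"
    using act_hsame[OF rG J v] R_hact[OF r J] rG by (auto simp: sec_def)
  show "sec J (\<phi> r v) \<subseteq> \<phi> r ` sec J v"
  proof
    fix w assume w: "w \<in> sec J (\<phi> r v)"
    then have "\<phi> (inv r) w \<in> sec J v"
      using act_hsame[OF rG J v, of "\<phi> (inv r) w"] R_hact[OF r J] rG by (simp add: sec_def)
    then show "w \<in> \<phi> r ` sec J v" using w rG by (metis (no_types, lifting) act_inv(2) imageI mem_Collect_eq sec_def)
  qed
qed

text \<open>Freeness on sectors in terms of vertices: a rotation permutes the sectors of
  \<open>J\<close>, so one that keeps a vertex in its sector fixes that sector.\<close>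

lemma R_free:
  assumes r: "r \<in> R J" and J: "J \<in> \<J>" and v: "v \<in> V" and h: "hsame J v (\<phi> r v)"
  shows "r = \<one>"
proof -
  have sec: "sec J v \<in> sectors X J" using v sectors_eq[OF \<J>_hyp[OF J]] by simp
  have "\<phi> r ` sec J v = sec J v"
    using R_sec[OF r J v] sec_eq_iff[OF \<J>_hyp[OF J], of v "\<phi> r v"] h v R_carrier[OF r] by simp
  then have "r \<in> stabilizer (G\<lparr>carrier := R J\<rparr>) (\<lambda>g. restrict (image (\<phi> g)) (sectors X J)) (sec J v)"
    using r sec by (simp add: stabilizer_def)
  moreover have "stabilizer (G\<lparr>carrier := R J\<rparr>) (\<lambda>g. restrict (image (\<phi> g)) (sectors X J)) (sec J v) = {\<one>}"
    using \<J>_rot[OF J] sec unfolding permutes_sectors_freely_transitively_def free_action_def Let_def by simp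
  ultimately show ?thesis by simp
qed

lemma R_trans:
  assumes J: "J \<in> \<J>" and v: "v \<in> V" "w \<in> V"
  shows "\<exists>r\<in>R J. hsame J (\<phi> r v) w"
proof -
  have sec: "sec J v \<in> sectors X J" "sec J w \<in> sectors X J" using v sectors_eq[OF \<J>_hyp[OF J]] by auto
  have "transitive_action (G\<lparr>carrier := R J\<rparr>) (sectors X J) (\<lambda>g. restrict (image (\<phi> g)) (sectors X J))"
    using \<J>_rot[OF J] by (simp add: permutes_sectors_freely_transitively_def Let_def)
  from transitive_action.unique_orbit[OF this sec] obtain r where r: "r \<in> R J" "\<phi> r ` sec J v = sec J w"
    using sec by auto
  then have "sec J (\<phi> r v) = sec J w" using R_sec[OF r(1) J v(1)] by simp
  then show ?thesis using sec_eq_iff[OF \<J>_hyp[OF J], of "\<phi> r v" w] r(1) v R_carrier[OF r(1)] by auto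
qed

lemma R_move:
  assumes "r \<in> R J" "J \<in> \<J>" "r \<noteq> \<one>" "v \<in> V" shows "\<not> hsame J v (\<phi> r v)" "\<phi> r v \<noteq> v"
  using R_free[OF assms(1,2,4)] assms(3) hsame_refl[OF \<J>_hyp[OF assms(2)] assms(4)] by auto

text \<open>Transitivity moves \<open>x\<close> into the sector of \<open>y\<close>. The rotation
  also preserves the clique of the edge, whose vertices lie in different sectors, so the image is
  \<open>y\<close>.\<close>

lemma R_edge:
  assumes J: "J \<in> \<J>" and e: "{x, y} \<in> J" shows "\<exists>r\<in>R J. r \<noteq> \<one> \<and> \<phi> r x = y"
proof -
  have xy: "x \<sim> y" using hyp_edge[OF \<J>_hyp[OF J] e] .
  obtain r where r: "r \<in> R J" "hsame J (\<phi> r x) y" using R_trans[OF J nb_V(1,2)[OF xy]] by blast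
  have "\<phi> r x \<in> ecl x y" using R_ecl[OF r(1) J e] ecl_self(1)[of x y] by blast
  have "\<phi> r x = y"
  proof (rule ccontr)
    assume ne: "\<phi> r x \<noteq> y"
    have "{\<phi> r x, y} \<in> J" using hyp_clique[OF \<J>_hyp[OF J] e \<open>\<phi> r x \<in> ecl x y\<close> ecl_self(2) ne] .
    then show False using hyp_crossing[OF \<J>_hyp[OF J], of "\<phi> r x" y] r(2) hyp_edge[OF \<J>_hyp[OF J]] by blast
  qed
  moreover have "r \<noteq> \<one>" using \<open>\<phi> r x = y\<close> nb_V[OF xy] by auto
  ultimately show ?thesis using r(1) by blast
qed

lemma R_edge_moved:
  assumes r: "r \<in> R J" "J \<in> \<J>" "r \<noteq> \<one>" and e: "{x, y} \<in> J"
  shows "{x, \<phi> r x} \<in> J" "\<phi> r x \<in> ecl x y"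
proof -
  have xy: "x \<sim> y" using hyp_edge[OF \<J>_hyp[OF r(2)] e] .
  show "\<phi> r x \<in> ecl x y" using R_ecl[OF r(1,2) e] ecl_self(1)[of x y] by blast
  then show "{x, \<phi> r x} \<in> J"
    using hyp_clique[OF \<J>_hyp[OF r(2)] e ecl_self(1), of "\<phi> r x"] R_move(2)[OF r nb_V(1)[OF xy]] by metis
qed

lemma R_eq:
  assumes "r \<in> R J" "s \<in> R J" "J \<in> \<J>" "v \<in> V" "\<phi> r v = \<phi> s v" shows "r = s"
proof -
  note c = R_carrier[OF assms(1)] R_carrier[OF assms(2)]
  have "\<phi> (inv s \<otimes> r) v = v" using c assms act_mult[of "inv s" r v] by simp
  then have "inv s \<otimes> r = \<one>"
    using R_free[OF R_mult[OF R_inv[OF assms(2)] assms(1)] assms(3,4)] hsame_refl \<J>_hyp assms(3,4) by simp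
  then show ?thesis using c by (metis inv_equality inv_inv inv_closed)
qed

text \<open>A non-trivial rotation around \<open>J\<close> moves an end of a \<open>J\<close>-edge
  along a \<open>J\<close>-edge. This does not cross \<open>J'\<close>, so freeness for
  \<open>J'\<close> makes the element trivial.\<close>

lemma R_inter:
  assumes "J \<in> \<J>" "J' \<in> \<J>" "J \<noteq> J'" "r \<in> R J" "r \<in> R J'" shows "r = \<one>"
proof (rule ccontr)
  assume r: "r \<noteq> \<one>"
  obtain x y where xy: "x \<sim> y" "{x, y} \<in> J" using hyp_nonempty[OF \<J>_hyp[OF assms(1)]] .
  note xV = nb_V(1)[OF xy(1)]
  have e: "{x, \<phi> r x} \<in> J" using R_edge_moved[OF assms(4,1) r xy(2)] by blast
  then have "{x, \<phi> r x} \<notin> J'" using hyp_unique \<J>_hyp assms(1-3) by blast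
  then have "hsame J' x (\<phi> r x)"
    using hyp_crossing[OF \<J>_hyp[OF assms(2)]] hyp_edge[OF \<J>_hyp[OF assms(1)] e] by blast
  then show False using R_free[OF assms(5,2) xV] r by blast
qed

lemma R_nontrivial: "J \<in> \<J> \<Longrightarrow> \<exists>r\<in>R J. r \<noteq> \<one>"
  using hyp_nonempty[OF \<J>_hyp] R_edge by metis

lemma R_neq: "J \<in> \<J> \<Longrightarrow> J' \<in> \<J> \<Longrightarrow> J \<noteq> J' \<Longrightarrow> R J \<noteq> R J'"
  using R_nontrivial R_inter by metis

lemma act_clique:
  assumes g: "g \<in> carrier G" and C: "clique X C" shows "clique X (\<phi> g ` C)"
  unfolding clique_def Let_def
proof (intro conjI allI impI)
  have CV: "C \<subseteq> V" and Cn: "\<And>x y. x \<in> C \<Longrightarrow> y \<in> C \<Longrightarrow> x \<noteq> y \<Longrightarrow> x \<sim> y"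
    and Cm: "\<And>D. D \<subseteq> V \<Longrightarrow> (\<And>x y. x \<in> D \<Longrightarrow> y \<in> D \<Longrightarrow> x \<noteq> y \<Longrightarrow> x \<sim> y) \<Longrightarrow> C \<subseteq> D \<Longrightarrow> D = C"
    using C unfolding clique_def Let_def by blast+
  show "\<phi> g ` C \<subseteq> V" using CV g by auto
  show "\<forall>x\<in>\<phi> g ` C. \<forall>y\<in>\<phi> g ` C. x \<noteq> y \<longrightarrow> x \<sim> y" using Cn act_nbI[OF g] by auto
  fix D assume D: "(D \<subseteq> V \<and> (\<forall>x\<in>D. \<forall>y\<in>D. x \<noteq> y \<longrightarrow> x \<sim> y)) \<and> \<phi> g ` C \<subseteq> D"
  have DV: "\<And>x. x \<in> D \<Longrightarrow> x \<in> V" and Dn: "\<And>x y. x \<in> D \<Longrightarrow> y \<in> D \<Longrightarrow> x \<noteq> y \<Longrightarrow> x \<sim> y"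
    and CD: "\<And>x. x \<in> C \<Longrightarrow> \<phi> g x \<in> D" using D by blast+
  have "\<phi> (inv g) ` D = C"
  proof (rule Cm)
    show "\<phi> (inv g) ` D \<subseteq> V" using DV g by auto
    fix x y assume "x \<in> \<phi> (inv g) ` D" "y \<in> \<phi> (inv g) ` D" "x \<noteq> y"
    then show "x \<sim> y" using Dn act_nbI[of "inv g"] g by force
  next
    show "C \<subseteq> \<phi> (inv g) ` D"
    proof
      fix x assume "x \<in> C"
      then show "x \<in> \<phi> (inv g) ` D" using CD[of x] act_inv(1)[OF g, of x] CV by (metis imageI subsetD)
    qed
  qed
  then have "\<phi> g ` C = \<phi> g ` \<phi> (inv g) ` D" by simp
  also have "\<dots> = D" using DV act_inv(2)[OF g] by (force simp: image_iff)
  finally show "D = \<phi> g ` C" by simp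
qed

lemma R_conj:
  assumes g: "g \<in> carrier G" and J: "J \<in> \<J>" and r: "r \<in> R J"
  shows "g \<otimes> r \<otimes> inv g \<in> R (hact g J)"
  unfolding R_iff
proof (intro conjI allI impI)
  note rG = R_carrier[OF r]
  show "g \<otimes> r \<otimes> inv g \<in> carrier G" using g rG by simp
  fix C assume C: "clique X C \<and> edges (induced X C) \<subseteq> hact g J"
  note CV = clique_V[OF conjunct1[OF C]]
  define D where "D = \<phi> (inv g) ` C"
  have D: "clique X D" using act_clique[OF inv_closed[OF g]] C by (simp add: D_def)
  have gD: "\<phi> g ` D = C" using CV act_inv(2)[OF g] unfolding D_def by (force simp: image_iff)
  have "edges (induced X D) \<subseteq> J"
  proof
    fix e assume "e \<in> edges (induced X D)"
    then have e: "e \<in> edges X" "e \<subseteq> D" by (auto simp: induced_def)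
    obtain x y where xy: "e = {x, y}" "x \<sim> y" using edgeE[OF e(1)] .
    have "{\<phi> g x, \<phi> g y} \<in> edges (induced X C)"
      using act_nbI[OF g xy(2)] e xy gD by (auto simp: induced_def)
    then have "{\<phi> g x, \<phi> g y} \<in> hact g J" using C by blast
    then show "e \<in> J" using hactD[OF g J] nb_V[OF xy(2)] xy by blast
  qed
  then have rD: "\<phi> r ` D = D" using r D by (simp add: R_iff)
  have "\<phi> (g \<otimes> r \<otimes> inv g) v = \<phi> g (\<phi> r (\<phi> (inv g) v))" if "v \<in> V" for v
    using act_mult g rG that by simp
  then have "\<phi> (g \<otimes> r \<otimes> inv g) ` C = \<phi> g ` \<phi> r ` D"
    using CV unfolding D_def by (auto simp: image_image subset_iff cong: image_cong)
  then show "\<phi> (g \<otimes> r \<otimes> inv g) ` C = C" using rD gD by simp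
qed

lemma R_conj_eq:
  assumes "g \<in> carrier G" "J \<in> \<J>" "hact g J = J'" "r \<in> R J"
  shows "g \<otimes> r \<otimes> inv g \<in> R J'"
  using R_conj[OF assms(1,2,4)] assms(3) by simp

subsection \<open>Rotations and cycles\<close>

text \<open>The edge from \<open>x\<close> to \<open>w\<close> and its image under \<open>a\<close>
  are opposite sides of a square whose other sides lie in \<open>J1\<close>. Sides of
  \<open>J1\<close> exclude diagonals, so the square is convex, and the image lies both in
  \<open>J2\<close> and in the translate of \<open>J2\<close>.\<close>

lemma square_stable:
  assumes J: "J1 \<in> \<J>" "J2 \<in> \<J>" "J1 \<noteq> J2"
    and e: "{x, y} \<in> J1" "{w, z} \<in> J1" "{x, w} \<in> J2" and a: "a \<in> R J1"
  shows "hact a J2 = J2"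
proof (cases "a = \<one>")
  case True
  then show ?thesis using hact_one J by blast
next
  case False
  note H = \<J>_hyp[OF J(1)] \<J>_hyp[OF J(2)] and aG = R_carrier[OF a]
  have xw: "x \<sim> w" using hyp_edge[OF H(2) e(3)] .
  note V = nb_V(1,2)[OF xw]
  have axw: "\<phi> a x \<sim> \<phi> a w" using act_nbI[OF aG xw] .
  have x1: "{x, \<phi> a x} \<in> J1" "{w, \<phi> a w} \<in> J1"
    using R_edge_moved[OF a J(1) False e(1)] R_edge_moved[OF a J(1) False e(2)] by auto
  have n1: "x \<sim> \<phi> a x" "w \<sim> \<phi> a w" using hyp_edge[OF H(1)] x1 by auto
  have s: "hsame J1 x w" using hyps_disjoint[OF H(2,1) J(3)[symmetric] e(3)] .
  have sa: "hsame J1 (\<phi> a x) (\<phi> a w)" using act_hsame[OF aG J(1) V] R_hact[OF a J(1)] s by simp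
  have ns: "\<not> hsame J1 x (\<phi> a x)" "\<not> hsame J1 w (\<phi> a w)"
    using R_move(1)[OF a J(1) False] V by auto
  have aV: "\<phi> a x \<in> V" "\<phi> a w \<in> V" using V aG by auto
  have d1: "\<not> hsame J1 x (\<phi> a w)" using ns(2) s V aV hsame_trans[OF H(1) V(2) V(1) aV(2)] hsame_sym by blast
  have d2: "\<not> hsame J1 w (\<phi> a x)" using ns(1) s V aV hsame_trans[OF H(1) V(1) V(2) aV(1)] by blast
  have no: "\<not> u \<sim> \<phi> a v" if uv: "u \<sim> \<phi> a u" "\<phi> a u \<sim> \<phi> a v" "{u, \<phi> a u} \<in> J1" "\<not> hsame J1 u (\<phi> a v)"
    "hsame J1 (\<phi> a u) (\<phi> a v)" for u v
  proof
    assume n: "u \<sim> \<phi> a v"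
    then have "\<phi> a v \<in> ecl u (\<phi> a u)" using uv nb_sym by (auto simp: ecl_def)
    then have "{\<phi> a u, \<phi> a v} \<in> J1"
      using hyp_clique[OF H(1) uv(3) ecl_self(2)] nb_V(3)[OF uv(2)] by blast
    then show False using hyp_crossing[OF H(1) uv(2)] uv(5) by blast
  qed
  have i: "\<not> x \<sim> \<phi> a w" "\<not> w \<sim> \<phi> a x"
    using no[OF n1(1) axw x1(1) d1 sa] no[OF n1(2) nb_sym[OF axw] x1(2) d2 hsame_sym[OF sa]] .
  have ne: "x \<noteq> \<phi> a w" "\<phi> a x \<noteq> w" using d1 d2 hsame_refl[OF H(1)] V by metis+
  obtain c where c: "ecyc 2 c" "c 0 = x" "c 1 = \<phi> a x" "c 2 = \<phi> a w" "c 3 = w"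
    using square_convex[OF n1(1) axw nb_sym[OF n1(2)] nb_sym[OF xw] ne i(1)] i(2) nb_sym by metis
  have "{c 3, c (3 + 1)} \<in> J2" using e(3) c ecyc_periodic(1)[OF c(1), of 0] by (simp add: insert_commute)
  from hyp_opposite[OF H(2) c(1) this] have "{\<phi> a x, \<phi> a w} \<in> J2"
    using c ecyc_periodic(1)[OF c(1), of 1] ecyc_periodic(1)[OF c(1), of 2] by simp
  moreover have "{\<phi> a x, \<phi> a w} \<in> hact a J2" using hactI[OF e(3)] .
  ultimately show ?thesis using hyp_unique[OF \<J>_hyp[OF act_hact[OF aG J(2)]] H(2)] by blast
qed

text \<open>The commutator lies in both rotation groups.\<close>
lemma stable_commute:
  assumes J: "J1 \<in> \<J>" "J2 \<in> \<J>" "J1 \<noteq> J2"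
    and a: "a \<in> R J1" and b: "b \<in> R J2" and s: "hact a J2 = J2" "hact (inv b) J1 = J1"
  shows "a \<otimes> b = b \<otimes> a"
proof -
  note G = R_carrier[OF a] R_carrier[OF b]
  have "a \<otimes> b \<otimes> inv a \<in> R J2" using R_conj_eq[OF G(1) J(2) s(1) b] .
  then have 1: "inv b \<otimes> (a \<otimes> b \<otimes> inv a) \<in> R J2" using R_mult[OF R_inv[OF b]] by blast
  have "inv b \<otimes> a \<otimes> inv (inv b) \<in> R J1" using R_conj_eq[OF inv_closed[OF G(2)] J(1) s(2) a] .
  then have 2: "inv b \<otimes> a \<otimes> b \<otimes> inv a \<in> R J1" using R_mult[OF _ R_inv[OF a]] G by simp
  have "inv b \<otimes> (a \<otimes> b \<otimes> inv a) = \<one>" using R_inter[OF J _ 1] 2 G by (simp add: m_assoc)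
  then have "b = a \<otimes> b \<otimes> inv a" using G by (metis inv_equality inv_closed inv_inv m_closed)
  then have "b \<otimes> a = a \<otimes> b \<otimes> inv a \<otimes> a" by simp
  then show ?thesis using G by (simp add: m_assoc)
qed

lemma square_all:
  assumes J: "J1 \<in> \<J>" "J2 \<in> \<J>" "J1 \<noteq> J2" and c: "ecyc 2 c" "{c i, c (i + 1)} \<in> J1" "{c j, c (j + 1)} \<in> J2"
  shows "a \<in> R J1 \<Longrightarrow> hact a J2 = J2" "b \<in> R J2 \<Longrightarrow> hact b J1 = J1"
    "a \<in> R J1 \<Longrightarrow> b \<in> R J2 \<Longrightarrow> a \<otimes> b = b \<otimes> a"
proof -
  note H = \<J>_hyp[OF J(1)] \<J>_hyp[OF J(2)]
  note p = ecyc_periodic[OF c(1)]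
  have 1: "{c (i + 2), c (i + 3)} \<in> J1" using hyp_opposite[OF H(1) c(1,2)] by (simp add: algebra_simps)
  have 2: "{c (j + 2), c (j + 3)} \<in> J2" using hyp_opposite[OF H(2) c(1,3)] by (simp add: algebra_simps)
  \<comment> \<open>The position of the \<open>J1\<close>-edge relative to the
    \<open>J2\<close>-edge. At an even position it would be the \<open>J2\<close>-edge or its
    opposite, and so lie in both hyperplanes.\<close>
  define m where "m = (i - j) mod 4"
  have "4 dvd i - (j + m)" unfolding m_def by (metis diff_diff_add dvd_minus_mod)
  then have e: "c (i + s) = c (j + m + s)" for s using ecyc_eq[OF c(1)] by (simp add: algebra_simps)
  have "m = 0 \<or> m = 1 \<or> m = 2 \<or> m = 3" unfolding m_def by auto
  then have K: "{c (i + 1), c (i + 2)} \<in> J2 \<and> {c i, c (i + 3)} \<in> J2"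
  proof (elim disjE)
    assume "m = 0"
    then have "{c i, c (i + 1)} \<in> J2" using e[of 0] e[of 1] c(3) by simp
    then show ?thesis using hyp_unique[OF H c(2)] J(3) by blast
  next
    assume "m = 2"
    then have "{c i, c (i + 1)} \<in> J2" using e[of 0] e[of 1] 2 by (simp add: algebra_simps)
    then show ?thesis using hyp_unique[OF H c(2)] J(3) by blast
  next
    assume "m = 1"
    then have "c (i + 1) = c (j + 2)" "c (i + 2) = c (j + 3)" "c i = c (j + 1)" "c (i + 3) = c j"
      using e[of 0] e[of 1] e[of 2] e[of 3] p(1)[of j] by (simp_all add: algebra_simps)
    then show ?thesis using 2 c(3) by (simp add: insert_commute)
  next
    assume "m = 3"
    then have "c (i + 1) = c j" "c (i + 2) = c (j + 1)" "c i = c (j + 3)" "c (i + 3) = c (j + 2)"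
      using e[of 0] e[of 1] e[of 2] e[of 3] p(1)[of j] p(1)[of "j + 1"] p(1)[of "j + 2"]
      by (simp_all add: algebra_simps)
    then show ?thesis using 2 c(3) by (simp add: insert_commute)
  qed
  show A: "hact a J2 = J2" if "a \<in> R J1" for a
    by (rule square_stable[OF J c(2) _ _ that, of "c (i + 3)" "c (i + 2)"])
      (use 1 K in \<open>simp_all add: insert_commute\<close>)
  show B: "hact b J1 = J1" if "b \<in> R J2" for b
    by (rule square_stable[OF J(2,1) J(3)[symmetric] _ _ _ that, of "c i" "c (i + 3)" "c (i + 1)" "c (i + 2)"])
      (use c K in \<open>simp_all add: insert_commute\<close>)
  show "a \<otimes> b = b \<otimes> a" if "a \<in> R J1" "b \<in> R J2"
    using stable_commute[OF J that A[OF that(1)] B[OF R_inv[OF that(2)]]] .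
qed

text \<open>The cliques of the edge and of its opposite edge are just these edges, so a non-trivial
  rotation swaps the ends of both. The image cycle therefore shares two edges with the cycle and
  equals it, and \<open>ecyc_match\<close> identifies the action as the reflection.\<close>

lemma long_reflect:
  assumes J: "J \<in> \<J>" and c: "ecyc k c" "3 \<le> k" "{c i, c (i + 1)} \<in> J" and r: "r \<in> R J" "r \<noteq> \<one>"
  shows "\<phi> r (c j) = c (2 * i + 1 - j)"
proof -
  note H = \<J>_hyp[OF J] and rG = R_carrier[OF r(1)] and V = ecyc_V[OF c(1)]
  have sw: "\<phi> r (c i) = c (i + 1)" "\<phi> r (c (i + 1)) = c i"
    if "{c i, c (i + 1)} \<in> J" for i
  proof -
    have "\<phi> r (c i) \<in> {c i, c (i + 1)}" "\<phi> r (c (i + 1)) \<in> {c i, c (i + 1)}"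
      using R_ecl[OF r(1) J that] unfolding long_ecl[OF c(1,2)] by auto
    then show "\<phi> r (c i) = c (i + 1)" "\<phi> r (c (i + 1)) = c i"
      using R_move(2)[OF r(1) J r(2) V] by auto
  qed
  \<comment> \<open>\<open>c1\<close> is the image of the cycle traversed backwards; like
    \<open>c2\<close> it starts at \<open>c i\<close> and continues with
    \<open>c (i + 1)\<close>.\<close>
  define c1 c2 where "c1 = (\<lambda>j. \<phi> r (c (- j + (i + 1))))" and "c2 = (\<lambda>j. c (j + i))"
  have e: "ecyc k c1" "ecyc k c2"
    using act_ecyc[OF rG ecyc_reflect[OF ecyc_shift[OF c(1), of "i + 1"]]] ecyc_shift[OF c(1)]
    by (simp_all add: c1_def c2_def)
  have i2: "{c (i + k), c (i + k + 1)} \<in> J" using hyp_opposite[OF H c(1,3)] .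
  have m: "c i \<in> range c1" "c (i + 1) \<in> range c1" "c (i + k) \<in> range c1" "c (i + k + 1) \<in> range c1"
    using sw[OF c(3)] sw[OF i2] rangeI[of c1 0] rangeI[of c1 1] rangeI[of c1 "-k"] rangeI[of c1 "1-k"]
    by (simp_all add: c1_def algebra_simps)
  have "range c = range c1"
    by (rule ecyc_same[OF c(1) e(1), of "{c i, c (i + 1)}" "{c (i + k), c (i + k + 1)}"])
      (use m ecyc_nb(1)[OF c(1), of i] ecyc_nb(1)[OF c(1), of "i + k"]
        ecyc_ne[OF c(1), of i "i + k"] ecyc_ne[OF c(1), of "i" "i + k + 1"] c(2) in \<open>auto simp: doubleton_eq_iff\<close>)
  moreover have "range c = range c2"
    by (auto simp: c2_def image_iff) (metis diff_add_cancel)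
  moreover have "c1 0 = c2 0" "c1 1 = c2 1" using sw[OF c(3)] by (simp_all add: c1_def c2_def add.commute)
  ultimately have "c1 = c2" using ecyc_match(1)[OF e(2,1)] by blast
  then have "c1 (i + 1 - j) = c2 (i + 1 - j)" by simp
  then show ?thesis by (simp add: c1_def c2_def algebra_simps)
qed

text \<open>All non-trivial rotations act on the cycle by the same reflection, and rotations around
  \<open>J\<close> that agree at one vertex are equal.\<close>

lemma long_order_two:
  assumes "J \<in> \<J>" "ecyc k c" "3 \<le> k" "{c i, c (i + 1)} \<in> J" "r \<in> R J" "r \<noteq> \<one>"
  shows "R J = {\<one>, r}" "r \<otimes> r = \<one>"
proof -
  have eq: "s = r" if "s \<in> R J" "s \<noteq> \<one>" for s
    using R_eq[OF that(1) assms(5,1) ecyc_V[OF assms(2)]] long_reflect[OF assms(1-4)] assms(5,6) that by metis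
  then show "R J = {\<one>, r}" using R_one assms(5) by blast
  have "r \<otimes> r \<noteq> r" using assms(6) R_carrier[OF assms(5)] by simp
  then show "r \<otimes> r = \<one>" using eq R_mult[OF assms(5,5)] by blast
qed

text \<open>A word of odd length alternating in two involutions is a palindrome, hence a conjugate
  of its middle letter, and conjugates of rotations are rotations. The induction goes in steps of
  two, conjugating by \<open>a \<otimes> b\<close>.\<close>

lemma dihedral_conj:
  assumes J: "J1 \<in> \<J>" "J2 \<in> \<J>" and a: "a \<in> R J1" "a \<otimes> a = \<one>" and b: "b \<in> R J2" "b \<otimes> b = \<one>"
    and ne: "a \<noteq> \<one>" "b \<noteq> \<one>"
  shows "\<exists>H\<in>\<J>. (a \<otimes> b) [^] (n::nat) \<otimes> a \<in> R H \<and> (a \<otimes> b) [^] n \<otimes> a \<noteq> \<one>"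
proof (induction n rule: less_induct)
  case (less n)
  note G = R_carrier[OF a(1)] R_carrier[OF b(1)]
  have ia: "inv a = a" "inv b = b" using a b G by (simp_all add: inv_equality)
  consider "n = 0" | "n = 1" | m where "n = m + 2" by (metis One_nat_def Suc_eq_plus1 add_2_eq_Suc' not0_implies_Suc)
  then show ?case
  proof cases
    case 1
    then show ?thesis using a ne J G by auto
  next
    case 2
    have "a \<otimes> b \<otimes> inv a \<in> R (hact a J2)" using R_conj[OF G(1) J(2) b(1)] .
    moreover have "a \<otimes> b \<otimes> inv a \<noteq> \<one>"
    proof
      assume "a \<otimes> b \<otimes> inv a = \<one>"
      then have "a \<otimes> b = a" using G by (metis inv_equality inv_inv inv_closed m_closed)
      then show False using ne G by simp
    qed
    ultimately show ?thesis using 2 ia G act_hact[OF G(1) J(2)] by auto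
  next
    case 3
    define r where "r = (a \<otimes> b) [^] m \<otimes> a"
    obtain H where H: "H \<in> \<J>" "r \<in> R H" "r \<noteq> \<one>" using less.IH[of m] 3 by (auto simp: r_def)
    note rG = R_carrier[OF H(2)]
    have ab: "a \<otimes> b \<in> carrier G" "inv (a \<otimes> b) = b \<otimes> a" using G ia by (simp_all add: inv_mult_group)
    have cj: "(a \<otimes> b) \<otimes> r \<otimes> inv (a \<otimes> b) \<in> R (hact (a \<otimes> b) H)" using R_conj[OF ab(1) H(1,2)] .
    have eq: "(a \<otimes> b) [^] n \<otimes> a = (a \<otimes> b) \<otimes> r \<otimes> inv (a \<otimes> b)"
    proof -
      have "(a \<otimes> b) [^] n = (a \<otimes> b) \<otimes> (a \<otimes> b) [^] m \<otimes> (a \<otimes> b)"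
        using ab(1) 3 by (metis Suc_eq_plus1 add_2_eq_Suc' nat_pow_Suc nat_pow_Suc2)
      then show ?thesis using G ab unfolding r_def ab(2) by (simp add: m_assoc)
    qed
    have "(a \<otimes> b) \<otimes> r \<otimes> inv (a \<otimes> b) \<noteq> \<one>"
    proof
      assume "(a \<otimes> b) \<otimes> r \<otimes> inv (a \<otimes> b) = \<one>"
      then have "(a \<otimes> b) \<otimes> r = a \<otimes> b" using ab(1) rG by (metis inv_equality inv_inv inv_closed m_closed)
      then show False using H(3) ab(1) rG by simp
    qed
    then show ?thesis using cj eq act_hact[OF ab(1) H(1)] by auto
  qed
qed

text \<open>If \<open>(a b)\<^sup>n\<close> is trivial on the cycle, then \<open>(a b)\<^sup>n a\<close>, a rotation around some hyperplane by
  \<open>dihedral_conj\<close>, agrees with \<open>a\<close> on an edge of \<open>J1\<close>, hence is \<open>a\<close>.\<close>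
lemma long_rotation:
  assumes J: "J1 \<in> \<J>" "J2 \<in> \<J>" and c: "ecyc k c" "3 \<le> k" "{c i, c (i + 1)} \<in> J1" "{c j, c (j + 1)} \<in> J2"
    and a: "a \<in> R J1" "a \<noteq> \<one>" and b: "b \<in> R J2" "b \<noteq> \<one>"
  shows "\<phi> ((a \<otimes> b) [^] (n::nat)) (c l) = c (l + 2 * int n * (i - j))"
    and "\<phi> ((a \<otimes> b) [^] n) (c l) = c l \<Longrightarrow> (a \<otimes> b) [^] n = \<one>"
    and "(a \<otimes> b) [^] nat k = \<one>"
proof -
  note G = R_carrier[OF a(1)] R_carrier[OF b(1)] and V = ecyc_V[OF c(1)]
  have ra: "\<phi> a (c l) = c (2 * i + 1 - l)" for l using long_reflect[OF J(1) c(1-3) a] .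
  have rb: "\<phi> b (c l) = c (2 * j + 1 - l)" for l using long_reflect[OF J(2) c(1,2,4) b] .
  \<comment> \<open>The product of two reflections of the cycle is a shift by twice the difference
    of their indices.\<close>
  have ab: "\<phi> (a \<otimes> b) (c l) = c (l + 2 * (i - j))" for l
    using act_mult[OF G V] ra rb by (simp add: algebra_simps)
  show rot: "\<phi> ((a \<otimes> b) [^] n) (c l) = c (l + 2 * int n * (i - j))" for n :: nat and l
  proof (induction n arbitrary: l)
    case (Suc n)
    have "\<phi> ((a \<otimes> b) [^] Suc n) (c l) = \<phi> ((a \<otimes> b) [^] n) (\<phi> (a \<otimes> b) (c l))"
      using act_mult G V by simp
    then show ?case using Suc ab by (simp add: algebra_simps)
  qed (use V in simp)
  show triv: "(a \<otimes> b) [^] n = \<one>" if fix_l: "\<phi> ((a \<otimes> b) [^] n) (c l) = c l" for n :: nat and l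
  proof -
    have "2 * k dvd 2 * int n * (i - j)"
      using fix_l rot[of n l] ecyc_eq[OF c(1), of "l + 2 * int n * (i - j)" l] by simp
    then have all: "\<phi> ((a \<otimes> b) [^] n) (c l) = c l" for l
      using rot[of n l] ecyc_eq[OF c(1), of "l + 2 * int n * (i - j)" l] by simp
    have aa: "a \<otimes> a = \<one>" "b \<otimes> b = \<one>"
      using long_order_two(2)[OF J(1) c(1-3) a] long_order_two(2)[OF J(2) c(1,2,4) b] .
    define r where "r = (a \<otimes> b) [^] n \<otimes> a"
    obtain H where H: "H \<in> \<J>" "r \<in> R H" "r \<noteq> \<one>"
      using dihedral_conj[OF J a(1) aa(1) b(1) aa(2) a(2) b(2)] by (auto simp: r_def)
    have ri: "\<phi> r (c i) = c (i + 1)" using act_mult[of "(a \<otimes> b) [^] n" a "c i"] G V ra all by (simp add: r_def)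
    have "H = J1"
    proof (rule ccontr)
      assume "H \<noteq> J1"
      then have "hsame H (c i) (c (i + 1))" using hyps_disjoint \<J>_hyp J(1) H(1) c(3) by metis
      then show False using R_free[OF H(2,1) V] ri H(3) by metis
    qed
    then have "r = a" using R_eq[OF _ a(1) J(1) V, of r i] H ri ra[of i] by simp
    then show ?thesis using G by (simp add: r_def)
  qed
  \<comment> \<open>The shift is by a multiple of the length \<open>2 * k\<close>. The order of
    \<open>a \<otimes> b\<close> may be smaller than \<open>k\<close>.\<close>
  have "\<phi> ((a \<otimes> b) [^] nat k) (c 0) = c 0"
    using rot[of "nat k" 0] ecyc_eq[OF c(1), of "2 * k * (i - j)" 0] c(2) by simp
  then show "(a \<otimes> b) [^] nat k = \<one>" using triv by blast
qed

end

subsection \<open>Chambers\<close>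

locale rot_chamber = rot_action +
  fixes bp assumes bp: "bp \<in> V"
begin

definition Y where "Y = {v \<in> V. \<forall>J\<in>\<J>. hsame J bp v}"
definition TT where "TT = {J \<in> hyps. tangent J Y}"

lemma Y_V: "y \<in> Y \<Longrightarrow> y \<in> V" by (simp add: Y_def)

lemma bp_Y: "bp \<in> Y" using hsame_refl[OF \<J>_hyp bp] bp by (simp add: Y_def)

lemma Y_hsame:
  assumes "y \<in> Y" "z \<in> Y" "J \<in> \<J>" shows "hsame J y z"
proof -
  have "hsame J bp y" "hsame J bp z" using assms by (auto simp: Y_def)
  then show ?thesis
    using hsame_trans[OF \<J>_hyp[OF assms(3)] Y_V[OF assms(1)] bp Y_V[OF assms(2)]] hsame_sym by blast
qed

lemma Y_intro:
  assumes "y \<in> Y" "z \<in> V" "\<And>J. J \<in> \<J> \<Longrightarrow> hsame J y z" shows "z \<in> Y"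
proof -
  have "hsame J bp z" if J: "J \<in> \<J>" for J
    using hsame_trans[OF \<J>_hyp[OF J] bp Y_V[OF assms(1)] assms(2) _ assms(3)[OF J]] Y_hsame[OF bp_Y assms(1) J]
    by blast
  then show ?thesis using assms(2) by (simp add: Y_def)
qed

lemma Y_convex: "convex_subgraph X Y"
  unfolding convex_subgraph_def
proof (intro conjI ballI subsetI)
  show "y \<in> V" if "y \<in> Y" for y using Y_V that .
  fix x y z assume xy: "x \<in> Y" "y \<in> Y" and z: "z \<in> ival X x y"
  then show "z \<in> Y"
    using Y_intro[OF xy(1)] hsame_convex[OF \<J>_hyp Y_V[OF xy(2)] _ Y_V[OF xy(1)] Y_hsame[OF xy]]
    by (auto simp: ival_iff)
qed

lemma Y_leave:
  assumes "y \<in> Y" "y \<sim> z" "z \<notin> Y"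
  obtains J where "J \<in> \<J>" "{y, z} \<in> J"
  using Y_intro[OF assms(1) nb_V(2)[OF assms(2)]] assms(3) hyp_crossing[OF \<J>_hyp assms(2)] by blast

text \<open>An edge leaving \<open>Y\<close> is separated by some member of \<open>\<J>\<close>, and
  it lies in one hyperplane only; so a hyperplane tangent to \<open>Y\<close> belongs to
  \<open>\<J>\<close>. Conversely, an edge of a member of \<open>\<J>\<close> cannot have both ends
  in \<open>Y\<close>.\<close>

lemma TT_iff: "J \<in> TT \<longleftrightarrow> J \<in> \<J> \<and> (\<exists>x y. {x, y} \<in> J \<and> x \<in> Y)"
proof
  assume "J \<in> TT"
  then obtain x y where xy: "J \<in> hyps" "{x, y} \<in> J" "x \<in> Y" "y \<notin> Y" by (auto simp: TT_def tangent_def)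
  obtain J' where "J' \<in> \<J>" "{x, y} \<in> J'" using Y_leave[OF xy(3) hyp_edge[OF xy(1,2)] xy(4)] .
  then show "J \<in> \<J> \<and> (\<exists>x y. {x, y} \<in> J \<and> x \<in> Y)" using hyp_unique[OF xy(1)] \<J>_hyp xy by blast
next
  assume "J \<in> \<J> \<and> (\<exists>x y. {x, y} \<in> J \<and> x \<in> Y)"
  then obtain x y where xy: "J \<in> \<J>" "{x, y} \<in> J" "x \<in> Y" by blast
  then have "y \<notin> Y" using Y_hsame hyp_crossing[OF \<J>_hyp] hyp_edge[OF \<J>_hyp] by blast
  then show "J \<in> TT" using xy \<J>_hyp by (auto simp: TT_def tangent_def)
qed

lemma TT_\<J>: "J \<in> TT \<Longrightarrow> J \<in> \<J>" by (simp add: TT_iff)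

lemma TT_hyp: "J \<in> TT \<Longrightarrow> J \<in> hyps" by (simp add: TT_def)

lemma TT_edge: assumes "J \<in> TT" obtains x y where "{x, y} \<in> J" "x \<in> Y" "x \<sim> y" "y \<notin> Y" "y \<in> V"
proof -
  obtain x y where xy: "{x, y} \<in> J" "x \<in> Y" using assms TT_iff by blast
  have n: "x \<sim> y" using hyp_edge[OF TT_hyp[OF assms] xy(1)] .
  then have "y \<notin> Y" using Y_hsame[OF xy(2) _ TT_\<J>[OF assms]] hyp_crossing[OF TT_hyp[OF assms] n] xy(1) by blast
  then show thesis using that xy n nb_V[OF n] by blast
qed

lemma Y_cross:
  assumes "y \<in> Y" "y \<sim> z" "z \<notin> Y"
  obtains J r where "J \<in> TT" "r \<in> R J" "r \<noteq> \<one>" "\<phi> r y = z" "{y, z} \<in> J"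
proof -
  obtain J where J: "J \<in> \<J>" "{y, z} \<in> J" using Y_leave[OF assms] .
  then have "J \<in> TT" using TT_iff assms by blast
  moreover obtain r where "r \<in> R J" "r \<noteq> \<one>" "\<phi> r y = z" using R_edge[OF J] by blast
  ultimately show thesis using that J by blast
qed

definition Rot where "Rot = generate G (\<Union>J\<in>\<J>. R J)"
definition RotT where "RotT = generate G (\<Union>J\<in>TT. R J)"

lemma gens_G: "(\<Union>J\<in>\<J>. R J) \<subseteq> carrier G" "(\<Union>J\<in>TT. R J) \<subseteq> carrier G"
  using R_carrier by blast+

lemma Rot_subgroup: "subgroup Rot G" "subgroup RotT G"
  using generate_is_subgroup gens_G by (auto simp: Rot_def RotT_def)

text \<open>Along a geodesic from \<open>bp\<close>, an edge leaving the chamber \<open>m Y\<close>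
  is pulled back by \<open>m\<close> to an edge leaving \<open>Y\<close> through a tangent
  hyperplane. Multiplying \<open>m\<close> on the right by a rotation around it gives the next
  chamber.\<close>

lemma RotT_cover:
  "v \<in> V \<Longrightarrow> \<exists>m\<in>RotT. \<exists>y\<in>Y. v = \<phi> m y"
proof (induction "d bp v" arbitrary: v)
  case 0
  then have "v = bp" using d_eq_0 bp by auto
  then show ?case using subgroup.one_closed[OF Rot_subgroup(2)] bp bp_Y by (metis act_one)
next
  case (Suc n)
  obtain w where w: "v \<sim> w" "d bp w = n" "w \<in> V" using d_step_nb[OF bp Suc.prems] Suc.hyps(2) by metis
  then obtain m y where m: "m \<in> RotT" "y \<in> Y" "w = \<phi> m y" using Suc.hyps(1)[of w] by auto
  have mG: "m \<in> carrier G" using subgroup.mem_carrier[OF Rot_subgroup(2) m(1)] .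
  define z where "z = \<phi> (inv m) v"
  have z: "z \<in> V" "v = \<phi> m z" using mG Suc.prems by (simp_all add: z_def)
  have yz: "y \<sim> z" using w(1) z m act_nb[OF mG, of y z] Y_V nb_sym by simp
  show ?case
  proof (cases "z \<in> Y")
    case False
    then obtain J r where r: "J \<in> TT" "r \<in> R J" "\<phi> r y = z" using Y_cross[OF m(2) yz] by metis
    then have "r \<in> RotT" unfolding RotT_def by (meson UN_I generate.incl)
    then have "m \<otimes> r \<in> RotT" using subgroup.m_closed[OF Rot_subgroup(2) m(1)] by blast
    moreover have "v = \<phi> (m \<otimes> r) y" using act_mult[OF mG R_carrier[OF r(2)] Y_V[OF m(2)]] r z by simp
    ultimately show ?thesis using m by blast
  qed (use z m in blast)
qed

text \<open>A hyperplane in \<open>\<J>\<close> has an edge starting in some chamber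
  \<open>m Y\<close> with \<open>m \<in> RotT\<close>. Its translate by \<open>inv m\<close> is
  tangent to \<open>Y\<close>, and conjugation by \<open>m\<close> brings the rotation back.\<close>

lemma Rot_eq: "Rot = RotT"
proof
  show "RotT \<subseteq> Rot" unfolding Rot_def RotT_def using TT_\<J> by (intro mono_generate) blast
  have "R J \<subseteq> RotT" if J: "J \<in> \<J>" for J
  proof
    fix r assume r: "r \<in> R J"
    obtain x x' where xy: "x \<sim> x'" "{x, x'} \<in> J" using hyp_nonempty[OF \<J>_hyp[OF J]] .
    obtain m y where m: "m \<in> RotT" "y \<in> Y" "x = \<phi> m y" using RotT_cover nb_V(1)[OF xy(1)] by blast
    have mG: "m \<in> carrier G" using subgroup.mem_carrier[OF Rot_subgroup(2) m(1)] .
    have "{\<phi> (inv m) x, \<phi> (inv m) x'} \<in> hact (inv m) J" using hactI[OF xy(2)] .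
    then have "{y, \<phi> (inv m) x'} \<in> hact (inv m) J" using m mG Y_V by simp
    then have "hact (inv m) J \<in> TT" using TT_iff act_hact[OF inv_closed[OF mG] J] m by blast
    moreover have "inv m \<otimes> r \<otimes> inv (inv m) \<in> R (hact (inv m) J)" using R_conj[OF inv_closed[OF mG] J r] .
    ultimately have s: "inv m \<otimes> r \<otimes> m \<in> RotT" using mG unfolding RotT_def by (auto intro: generate.incl)
    have "m \<otimes> (inv m \<otimes> r \<otimes> m) \<otimes> inv m \<in> RotT"
      using subgroup.m_closed[OF Rot_subgroup(2)] subgroup.m_inv_closed[OF Rot_subgroup(2)] m(1) s by blast
    moreover have "m \<otimes> (inv m \<otimes> r \<otimes> m) \<otimes> inv m = r"
    proof -
      have "m \<otimes> (inv m \<otimes> r \<otimes> m) \<otimes> inv m = (m \<otimes> inv m) \<otimes> r \<otimes> (m \<otimes> inv m)"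
        using mG R_carrier[OF r] by (simp only: m_assoc m_closed inv_closed)
      then show ?thesis using mG R_carrier[OF r] by simp
    qed
    ultimately show "r \<in> RotT" by simp
  qed
  then have "(\<Union>J\<in>\<J>. R J) \<subseteq> RotT" by blast
  then show "Rot \<subseteq> RotT" unfolding Rot_def using generate_subgroup_incl Rot_subgroup(2) by blast
qed

text \<open>A vertex beyond both hyperplanes forces \<open>J2\<close> to have edges on both sides of
  \<open>J1\<close>, the situation of \<open>crossing_cycle\<close>.\<close>

lemma pair_cycle:
  assumes J: "J1 \<in> TT" "J2 \<in> TT" "J1 \<noteq> J2" and z: "z \<in> V" "\<not> hsame J1 bp z" "\<not> hsame J2 bp z"
  obtains k c i j where "ecyc k c" "{c i, c (i + 1)} \<in> J1" "{c j, c (j + 1)} \<in> J2"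
proof -
  note T = TT_\<J>[OF J(1)] TT_\<J>[OF J(2)]
  note H = \<J>_hyp[OF T(1)] \<J>_hyp[OF T(2)]
  obtain y1 y1' where y1: "{y1, y1'} \<in> J1" "y1 \<in> Y" "y1 \<sim> y1'" using TT_edge[OF J(1)] by metis
  obtain y2 y2' where y2: "{y2, y2'} \<in> J2" "y2 \<in> Y" "y2 \<sim> y2'" using TT_edge[OF J(2)] by metis
  have yV: "y1 \<in> V" "y2 \<in> V" using y1 y2 Y_V by auto
  have nz: "\<not> hsame J z y" if "J \<in> \<J>" "\<not> hsame J bp z" "y \<in> Y" for J y
    using that hsame_trans[OF \<J>_hyp[OF that(1)] bp Y_V[OF that(3)] z(1)] Y_hsame[OF bp_Y that(3,1)] hsame_sym by blast
  \<comment> \<open>\<open>p\<close> is the vertex nearest to \<open>z\<close> in a clique of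
    \<open>J1\<close> that meets \<open>Y\<close>. For \<open>J1\<close> it is on the side of
    \<open>z\<close>, but for \<open>J2\<close> still on the side of \<open>Y\<close>.\<close>
  obtain p where p: "gate (ecl y1 y1') z p" using gate_ex[OF y1(3) z(1)] by blast
  then have pK: "p \<in> ecl y1 y1'" by (simp add: gate_def)
  have pV: "p \<in> V" using ecl_V[OF y1(3) pK] .
  have pz: "hsame J1 p z" using hsame_iff[OF H(1) y1(1) pV z(1)] gate_self[OF y1(3) pK] p unfolding same_def by blast
  have "y1 \<noteq> p" using nz[OF T(1) z(2) y1(2)] pz hsame_sym by blast
  then have "{y1, p} \<in> J1" using hyp_clique[OF H(1) y1(1) ecl_self(1) pK] by blast
  then have "hsame J2 y1 p" using hyps_disjoint[OF H(1,2) J(3)] by blast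
  then have "\<not> hsame J2 p z" using nz[OF T(2) z(3) y1(2)] hsame_trans[OF H(2) yV(1) pV z(1)] hsame_sym by blast
  then obtain u v where uv: "{u, v} \<in> J2" "u \<in> V" "d p z = d p u + d u z"
    using separated_edge[OF H(2) z(1) pV] by blast
  have "hsame J1 p u" using hsame_convex[OF H(1) z(1) uv(2) pV pz uv(3)] .
  then have "hsame J1 u z" using hsame_trans[OF H(1) uv(2) pV z(1)] pz hsame_sym by blast
  \<comment> \<open>So \<open>J2\<close> has an edge at \<open>y2\<close>, on the side of
    \<open>Y\<close>, and one at \<open>u\<close>, on the far side of \<open>J1\<close>.\<close>
  then have "\<not> hsame J1 y2 u" using nz[OF T(1) z(2) y2(2)] hsame_trans[OF H(1) yV(2) uv(2) z(1)] hsame_sym by blast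
  then show thesis using crossing_cycle[OF H J(3) y2(1) uv(1)] that by metis
qed

end

section \<open>The covering defined by a group over the rotation group\<close>

text \<open>What the covering needs to know of the periagroup: a homomorphism to \<open>G\<close>,
  sections over the rotation groups of tangent hyperplanes, generation by their images, and
  relations between pairs of them. \<open>\<iota>\<close> is indexed by \<open>R J\<close> because
  the vertices of a basis graph are subgroups. \<open>dihedral_rel\<close> is required for every
  exponent that is trivial in \<open>G\<close>, since that exponent depends on the cycle.\<close>

locale rot_covering = rot_chamber +
  fixes P :: "'p monoid" and \<pi> :: "'p \<Rightarrow> 'b" and \<iota> :: "'b set \<Rightarrow> 'b \<Rightarrow> 'p"
  assumes P: "group P" and \<pi>_hom: "\<pi> \<in> hom P G"
    and \<iota>_hom: "\<And>J. J \<in> TT \<Longrightarrow> \<iota> (R J) \<in> hom (G\<lparr>carrier := R J\<rparr>) P"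
    and \<pi>_\<iota>: "\<And>J r. J \<in> TT \<Longrightarrow> r \<in> R J \<Longrightarrow> \<pi> (\<iota> (R J) r) = r"
    and P_gen: "carrier P = generate P (\<Union>J\<in>TT. \<iota> (R J) ` R J)"
    and comm_rel: "\<And>J1 J2 a b. J1 \<in> TT \<Longrightarrow> J2 \<in> TT \<Longrightarrow> J1 \<noteq> J2 \<Longrightarrow>
      (\<And>a b. a \<in> R J1 \<Longrightarrow> b \<in> R J2 \<Longrightarrow> a \<otimes> b = b \<otimes> a) \<Longrightarrow> a \<in> R J1 \<Longrightarrow> b \<in> R J2 \<Longrightarrow>
      \<iota> (R J1) a \<otimes>\<^bsub>P\<^esub> \<iota> (R J2) b = \<iota> (R J2) b \<otimes>\<^bsub>P\<^esub> \<iota> (R J1) a"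
    and dihedral_rel: "\<And>J1 J2 a b n. J1 \<in> TT \<Longrightarrow> J2 \<in> TT \<Longrightarrow> J1 \<noteq> J2 \<Longrightarrow>
      R J1 = {\<one>, a} \<Longrightarrow> R J2 = {\<one>, b} \<Longrightarrow> a \<noteq> \<one> \<Longrightarrow> b \<noteq> \<one> \<Longrightarrow> a \<otimes> a = \<one> \<Longrightarrow> b \<otimes> b = \<one> \<Longrightarrow>
      (a \<otimes> b) [^] (n::nat) = \<one> \<Longrightarrow> (\<iota> (R J1) a \<otimes>\<^bsub>P\<^esub> \<iota> (R J2) b) [^]\<^bsub>P\<^esub> n = \<one>\<^bsub>P\<^esub>"
begin

interpretation P: group P by (rule P)
interpretation \<pi>: group_hom P G \<pi>
  using P \<pi>_hom by (simp add: group_hom_def group_hom_axioms_def)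

abbreviation io where "io J \<equiv> \<iota> (R J)"

lemma io_closed [simp]: "J \<in> TT \<Longrightarrow> r \<in> R J \<Longrightarrow> io J r \<in> carrier P"
  using \<iota>_hom[of J] by (auto simp: hom_def)

lemma io_mult: "J \<in> TT \<Longrightarrow> r \<in> R J \<Longrightarrow> s \<in> R J \<Longrightarrow> io J (r \<otimes> s) = io J r \<otimes>\<^bsub>P\<^esub> io J s"
  using \<iota>_hom[of J] by (simp add: hom_def)

lemma io_one: "J \<in> TT \<Longrightarrow> io J \<one> = \<one>\<^bsub>P\<^esub>"
  using io_mult[of J \<one> \<one>] io_closed[of J \<one>] R_one by (metis P.l_cancel_one one_closed r_one)

lemma io_inv: "J \<in> TT \<Longrightarrow> r \<in> R J \<Longrightarrow> io J (inv r) = inv\<^bsub>P\<^esub> (io J r)"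
  using io_mult[of J "inv r" r] io_one[of J] R_inv[of r J] R_carrier[of r J] by (metis P.inv_equality io_closed l_inv)

definition lift where "lift p x \<longleftrightarrow> p \<in> carrier P \<and> (\<exists>y\<in>Y. x = \<phi> (\<pi> p) y)"

text \<open>The vertices of the covering are the pairs \<open>(p, y)\<close> with \<open>y \<in> Y\<close>. The one over \<open>x\<close> is determined by
  \<open>p\<close>, so an edge of the covering is recorded by an edge of \<open>X\<close> and the group elements over its ends.\<close>
inductive E :: "'a \<Rightarrow> 'p \<Rightarrow> 'a \<Rightarrow> 'p \<Rightarrow> bool" where
  inside: "p \<in> carrier P \<Longrightarrow> y \<in> Y \<Longrightarrow> y' \<in> Y \<Longrightarrow> y \<sim> y' \<Longrightarrow> E (\<phi> (\<pi> p) y) p (\<phi> (\<pi> p) y') p"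
| cross: "p \<in> carrier P \<Longrightarrow> y \<in> Y \<Longrightarrow> J \<in> TT \<Longrightarrow> r \<in> R J \<Longrightarrow> {y, \<phi> r y} \<in> J \<Longrightarrow>
    E (\<phi> (\<pi> p) y) p (\<phi> (\<pi> p) (\<phi> r y)) (p \<otimes>\<^bsub>P\<^esub> io J r)"

lemma TT_nb: "J \<in> TT \<Longrightarrow> {x, y} \<in> J \<Longrightarrow> x \<sim> y"
  using hyp_edge TT_hyp by blast

lemma TT_not_Y:
  assumes "J \<in> TT" "{y, z} \<in> J" "y \<in> Y" shows "z \<notin> Y"
  using Y_hsame[OF assms(3) _ TT_\<J>[OF assms(1)]] hyp_crossing[OF TT_hyp[OF assms(1)] TT_nb[OF assms(1,2)]]
    assms(2) by blast

lemma E_props: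
  assumes "E x p x' p'"
  shows "p \<in> carrier P" "p' \<in> carrier P" "lift p x" "lift p' x'" "x \<sim> x'"
proof -
  have "p \<in> carrier P \<and> p' \<in> carrier P \<and> lift p x \<and> lift p' x' \<and> x \<sim> x'"
    using assms
  proof cases
    case (inside y y')
    then show ?thesis using act_nbI by (auto simp: lift_def)
  next
    case (cross y J r)
    have "x' = \<phi> (\<pi> p') y"
      using cross act_mult[of "\<pi> p" r y] R_carrier[OF cross(7)] Y_V by (simp add: \<pi>_\<iota>)
    moreover have "x \<sim> x'" using act_nbI[OF _ TT_nb[OF cross(6,8)], of "\<pi> p"] cross by simp
    ultimately show ?thesis using cross by (auto simp: lift_def)
  qed
  then show "p \<in> carrier P" "p' \<in> carrier P" "lift p x" "lift p' x'" "x \<sim> x'" by auto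
qed

lemma E_ex:
  assumes "lift p x" "x \<sim> x'"
  shows "\<exists>p'. E x p x' p'"
proof -
  obtain y where y: "p \<in> carrier P" "y \<in> Y" "x = \<phi> (\<pi> p) y" using assms by (auto simp: lift_def)
  define z where "z = \<phi> (inv (\<pi> p)) x'"
  have x': "x' \<in> V" using nb_V assms by blast
  have z: "z \<in> V" "x' = \<phi> (\<pi> p) z" using y x' by (auto simp: z_def)
  have yz: "y \<sim> z" using assms(2) y z act_nb[of "\<pi> p" y z] Y_V by simp
  show ?thesis
  proof (cases "z \<in> Y")
    case True
    then show ?thesis using E.inside[OF y(1,2) True yz] y z by blast
  next
    case False
    obtain J r where "J \<in> TT" "r \<in> R J" "\<phi> r y = z" "{y, z} \<in> J" using Y_cross[OF y(2) yz False] by metis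
    then show ?thesis using E.cross[OF y(1,2), of J r] y z by blast
  qed
qed

lemma E_target:
  assumes "E x p x' p'"
  defines "y \<equiv> \<phi> (inv (\<pi> p)) x" and "z \<equiv> \<phi> (inv (\<pi> p)) x'"
  shows "y \<in> Y \<and> (z \<in> Y \<and> p' = p \<or>
    (\<exists>J\<in>TT. \<exists>r\<in>R J. {y, z} \<in> J \<and> \<phi> r y = z \<and> p' = p \<otimes>\<^bsub>P\<^esub> io J r))"
  using assms(1)
proof cases
  case (inside y0 y1)
  then show ?thesis using Y_V unfolding y_def z_def by simp
next
  case (cross y0 J r)
  then have "y = y0" "z = \<phi> r y0" using Y_V R_carrier[OF cross(7)] unfolding y_def z_def by simp_all
  then show ?thesis using cross by blast
qed

text \<open>The edge pulled back to \<open>Y\<close> lies in at most one hyperplane, and a rotation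
  around it is determined by the image of one vertex. Together with \<open>E_ex\<close> this is
  unique path lifting.\<close>

lemma E_unique:
  assumes "E x p x' p'" "E x p x' p''"
  shows "p' = p''"
proof -
  define y z where "y = \<phi> (inv (\<pi> p)) x" and "z = \<phi> (inv (\<pi> p)) x'"
  note t = E_target[OF assms(1), folded y_def z_def] E_target[OF assms(2), folded y_def z_def]
  show ?thesis
  proof (cases "z \<in> Y")
    case True
    then have "p' = p" "p'' = p" using t TT_not_Y[of _ y z] by blast+
    then show ?thesis by simp
  next
    case False
    then obtain J r J' r' where r: "J \<in> TT" "r \<in> R J" "{y, z} \<in> J" "\<phi> r y = z" "p' = p \<otimes>\<^bsub>P\<^esub> io J r"
      "J' \<in> TT" "r' \<in> R J'" "{y, z} \<in> J'" "\<phi> r' y = z" "p'' = p \<otimes>\<^bsub>P\<^esub> io J' r'"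
      using t by blast
    have J: "J = J'" using hyp_unique[OF TT_hyp[OF r(1)] TT_hyp[OF r(6)] r(3,8)] .
    have "r = r'" by (rule R_eq[OF r(2) _ TT_\<J>[OF r(1)] Y_V[of y]]) (use r J t in simp_all)
    then show ?thesis using r J by simp
  qed
qed

lemma E_sym:
  assumes "E x p x' p'" shows "E x' p' x p"
  using assms
proof cases
  case (inside y y')
  then show ?thesis using E.inside[OF inside(4,6,5) nb_sym[OF inside(7)]] by simp
next
  case (cross y J r)
  note rG = R_carrier[OF cross(7)] and yV = Y_V[OF cross(5)]
  have iG: "inv r \<in> R J" using R_inv[OF cross(7)] .
  have pc: "p \<in> carrier P" "io J r \<in> carrier P" using cross by simp_all
  have p': "p' \<in> carrier P" "\<pi> p' = \<pi> p \<otimes> r" using cross by (simp_all add: \<pi>_\<iota>)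
  have "{\<phi> (inv r) y, \<phi> (inv r) (\<phi> r y)} \<in> hact (inv r) J" using hactI[OF cross(8)] .
  then have e: "{y, \<phi> (inv r) y} \<in> J"
    using R_hact[OF iG TT_\<J>[OF cross(6)]] rG yV by (simp add: insert_commute)
  have "x' = \<phi> (\<pi> p') y" "x = \<phi> (\<pi> p') (\<phi> (inv r) y)"
    using p' cross act_mult[of "\<pi> p" r] rG yV by simp_all
  moreover have "p = p' \<otimes>\<^bsub>P\<^esub> io J (inv r)"
    using cross io_inv[OF cross(6,7)] pc by (simp add: P.m_assoc)
  ultimately show ?thesis using E.cross[OF p'(1) cross(5,6) iG e] by simp
qed

text \<open>\<open>P\<close> acts on the covering by left multiplication, over its action on
  \<open>X\<close>. This allows closed paths to be lifted from the identity only.\<close>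

lemma E_left:
  assumes "E x p x' p'" "q \<in> carrier P"
  shows "E (\<phi> (\<pi> q) x) (q \<otimes>\<^bsub>P\<^esub> p) (\<phi> (\<pi> q) x') (q \<otimes>\<^bsub>P\<^esub> p')"
proof -
  have pc: "p \<in> carrier P" using E_props(1)[OF assms(1)] .
  then have qp: "q \<otimes>\<^bsub>P\<^esub> p \<in> carrier P" using assms by simp
  have tr: "\<phi> (\<pi> q) (\<phi> (\<pi> p) w) = \<phi> (\<pi> (q \<otimes>\<^bsub>P\<^esub> p)) w" if "w \<in> V" for w
    using act_mult[of "\<pi> q" "\<pi> p" w] assms(2) pc that by simp
  from assms(1) show ?thesis
  proof cases
    case (inside y y')
    then show ?thesis using E.inside[OF qp inside(5-7)] tr Y_V by metis
  next
    case (cross y J r)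
    have "q \<otimes>\<^bsub>P\<^esub> p' = (q \<otimes>\<^bsub>P\<^esub> p) \<otimes>\<^bsub>P\<^esub> io J r" using cross assms(2) by (simp add: P.m_assoc)
    moreover have "\<phi> r y \<in> V" using Y_V[OF cross(5)] R_carrier[OF cross(7)] by simp
    ultimately show ?thesis using E.cross[OF qp cross(5-8)] tr[OF Y_V[OF cross(5)]] tr[of "\<phi> r y"] cross(1,2) by simp
  qed
qed

subsection \<open>Triangles and convex even cycles lift to closed paths\<close>

text \<open>The group elements met along the lift stay in a set \<open>S\<close> on which the action
  on chambers is free; a path that returns to \<open>Y\<close> therefore ends at the identity.
  Below, \<open>S\<close> is the copy of one rotation group, a product of two commuting ones, or a
  dihedral group.\<close>

lemma closing:
  assumes step: "\<And>i. i < n \<Longrightarrow> E (v i) (p i) (v (Suc i)) (p (Suc i))" and p0: "p 0 = \<one>\<^bsub>P\<^esub>"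
    and S1: "\<one>\<^bsub>P\<^esub> \<in> S" and S: "\<And>i s J r y. i < n \<Longrightarrow> s \<in> S \<Longrightarrow> s \<in> carrier P \<Longrightarrow> J \<in> TT \<Longrightarrow> r \<in> R J \<Longrightarrow>
      y \<in> Y \<Longrightarrow> {y, \<phi> r y} \<in> J \<Longrightarrow> v i = \<phi> (\<pi> s) y \<Longrightarrow> v (Suc i) = \<phi> (\<pi> s) (\<phi> r y) \<Longrightarrow> s \<otimes>\<^bsub>P\<^esub> io J r \<in> S"
    and vn: "v n = v 0" "v 0 \<in> Y" and
    triv: "\<And>s y. s \<in> S \<Longrightarrow> s \<in> carrier P \<Longrightarrow> y \<in> Y \<Longrightarrow> \<phi> (\<pi> s) y \<in> Y \<Longrightarrow> s = \<one>\<^bsub>P\<^esub>"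
  shows "p n = \<one>\<^bsub>P\<^esub>"
proof -
  have "i \<le> n \<Longrightarrow> p i \<in> S" for i
  proof (induction i)
    case (Suc i)
    then have i: "i < n" "p i \<in> S" by auto
    have e: "E (v i) (p i) (v (Suc i)) (p (Suc i))" using step i by blast
    have pc: "p i \<in> carrier P" using E_props(1)[OF e] .
    from e show ?case
    proof cases
      case (cross y J r)
      then show ?thesis using S[OF i(1,2) pc cross(6,7,5,8,1,2)] by simp
    qed (use i in simp)
  qed (use p0 S1 in simp)
  then have pn: "p n \<in> S" by blast
  show ?thesis
  proof (cases n)
    case (Suc m)
    then have "lift (p n) (v n)" using E_props(4)[OF step[of m]] by simp
    then show ?thesis using triv[OF pn] vn by (auto simp: lift_def)
  qed (use p0 in simp)
qed

lemma R_chamber_free: "r \<in> R J \<Longrightarrow> J \<in> \<J> \<Longrightarrow> y \<in> Y \<Longrightarrow> \<phi> r y \<in> Y \<Longrightarrow> r = \<one>"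
  using R_free Y_hsame Y_V by blast

lemma closing1:
  assumes step: "\<And>i. i < n \<Longrightarrow> E (v i) (p i) (v (Suc i)) (p (Suc i))" and p0: "p 0 = \<one>\<^bsub>P\<^esub>"
    and vn: "v n = v 0" "v 0 \<in> Y"
    and H: "\<And>i J s y r. i < n \<Longrightarrow> (s = \<one> \<or> H \<in> TT \<and> s \<in> R H) \<Longrightarrow> J \<in> TT \<Longrightarrow> r \<in> R J \<Longrightarrow> y \<in> Y \<Longrightarrow>
       {y, \<phi> r y} \<in> J \<Longrightarrow> v i = \<phi> s y \<Longrightarrow> v (Suc i) = \<phi> s (\<phi> r y) \<Longrightarrow> J = H"
  shows "p n = \<one>\<^bsub>P\<^esub>"
proof (rule closing[OF step p0 _ _ vn])
  define S where "S = {\<one>\<^bsub>P\<^esub>} \<union> {io H a | a. a \<in> R H \<and> H \<in> TT}"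
  have \<pi>S: "\<pi> s = \<one> \<or> H \<in> TT \<and> \<pi> s \<in> R H" if "s \<in> S" for s
    using that by (auto simp: S_def \<pi>_\<iota>)
  show "\<one>\<^bsub>P\<^esub> \<in> S" by (simp add: S_def)
  show "s \<otimes>\<^bsub>P\<^esub> io J r \<in> S" if "i < n" "s \<in> S" "s \<in> carrier P" "J \<in> TT" "r \<in> R J"
      "y \<in> Y" "{y, \<phi> r y} \<in> J" "v i = \<phi> (\<pi> s) y" "v (Suc i) = \<phi> (\<pi> s) (\<phi> r y)" for i s J r y
  proof -
    have "J = H" using H[OF that(1) \<pi>S[OF that(2)] that(4-9)] .
    then show ?thesis using that(2,4,5) io_mult[of H _ r] R_mult[of _ H r] by (auto simp: S_def) metis+
  qed
  show "s = \<one>\<^bsub>P\<^esub>" if s: "s \<in> S" "s \<in> carrier P" "y \<in> Y" "\<phi> (\<pi> s) y \<in> Y" for s y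
    using s R_chamber_free[OF _ TT_\<J>] io_one by (auto simp: S_def \<pi>_\<iota>)
qed

text \<open>Here \<open>S\<close> consists of the products from two commuting rotation groups.
  Elements of both groups preserve \<open>H1\<close> and \<open>H2\<close>, so an edge of the path
  pulled back to \<open>Y\<close> still crosses one of these two.\<close>

lemma closing2:
  assumes step: "\<And>i. i < n \<Longrightarrow> E (v i) (p i) (v (Suc i)) (p (Suc i))" and p0: "p 0 = \<one>\<^bsub>P\<^esub>"
    and vn: "v n = v 0" "v 0 \<in> Y"
    and H: "H1 \<in> TT" "H2 \<in> TT" "H1 \<noteq> H2" and only: "\<And>i J. i < n \<Longrightarrow> J \<in> \<J> \<Longrightarrow> {v i, v (Suc i)} \<in> J \<Longrightarrow> J = H1 \<or> J = H2"
    and st: "\<And>a. a \<in> R H1 \<Longrightarrow> hact a H2 = H2" "\<And>b. b \<in> R H2 \<Longrightarrow> hact b H1 = H1"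
    and cm: "\<And>a b. a \<in> R H1 \<Longrightarrow> b \<in> R H2 \<Longrightarrow> a \<otimes> b = b \<otimes> a"
  shows "p n = \<one>\<^bsub>P\<^esub>"
proof (rule closing[OF step p0 _ _ vn])
  note T = TT_\<J>[OF H(1)] TT_\<J>[OF H(2)]
  define S where "S = {io H1 a \<otimes>\<^bsub>P\<^esub> io H2 b | a b. a \<in> R H1 \<and> b \<in> R H2}"
  show "\<one>\<^bsub>P\<^esub> \<in> S" unfolding S_def using io_one H R_one by force
  have c: "io H1 a \<otimes>\<^bsub>P\<^esub> io H2 b = io H2 b \<otimes>\<^bsub>P\<^esub> io H1 a" if "a \<in> R H1" "b \<in> R H2" for a b
    using comm_rel[OF H cm that] .
  show "s \<otimes>\<^bsub>P\<^esub> io J r \<in> S" if s: "i < n" "s \<in> S" "s \<in> carrier P" "J \<in> TT" "r \<in> R J"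
      "y \<in> Y" "{y, \<phi> r y} \<in> J" "v i = \<phi> (\<pi> s) y" "v (Suc i) = \<phi> (\<pi> s) (\<phi> r y)" for i s J r y
  proof -
    obtain a b where ab: "s = io H1 a \<otimes>\<^bsub>P\<^esub> io H2 b" "a \<in> R H1" "b \<in> R H2" using s(2) by (auto simp: S_def)
    note G = R_carrier[OF ab(2)] R_carrier[OF ab(3)]
    have \<pi>s: "\<pi> s = a \<otimes> b" using ab H by (simp add: \<pi>_\<iota>)
    have sG: "\<pi> s \<in> carrier G" using \<pi>s G by simp
    have hs: "hact (\<pi> s) H1 = H1" "hact (\<pi> s) H2 = H2"
      using hact_mult[OF G T(1)] hact_mult[OF G T(2)] st R_hact[OF _ T(1)] R_hact[OF _ T(2)] ab \<pi>s by simp_all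
    have "{v i, v (Suc i)} \<in> hact (\<pi> s) J" using hactI[OF s(7), of "\<pi> s"] s(8,9) by simp
    then have "hact (\<pi> s) J = H1 \<or> hact (\<pi> s) J = H2" using only[OF s(1) act_hact[OF sG TT_\<J>[OF s(4)]]] by blast
    then have "J = H1 \<or> J = H2" using hact_inv(1)[OF sG] TT_\<J>[OF s(4)] T hs by metis
    then show ?thesis
    proof
      assume J: "J = H1"
      have "s \<otimes>\<^bsub>P\<^esub> io J r = io H1 a \<otimes>\<^bsub>P\<^esub> (io H2 b \<otimes>\<^bsub>P\<^esub> io H1 r)" using J ab H s by (simp add: P.m_assoc)
      also have "\<dots> = io H1 a \<otimes>\<^bsub>P\<^esub> (io H1 r \<otimes>\<^bsub>P\<^esub> io H2 b)" using c[of r b] J s ab by simp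
      also have "\<dots> = io H1 (a \<otimes> r) \<otimes>\<^bsub>P\<^esub> io H2 b" using J ab H s io_mult[of H1 a r] by (simp add: P.m_assoc)
      finally show ?thesis using R_mult[OF ab(2), of r] s J ab(3) unfolding S_def by blast
    next
      assume J: "J = H2"
      have "s \<otimes>\<^bsub>P\<^esub> io J r = io H1 a \<otimes>\<^bsub>P\<^esub> io H2 (b \<otimes> r)" using J ab H s io_mult[of H2 b r] by (simp add: P.m_assoc)
      then show ?thesis using R_mult[OF ab(3), of r] s J ab(2) unfolding S_def by blast
    qed
  qed
  show "s = \<one>\<^bsub>P\<^esub>" if s: "s \<in> S" "s \<in> carrier P" "y \<in> Y" "\<phi> (\<pi> s) y \<in> Y" for s y
  proof -
    obtain a b where ab: "s = io H1 a \<otimes>\<^bsub>P\<^esub> io H2 b" "a \<in> R H1" "b \<in> R H2" using s(1) by (auto simp: S_def)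
    note G = R_carrier[OF ab(2)] R_carrier[OF ab(3)] and yV = Y_V[OF s(3)]
    have \<pi>s: "\<pi> s = a \<otimes> b" using ab H by (simp add: \<pi>_\<iota>)
    note HH = \<J>_hyp[OF T(1)] \<J>_hyp[OF T(2)]
    \<comment> \<open>A rotation around \<open>H2\<close> does not change the side of
      \<open>H1\<close>: some \<open>w\<close> in \<open>Y\<close> is joined to
      \<open>\<phi> b w\<close> by an edge of \<open>H2\<close>, and \<open>b\<close> preserves
      \<open>H1\<close>. Hence \<open>a\<close> alone would have to cross \<open>H1\<close>, and it
      is trivial.\<close>
    have "hsame H1 y (\<phi> b y)"
    proof (cases "b = \<one>")
      case False
      obtain w w' where w: "{w, w'} \<in> H2" "w \<in> Y" using TT_edge[OF H(2)] by metis
      note wV = Y_V[OF w(2)]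
      have "{w, \<phi> b w} \<in> H2" using R_edge_moved(1)[OF ab(3) T(2) False w(1)] .
      then have wb: "hsame H1 w (\<phi> b w)" using hyps_disjoint[OF HH(2,1) H(3)[symmetric]] by blast
      have "hsame H1 (\<phi> b w) (\<phi> b y)" using act_hsame[OF G(2) T(1) wV yV] st(2)[OF ab(3)] Y_hsame[OF w(2) s(3) T(1)] by simp
      then have "hsame H1 w (\<phi> b y)" using hsame_trans[OF HH(1) wV _ _ wb] G wV yV by simp
      then show ?thesis using hsame_trans[OF HH(1) yV wV _ Y_hsame[OF s(3) w(2) T(1)]] G yV by simp
    qed (use hsame_refl[OF HH(1)] yV in simp)
    then have 1: "hsame H1 (\<phi> a y) (\<phi> a (\<phi> b y))"
      using act_hsame[OF G(1) T(1) yV, of "\<phi> b y"] R_hact[OF ab(2) T(1)] G yV by simp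
    have "\<phi> a (\<phi> b y) = \<phi> (\<pi> s) y" using act_mult[OF G yV] \<pi>s by simp
    then have "hsame H1 y (\<phi> a (\<phi> b y))" using Y_hsame[OF s(3,4) T(1)] by simp
    then have "hsame H1 y (\<phi> a y)" using 1 hsame_trans[OF HH(1) yV, of "\<phi> a (\<phi> b y)" "\<phi> a y"] hsame_sym G yV by simp
    then have a1: "a = \<one>" using R_free[OF ab(2) T(1) yV] by blast
    then have "\<phi> b y \<in> Y" using s(4) \<pi>s G by simp
    then have "b = \<one>" using R_chamber_free[OF ab(3) T(2) s(3)] by blast
    then show ?thesis using ab a1 io_one H by simp
  qed
qed

text \<open>The hypothesis concerns the path itself and is pulled back by an element of
  \<open>R H\<close>, which fixes \<open>H\<close>. Tangency of \<open>H\<close> is demanded only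
  when an edge is crossed, so a path crossing no member of \<open>\<J>\<close> may use any
  \<open>H\<close>.\<close>

lemma closing1':
  assumes step: "\<And>i. i < n \<Longrightarrow> E (v i) (p i) (v (Suc i)) (p (Suc i))" and p0: "p 0 = \<one>\<^bsub>P\<^esub>"
    and vn: "v n = v 0" "v 0 \<in> Y"
    and only: "\<And>i J. i < n \<Longrightarrow> J \<in> \<J> \<Longrightarrow> {v i, v (Suc i)} \<in> J \<Longrightarrow> J = H \<and> H \<in> TT"
  shows "p n = \<one>\<^bsub>P\<^esub>"
proof (rule closing1[OF step p0 vn, where H = H])
  fix i J s y r
  assume i: "i < n" "s = \<one> \<or> H \<in> TT \<and> s \<in> R H" "J \<in> TT" "{y, \<phi> r y} \<in> J" "v i = \<phi> s y"
    "v (Suc i) = \<phi> s (\<phi> r y)"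
  have sG: "s \<in> carrier G" using i(2) R_carrier by auto
  have "{v i, v (Suc i)} \<in> hact s J" using hactI[OF i(4), of s] i by simp
  then have H: "hact s J = H" "H \<in> TT" using only[OF i(1) act_hact[OF sG TT_\<J>[OF i(3)]]] by auto
  have "hact s H = H" using i(2) hact_one[OF TT_\<J>[OF H(2)]] R_hact[OF _ TT_\<J>[OF H(2)]] by blast
  then show "J = H"
    using hact_inv(1)[OF sG TT_\<J>[OF i(3)]] hact_inv(1)[OF sG TT_\<J>[OF H(2)]] H(1) by metis
qed

text \<open>The three edges lie in one clique, so a member of \<open>\<J>\<close> containing one of
  them contains all.\<close>

lemma triangle_closed:
  assumes e: "E x p y q" "E y q z s" and xz: "x \<sim> z"
  shows "E x p z s"
proof -
  obtain t where t: "E z s x t" using E_ex[OF E_props(4)[OF e(2)] nb_sym[OF xz]] by blast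
  \<comment> \<open>Left translation by \<open>g\<close> makes the lifted triangle start at the
    identity; it remains to see that \<open>t\<close>, reached by lifting the closing edge, is
    \<open>p\<close>.\<close>
  define g where "g = inv\<^bsub>P\<^esub> p"
  have pc: "p \<in> carrier P" "t \<in> carrier P" using E_props e t by blast+
  then have gc: "g \<in> carrier P" by (simp add: g_def)
  then have gG: "\<pi> g \<in> carrier G" by simp
  define v where "v = (\<lambda>i::nat. \<phi> (\<pi> g) (if i = 1 then y else if i = 2 then z else x))"
  define w where "w = (\<lambda>i::nat. g \<otimes>\<^bsub>P\<^esub> (if i = 0 then p else if i = 1 then q else if i = 2 then s else t))"
  \<comment> \<open>If no member of \<open>\<J>\<close> contains the first edge, the triangle
    crosses none of them and the value of \<open>SOME\<close> may be anything.\<close>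
  have "w 3 = \<one>\<^bsub>P\<^esub>"
  proof (rule closing1'[where v = v and H = "SOME J. J \<in> \<J> \<and> {v 0, v 1} \<in> J"])
    show st: "E (v i) (w i) (v (Suc i)) (w (Suc i))" if "i < 3" for i
    proof -
      have "i = 0 \<or> i = 1 \<or> i = 2" using that by auto
      then show ?thesis using E_left[OF e(1) gc] E_left[OF e(2) gc] E_left[OF t gc]
        by (auto simp: v_def w_def)
    qed
    show w0: "w 0 = \<one>\<^bsub>P\<^esub>" using pc by (simp add: w_def g_def)
    show "v 3 = v 0" by (simp add: v_def)
    have "lift \<one>\<^bsub>P\<^esub> (v 0)" using E_props(3)[OF st[of 0]] w0 by simp
    then show v0: "v 0 \<in> Y" using Y_V by (auto simp: lift_def)
    fix i :: nat and J assume i: "i < 3" and J: "J \<in> \<J>" "{v i, v (Suc i)} \<in> J"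
    have n: "v 0 \<sim> v 1" "v 1 \<sim> v 2" "v 2 \<sim> v 0"
      using E_props(5)[OF st[of 0]] E_props(5)[OF st[of 1]] E_props(5)[OF st[of 2]]
      by (simp_all add: v_def numeral_2_eq_2)
    have "i = 0 \<or> i = 1 \<or> i = 2" using i by auto
    then have "{v 0, v 1} \<in> J \<or> {v 1, v 2} \<in> J \<or> {v 2, v 0} \<in> J"
      using J(2) by (auto simp: v_def numeral_2_eq_2)
    then have "{v 0, v 1} \<in> J"
    proof (elim disjE)
      assume a: "{v 1, v 2} \<in> J"
      have "v 0 \<in> ecl (v 1) (v 2)" using n nb_sym by (auto simp: ecl_def)
      then show ?thesis using hyp_clique[OF \<J>_hyp[OF J(1)] a _ ecl_self(1)] nb_V(3)[OF n(1)] by blast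
    next
      assume a: "{v 2, v 0} \<in> J"
      have "v 1 \<in> ecl (v 2) (v 0)" using n nb_sym by (auto simp: ecl_def)
      then show ?thesis using hyp_clique[OF \<J>_hyp[OF J(1)] a ecl_self(2)] nb_V(3)[OF n(1)] by blast
    qed
    note J01 = this
    have "(SOME J. J \<in> \<J> \<and> {v 0, v 1} \<in> J) = J"
    proof (rule some_equality)
      show "J \<in> \<J> \<and> {v 0, v 1} \<in> J" using J(1) J01 by blast
      show "K = J" if "K \<in> \<J> \<and> {v 0, v 1} \<in> K" for K
        using hyp_unique[OF \<J>_hyp[OF conjunct1[OF that]] \<J>_hyp[OF J(1)] conjunct2[OF that] J01] .
    qed
    then show "J = (SOME J. J \<in> \<J> \<and> {v 0, v 1} \<in> J) \<and> (SOME J. J \<in> \<J> \<and> {v 0, v 1} \<in> J) \<in> TT"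
      using TT_iff J01 J(1) v0 by auto
  qed
  then have "g \<otimes>\<^bsub>P\<^esub> t = \<one>\<^bsub>P\<^esub>" by (simp add: w_def)
  then have "t = p" using pc gc unfolding g_def by (metis P.inv_equality P.inv_inv P.inv_comm)
  then show ?thesis using E_sym[OF t] by simp
qed

text \<open>\<open>g\<close> permutes \<open>\<J>\<close>, so it sends vertices not separated by
  \<open>\<J>\<close> to such vertices; the same holds for its inverse.\<close>

lemma chamber_map:
  assumes g: "g \<in> carrier G" and y: "y \<in> Y" "\<phi> g y \<in> Y" and z: "z \<in> V"
  shows "\<phi> g z \<in> Y \<longleftrightarrow> z \<in> Y"
proof -
  have *: "\<phi> g z \<in> Y" if "g \<in> carrier G" "y \<in> Y" "\<phi> g y \<in> Y" "z \<in> Y" for g y z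
  proof (rule Y_intro[OF that(3)])
    show "\<phi> g z \<in> V" using that Y_V by simp
    fix J assume J: "J \<in> \<J>"
    have J': "hact (inv g) J \<in> \<J>" using act_hact[OF inv_closed[OF that(1)] J] .
    have "hsame (hact (inv g) J) y z" using Y_hsame[OF that(2,4) J'] .
    then show "hsame J (\<phi> g y) (\<phi> g z)"
      using act_hsame[OF that(1) J' Y_V[OF that(2)] Y_V[OF that(4)]] hact_inv(2)[OF that(1) J] by simp
  qed
  show ?thesis
    using *[OF g y, of z] *[OF inv_closed[OF g] y(2), of "\<phi> g z"] g y z Y_V by auto
qed

text \<open>If the exit edge and the entry edge of \<open>Y\<close> on the cycle belong to one
  hyperplane, the lift stays in one rotation group of order two. Otherwise their rotations
  \<open>a\<close> and \<open>b\<close> generate a dihedral group preserving the cycle, and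
  \<open>S\<close> is its copy in \<open>P\<close>.\<close>

lemma long_closed:
  assumes c: "ecyc k c" "3 \<le> k" and v0: "c 0 \<in> Y" and out: "c i0 \<notin> Y"
    and step: "\<And>i. i < nat (2 * k) \<Longrightarrow> E (c (int i)) (p i) (c (int (Suc i))) (p (Suc i))" and p0: "p 0 = \<one>\<^bsub>P\<^esub>"
  shows "p (nat (2 * k)) = \<one>\<^bsub>P\<^esub>"
proof -
  note CV = ecyc_V[OF c(1)]
  have vn: "c (int (nat (2 * k))) = c (int 0)" "c (int 0) \<in> Y"
    using ecyc_periodic(1)[OF c(1), of 0] c(2) v0 by simp_all
  obtain j where j: "c j \<in> Y" "c (j + 1) \<notin> Y" using exit_ex[OF c(1) v0 out] .
  obtain l' where l': "c (- l') \<in> Y" "c (- (l' + 1)) \<notin> Y"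
    using exit_ex[OF ecyc_reflect[OF c(1)], of Y "- i0"] v0 out by auto
  define l where "l = - (l' + 1)"
  have l: "c l \<notin> Y" "c (l + 1) \<in> Y" using l' by (simp_all add: l_def)
  obtain J1 where J1: "J1 \<in> \<J>" "{c j, c (j + 1)} \<in> J1" using Y_leave[OF j(1) ecyc_nb(1)[OF c(1)] j(2)] .
  obtain J2 where J2': "J2 \<in> \<J>" "{c (l + 1), c l} \<in> J2" using Y_leave[OF l(2) ecyc_nb(2)[OF c(1)] l(1)] .
  then have J2: "J2 \<in> \<J>" "{c l, c (l + 1)} \<in> J2" by (simp_all add: insert_commute)
  have T: "J1 \<in> TT" "J2 \<in> TT" using TT_iff J1 J2' j l by blast+
  \<comment> \<open>The convex set \<open>Y\<close> meets the cycle in a single arc, so only its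
    exit edge and its entry edge leave it.\<close>
  have leave: "J = J1 \<or> J = J2" if J: "J \<in> TT" "{y, z} \<in> J" "y \<in> Y" "y \<in> range c" "z \<in> range c" for J y z
  proof -
    obtain m where m: "y = c m" using J by blast
    have z: "z \<notin> Y" using TT_not_Y J by blast
    have "z = c (m + 1) \<or> z = c (m - 1)" using ecyc_nbE[OF c(1) J(5)] TT_nb[OF J(1,2)] m by blast
    then show ?thesis
    proof
      assume z1: "z = c (m + 1)"
      then have "{y, z} = {c j, c (j + 1)}"
        using exit_unique[OF c(1) Y_convex j, of m] J m z by simp
      then show ?thesis using hyp_unique[OF \<J>_hyp[OF J1(1)] TT_hyp[OF J(1)]] J1(2) J(2) by metis
    next
      assume z1: "z = c (m - 1)"
      then have "{y, z} = {c l, c (l + 1)}"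
        using entry_unique[OF c(1) Y_convex l, of "m - 1"] J m z by (simp add: insert_commute)
      then show ?thesis using hyp_unique[OF \<J>_hyp[OF J2(1)] TT_hyp[OF J(1)]] J2(2) J(2) by metis
    qed
  qed
  show ?thesis
  proof (cases "J1 = J2")
    case True
    show ?thesis
    proof (rule closing1[where v = "\<lambda>i. c (int i)" and H = J1, OF step p0 vn])
      fix i J s y r
      assume i: "i < nat (2 * k)" "s = \<one> \<or> J1 \<in> TT \<and> s \<in> R J1" "J \<in> TT" "r \<in> R J" "y \<in> Y" "{y, \<phi> r y} \<in> J"
        "c (int i) = \<phi> s y" "c (int (Suc i)) = \<phi> s (\<phi> r y)"
      have V: "y \<in> V" "\<phi> r y \<in> V" using nb_V[OF TT_nb[OF i(3,6)]] by auto
      \<comment> \<open>\<open>s\<close> is trivial or a reflection of the cycle, so pulling back by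
        it stays on the cycle.\<close>
      have "z \<in> range c" if z: "z \<in> V" "c m = \<phi> s z" for m z
      proof (cases "s = \<one>")
        case True
        then have "z = c m" using z by simp
        then show ?thesis by simp
      next
        case False
        then have s: "s \<in> R J1" using i(2) by blast
        have "\<phi> s (c (2 * j + 1 - m)) = c m" using long_reflect[OF J1(1) c J1(2) s False] by simp
        then have "z = c (2 * j + 1 - m)" using act_inj[OF R_carrier[OF s] z(1) CV] z(2) by metis
        then show ?thesis by simp
      qed
      then show "J = J1" using leave[OF i(3,6,5)] V i True by blast
    qed
  next
    case False
    obtain a where a: "a \<in> R J1" "a \<noteq> \<one>" using R_nontrivial[OF J1(1)] by blast
    obtain b where b: "b \<in> R J2" "b \<noteq> \<one>" using R_nontrivial[OF J2(1)] by blast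
    note Ra = long_order_two[OF J1(1) c J1(2) a] and Rb = long_order_two[OF J2(1) c J2(2) b]
    note G = R_carrier[OF a(1)] R_carrier[OF b(1)]
    define \<alpha> \<beta> where "\<alpha> = io J1 a" and "\<beta> = io J2 b"
    have AB: "\<alpha> \<in> carrier P" "\<beta> \<in> carrier P" "\<pi> \<alpha> = a" "\<pi> \<beta> = b"
      using T a b by (simp_all add: \<alpha>_def \<beta>_def \<pi>_\<iota>)
    \<comment> \<open>The dihedral group generated by \<open>\<alpha>\<close> and
      \<open>\<beta>\<close>, as alternating words that begin with \<open>\<alpha>\<close>; words
      beginning with \<open>\<beta>\<close> are recovered through the finite order of the
      product.\<close>
    define S where "S = {(\<alpha> \<otimes>\<^bsub>P\<^esub> \<beta>) [^]\<^bsub>P\<^esub> n |n::nat. True} \<union> {(\<alpha> \<otimes>\<^bsub>P\<^esub> \<beta>) [^]\<^bsub>P\<^esub> n \<otimes>\<^bsub>P\<^esub> \<alpha> |n::nat. True}"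
    have SE: "(\<exists>n::nat. s = (\<alpha> \<otimes>\<^bsub>P\<^esub> \<beta>) [^]\<^bsub>P\<^esub> n \<and> \<pi> s = (a \<otimes> b) [^] n) \<or>
       (\<exists>n::nat. s = (\<alpha> \<otimes>\<^bsub>P\<^esub> \<beta>) [^]\<^bsub>P\<^esub> n \<otimes>\<^bsub>P\<^esub> \<alpha> \<and> \<pi> s = (a \<otimes> b) [^] n \<otimes> a)" if "s \<in> S" for s
      using that AB by (auto simp: S_def \<pi>.hom_nat_pow)
    have aa: "\<alpha> \<otimes>\<^bsub>P\<^esub> \<alpha> = \<one>\<^bsub>P\<^esub>" "\<beta> \<otimes>\<^bsub>P\<^esub> \<beta> = \<one>\<^bsub>P\<^esub>"
      using io_mult[OF T(1) a(1) a(1)] io_mult[OF T(2) b(1) b(1)] Ra(2) Rb(2) io_one T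
      by (simp_all add: \<alpha>_def \<beta>_def)
    note rot = long_rotation[OF J1(1) J2(1) c J1(2) J2(2) a b]
    have rel: "(\<alpha> \<otimes>\<^bsub>P\<^esub> \<beta>) [^]\<^bsub>P\<^esub> n = \<one>\<^bsub>P\<^esub>" if "(a \<otimes> b) [^] n = \<one>" for n :: nat
      using dihedral_rel[OF T False Ra(1) Rb(1) a(2) b(2) Ra(2) Rb(2) that] by (simp add: \<alpha>_def \<beta>_def)
    show ?thesis
    proof (rule closing[where v = "\<lambda>i. c (int i)" and S = S, OF step p0 _ _ vn])
      have "\<one>\<^bsub>P\<^esub> = (\<alpha> \<otimes>\<^bsub>P\<^esub> \<beta>) [^]\<^bsub>P\<^esub> (0::nat)" by simp
      then show "\<one>\<^bsub>P\<^esub> \<in> S" unfolding S_def by blast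
    next
      fix i s J r y
      assume i: "i < nat (2 * k)" "s \<in> S" "s \<in> carrier P" "J \<in> TT" "r \<in> R J" "y \<in> Y" "{y, \<phi> r y} \<in> J"
        "c (int i) = \<phi> (\<pi> s) y" "c (int (Suc i)) = \<phi> (\<pi> s) (\<phi> r y)"
      have V: "y \<in> V" "\<phi> r y \<in> V" using nb_V[OF TT_nb[OF i(4,7)]] by auto
      have sG: "\<pi> s \<in> carrier G" using i(3) by simp
      have "z \<in> range c" if z: "z \<in> V" "c m = \<phi> (\<pi> s) z" for m z
      proof -
        have "\<exists>m'. \<phi> (\<pi> s) (c m') = c m"
          using SE[OF i(2)]
        proof (elim disjE exE conjE)
          fix n :: nat assume "\<pi> s = (a \<otimes> b) [^] n"
          then have "\<phi> (\<pi> s) (c (m - 2 * int n * (j - l))) = c m" using rot(1) by simp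
          then show ?thesis ..
        next
          fix n :: nat assume s: "\<pi> s = (a \<otimes> b) [^] n \<otimes> a"
          have "\<phi> (\<pi> s) (c (2 * j + 1 - (m - 2 * int n * (j - l)))) = c m"
            unfolding s using act_mult[OF nat_pow_closed[OF m_closed[OF G]] G(1) CV]
              long_reflect[OF J1(1) c J1(2) a] rot(1) by simp
          then show ?thesis ..
        qed
        then obtain m' where "\<phi> (\<pi> s) (c m') = \<phi> (\<pi> s) z" using z by auto
        then have "z = c m'" using act_inj[OF sG CV z(1)] by metis
        then show ?thesis by simp
      qed
      then have J: "J = J1 \<or> J = J2" using leave[OF i(4,7,6)] V i(8,9) by blast
      have r1: "r \<noteq> \<one>" using i(7) V nb_irrefl hyp_edge[OF TT_hyp[OF i(4)] i(7)] by auto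
      have ab: "\<alpha> \<otimes>\<^bsub>P\<^esub> \<beta> \<in> carrier P" using AB by simp
      have Sp: "(\<alpha> \<otimes>\<^bsub>P\<^esub> \<beta>) [^]\<^bsub>P\<^esub> n \<in> S" "(\<alpha> \<otimes>\<^bsub>P\<^esub> \<beta>) [^]\<^bsub>P\<^esub> n \<otimes>\<^bsub>P\<^esub> \<alpha> \<in> S" for n :: nat
        unfolding S_def by blast+
      from J show "s \<otimes>\<^bsub>P\<^esub> io J r \<in> S"
      proof
        assume J: "J = J1"
        then have "r = a" using i(5) r1 Ra(1) by auto
        then have io: "io J r = \<alpha>" using J by (simp add: \<alpha>_def)
        from SE[OF i(2)] show ?thesis
          using Sp AB aa ab unfolding io by (auto simp: P.m_assoc)
      next
        assume J: "J = J2"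
        then have "r = b" using i(5) r1 Rb(1) by auto
        then have io: "io J r = \<beta>" using J by (simp add: \<beta>_def)
        from SE[OF i(2)] show ?thesis
        proof (elim disjE exE conjE)
          fix n :: nat assume s: "s = (\<alpha> \<otimes>\<^bsub>P\<^esub> \<beta>) [^]\<^bsub>P\<^esub> n \<otimes>\<^bsub>P\<^esub> \<alpha>"
          have "s \<otimes>\<^bsub>P\<^esub> \<beta> = (\<alpha> \<otimes>\<^bsub>P\<^esub> \<beta>) [^]\<^bsub>P\<^esub> Suc n" using AB ab s by (simp add: P.m_assoc)
          then show ?thesis using Sp(1)[of "Suc n"] io by metis
        next
          \<comment> \<open>The product is \<open>(\<alpha> \<beta>)^(n - 1) \<alpha>\<close>;
            inserting the trivial power with exponent \<open>k = N + 1\<close> keeps the exponent a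
            natural number when \<open>n = 0\<close>.\<close>
          fix n :: nat assume s: "s = (\<alpha> \<otimes>\<^bsub>P\<^esub> \<beta>) [^]\<^bsub>P\<^esub> n"
          obtain N where N: "nat k = Suc N" using c(2) by (cases "nat k") auto
          have "s = (\<alpha> \<otimes>\<^bsub>P\<^esub> \<beta>) [^]\<^bsub>P\<^esub> n \<otimes>\<^bsub>P\<^esub> (\<alpha> \<otimes>\<^bsub>P\<^esub> \<beta>) [^]\<^bsub>P\<^esub> nat k" using rel[OF rot(3)] s ab by simp
          also have "\<dots> = (\<alpha> \<otimes>\<^bsub>P\<^esub> \<beta>) [^]\<^bsub>P\<^esub> (n + N) \<otimes>\<^bsub>P\<^esub> (\<alpha> \<otimes>\<^bsub>P\<^esub> \<beta>)"
            unfolding N using ab by (simp add: P.nat_pow_mult[symmetric] P.m_assoc)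
          finally have "s \<otimes>\<^bsub>P\<^esub> \<beta> = (\<alpha> \<otimes>\<^bsub>P\<^esub> \<beta>) [^]\<^bsub>P\<^esub> (n + N) \<otimes>\<^bsub>P\<^esub> \<alpha>"
            using AB ab aa by (simp add: P.m_assoc)
          then show ?thesis using Sp(2) io by metis
        qed
      qed
    next
      fix s y assume s: "s \<in> S" "s \<in> carrier P" "y \<in> Y" "\<phi> (\<pi> s) y \<in> Y"
      from SE[OF s(1)] show "s = \<one>\<^bsub>P\<^esub>"
      proof (elim disjE exE conjE)
        fix n :: nat assume n: "s = (\<alpha> \<otimes>\<^bsub>P\<^esub> \<beta>) [^]\<^bsub>P\<^esub> n" "\<pi> s = (a \<otimes> b) [^] n"
        have sG: "\<pi> s \<in> carrier G" using s by simp
        have rj: "\<phi> (\<pi> s) (c m) = c (m + 2 * int n * (j - l))" for m using rot(1) n by simp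
        \<comment> \<open>\<open>\<pi> s\<close> preserves \<open>Y\<close> and shifts the cycle, so
          it sends the exit edge to an exit edge, of which there is only one. A shift fixing a
          vertex of the cycle is trivial in \<open>G\<close> by \<open>long_rotation\<close>, and
          \<open>rel\<close> transfers this to \<open>P\<close>.\<close>
        have "c (j + 2 * int n * (j - l)) \<in> Y" "c (j + 2 * int n * (j - l) + 1) \<notin> Y"
          using chamber_map[OF sG s(3,4) CV[of j]] chamber_map[OF sG s(3,4) CV[of "j + 1"]] j rj[of j] rj[of "j + 1"]
          by (simp_all add: algebra_simps)
        then have "c (j + 2 * int n * (j - l)) = c j" using exit_unique[OF c(1) Y_convex j] by blast
        then have "\<phi> ((a \<otimes> b) [^] n) (c j) = c j" using rot(1)[of n j] by simp
        then show ?thesis using rel[OF rot(2)] n by blast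
      next
        fix n :: nat assume n: "\<pi> s = (a \<otimes> b) [^] n \<otimes> a"
        \<comment> \<open>A word of odd length is a non-trivial rotation, and such a rotation maps
          no vertex of \<open>Y\<close> into \<open>Y\<close>.\<close>
        obtain H where H: "H \<in> \<J>" "\<pi> s \<in> R H" "\<pi> s \<noteq> \<one>"
          using dihedral_conj[OF J1(1) J2(1) a(1) Ra(2) b(1) Rb(2) a(2) b(2), of n] unfolding n by blast
        then show ?thesis using R_chamber_free[OF H(2,1) s(3,4)] by blast
      qed
    qed
  qed
qed

text \<open>In a square every edge is one of the two edges at \<open>c 0\<close> or opposite to one
  of them. Whether these two belong to distinct members of \<open>\<J>\<close> decides between
  \<open>closing2\<close> and \<open>closing1'\<close>.\<close>

lemma cycle_closed1:
  assumes c: "ecyc k c"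
    and step: "\<And>i. i < nat (2 * k) \<Longrightarrow> E (c (int i)) (p i) (c (int (Suc i))) (p (Suc i))" and p0: "p 0 = \<one>\<^bsub>P\<^esub>"
  shows "p (nat (2 * k)) = \<one>\<^bsub>P\<^esub>"
proof -
  have k: "2 \<le> k" using ecyc_k[OF c] .
  have "lift \<one>\<^bsub>P\<^esub> (c 0)" using E_props(3)[OF step[of 0]] p0 k by simp
  then have v0: "c 0 \<in> Y" using Y_V by (auto simp: lift_def)
  have vn: "c (int (nat (2 * k))) = c (int 0)" "c (int 0) \<in> Y"
    using ecyc_periodic(1)[OF c, of 0] k v0 by simp_all
  show ?thesis
  proof (cases "\<forall>i. c i \<in> Y")
    case True
    show ?thesis
    proof (rule closing1'[where v = "\<lambda>i. c (int i)", OF step p0 vn])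
      fix i J assume J: "J \<in> \<J>" "{c (int i), c (int (Suc i))} \<in> J"
      have "hsame J (c (int i)) (c (int (Suc i)))" using Y_hsame True J(1) by blast
      \<comment> \<open>A vacuous case, since an edge inside \<open>Y\<close> lies in no member of
        \<open>\<J>\<close>; \<open>undefined\<close> merely instantiates \<open>H\<close>.\<close>
      then show "J = undefined \<and> undefined \<in> TT"
        using hyp_crossing[OF \<J>_hyp[OF J(1)] hyp_edge[OF \<J>_hyp[OF J(1)] J(2)]] J(2) by blast
    qed
  next
    case False
    then obtain i0 where out: "c i0 \<notin> Y" by blast
    show ?thesis
    proof (cases "3 \<le> k")
      case True
      show ?thesis by (rule long_closed[where c = c, OF c True v0 out step p0])
    next
      case False
      then have k2: "k = 2" using k by simp
      note c2 = c[unfolded k2]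
      have cross: "{c 0, c 1} \<in> J \<or> {c 3, c 0} \<in> J" if J: "J \<in> \<J>" "i < nat (2 * k)" "{c (int i), c (int (Suc i))} \<in> J" for i J
      proof -
        have p: "c (i + 4) = c i" for i using ecyc_periodic(1)[OF c2, of i] by simp
        have "i = 0 \<or> i = 1 \<or> i = 2 \<or> i = 3" using J(2) k2 by auto
        then show ?thesis
          using J(3) hyp_opposite[OF \<J>_hyp[OF J(1)] c2, of "int i"] p[of 0] p[of 1] by auto
      qed
      have TTc: "J \<in> TT" if "J \<in> \<J>" "{c 0, c 1} \<in> J \<or> {c 3, c 0} \<in> J" for J
        using that TT_iff v0 insert_commute[of "c 3" "c 0" "{}"] by auto
      show ?thesis
      proof (cases "\<exists>J1 J2. J1 \<in> \<J> \<and> J2 \<in> \<J> \<and> {c 0, c 1} \<in> J1 \<and> {c 3, c 0} \<in> J2 \<and> J1 \<noteq> J2")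
        case True
        then obtain J1 J2 where J: "J1 \<in> \<J>" "J2 \<in> \<J>" "{c 0, c 1} \<in> J1" "{c 3, c 0} \<in> J2" "J1 \<noteq> J2" by blast
        have e: "{c 0, c (0 + 1)} \<in> J1" "{c 3, c (3 + 1)} \<in> J2"
          using J ecyc_periodic(1)[OF c2, of 0] by simp_all
        note sq = square_all[OF J(1,2,5) c2 e]
        show ?thesis
        proof (rule closing2[where v = "\<lambda>i. c (int i)", OF step p0 vn _ _ J(5) _ sq])
          show "J1 \<in> TT" "J2 \<in> TT" using TTc J by blast+
          fix i J assume i: "i < nat (2 * k)" "J \<in> \<J>" "{c (int i), c (int (Suc i))} \<in> J"
          then show "J = J1 \<or> J = J2"
            using cross[OF i(2,1,3)] hyp_unique[OF \<J>_hyp[OF i(2)] \<J>_hyp[OF J(1)]]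
              hyp_unique[OF \<J>_hyp[OF i(2)] \<J>_hyp[OF J(2)]] J by blast
        qed
      next
        case no: False
        \<comment> \<open>At most one member of \<open>\<J>\<close> crosses the square;
          \<open>SOME\<close> names it if there is one.\<close>
        define Q where "Q = (\<lambda>J. J \<in> \<J> \<and> ({c 0, c 1} \<in> J \<or> {c 3, c 0} \<in> J))"
        have uniq: "J = J'" if "Q J" "Q J'" for J J'
          using that no hyp_unique[OF \<J>_hyp \<J>_hyp, of J J'] unfolding Q_def by blast
        show ?thesis
        proof (rule closing1'[where v = "\<lambda>i. c (int i)" and H = "SOME J. Q J", OF step p0 vn])
          fix i J assume i: "i < nat (2 * k)" "J \<in> \<J>" "{c (int i), c (int (Suc i))} \<in> J"
          have J: "Q J" using cross[OF i(2,1,3)] i(2) by (simp add: Q_def)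
          have sJ: "(SOME J. Q J) = J" by (rule some_equality[of Q, OF J]) (rule uniq[OF _ J])
          have "J \<in> TT" using J TTc[of J] unfolding Q_def by blast
          then show "J = (SOME J. Q J) \<and> (SOME J. Q J) \<in> TT" unfolding sJ by simp
        qed
      qed
    qed
  qed
qed

lemma cycle_closed:
  assumes c: "ecyc k c" and step: "\<And>i. E (c (int i)) (p i) (c (int (Suc i))) (p (Suc i))"
  shows "p (nat (2 * k)) = p 0"
proof -
  define g where "g = inv\<^bsub>P\<^esub> (p 0)"
  have pc: "p i \<in> carrier P" for i using E_props(1)[OF step] .
  have gc: "g \<in> carrier P" using pc by (simp add: g_def)
  have "g \<otimes>\<^bsub>P\<^esub> p (nat (2 * k)) = \<one>\<^bsub>P\<^esub>"
    by (rule cycle_closed1[OF act_ecyc[OF \<pi>.hom_closed[OF gc] c], of "\<lambda>i. g \<otimes>\<^bsub>P\<^esub> p i"])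
      (use E_left[OF step gc] pc in \<open>simp_all add: g_def\<close>)
  then show ?thesis using pc unfolding g_def by (metis P.inv_equality P.inv_inv P.inv_comm P.inv_closed)
qed

subsection \<open>Lifting along geodesics\<close>

text \<open>\<open>T x p\<close> says that some geodesic from \<open>bp\<close> to \<open>x\<close>,
  lifted from the identity, ends in the copy of \<open>Y\<close> indexed by
  \<open>p\<close>.\<close>

inductive T :: "'a \<Rightarrow> 'p \<Rightarrow> bool" where
  base: "T bp \<one>\<^bsub>P\<^esub>"
| step: "T x p \<Longrightarrow> E x p x' p' \<Longrightarrow> d bp x' = d bp x + 1 \<Longrightarrow> T x' p'"

lemma T_lift: "T x p \<Longrightarrow> lift p x"
proof (induction rule: T.induct)
  case base
  then show ?case using bp bp_Y by (auto simp: lift_def intro!: bexI[of _ bp])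
qed (use E_props in blast)

lemma T_ex: "x \<in> V \<Longrightarrow> \<exists>p. T x p"
proof (induction "d bp x" arbitrary: x)
  case 0
  then have "x = bp" using d_eq_0 bp by auto
  then show ?case using T.base by blast
next
  case (Suc n)
  obtain w where w: "x \<sim> w" "d bp w = n" "w \<in> V" using d_step_nb[OF bp Suc.prems] Suc.hyps(2) by metis
  then obtain p where p: "T w p" using Suc.hyps(1)[of w] by auto
  then obtain p' where "E w p x p'" using E_ex[OF T_lift[OF p] nb_sym[OF w(1)]] by blast
  then show ?case using T.step[OF p] w Suc.hyps(2) by auto
qed

lemma path_lift:
  assumes v: "\<And>i::nat. v i \<sim> v (Suc i)" and p: "lift p (v 0)"
  shows "\<exists>f. f 0 = p \<and> (\<forall>i. E (v i) (f i) (v (Suc i)) (f (Suc i)))"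
proof -
  define f where "f = rec_nat p (\<lambda>i q. SOME q'. E (v i) q (v (Suc i)) q')"
  have "lift (f i) (v i) \<and> E (v i) (f i) (v (Suc i)) (f (Suc i))" for i
  proof (induction i)
    case 0
    have "lift (f 0) (v 0)" using p by (simp add: f_def)
    moreover have "E (v 0) (f 0) (v (Suc 0)) (f (Suc 0))"
      using someI_ex[OF E_ex[OF calculation v]] by (simp add: f_def)
    ultimately show ?case by blast
  next
    case (Suc i)
    then have "lift (f (Suc i)) (v (Suc i))" using E_props(4) by blast
    moreover have "E (v (Suc i)) (f (Suc i)) (v (Suc (Suc i))) (f (Suc (Suc i)))"
      using someI_ex[OF E_ex[OF calculation v]] by (simp add: f_def)
    ultimately show ?case by blast
  qed
  moreover have "f 0 = p" by (simp add: f_def)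
  ultimately show ?thesis by blast
qed

text \<open>Two geodesics arriving at \<open>x\<close> through different neighbours are rerouted
  through the lowest vertex \<open>c 0\<close> of the cycle given by the cycle condition. By
  induction this does not change the lifts at \<open>y1\<close> and \<open>y2\<close>, and since the
  cycle lifts to a closed path, its two halves end at the same lift of \<open>x\<close>.\<close>

lemma T_unique: "T x p \<Longrightarrow> T x q \<Longrightarrow> p = q"
proof (induction "d bp x" arbitrary: x p q)
  case 0
  have *: "p = \<one>\<^bsub>P\<^esub>" if "T x p" for p
    using that by (cases rule: T.cases) (use 0(1) in auto)
  show ?case using *[OF 0(2)] *[OF 0(3)] by simp
next
  case (Suc n)
  have *: "\<exists>y p1. T y p1 \<and> E y p1 x p \<and> d bp y = n" if "T x p" for p
    using that by (cases rule: T.cases) (use Suc.hyps(2) in auto)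
  obtain y1 p1 where y1: "T y1 p1" "E y1 p1 x p" "d bp y1 = n" using *[OF Suc.prems(1)] by blast
  obtain y2 q1 where y2: "T y2 q1" "E y2 q1 x q" "d bp y2 = n" using *[OF Suc.prems(2)] by blast
  show ?case
  proof (cases "y1 = y2")
    case True
    then have "p1 = q1" using Suc.hyps(1)[of y1] y1 y2 by simp
    then show ?thesis using E_unique y1 y2 True by blast
  next
    case False
    have eq: "d bp y1 = d bp y2" "d bp x = d bp y1 + 1" using y1 y2 Suc.hyps(2) by auto
    obtain k c where c: "ecyc k c" "c k = x" "c (k - 1) = y1" "c (k + 1) = y2" "c 0 \<in> ival X bp y1"
      using cycle_rule[OF bp E_props(5)[OF y1(2)] E_props(5)[OF y2(2)] False eq] by metis
    have k: "2 \<le> k" using ecyc_k[OF c(1)] .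
    note CV = ecyc_V[OF c(1)]
    have "int (d (c 0) (c (k - 1))) = k - 1" using ecyc_d(1)[OF c(1), of "k - 1" 0] k by simp
    then have top: "int (d bp (c k)) = int (d bp (c 0)) + k" using c(2,3,5) eq by (simp add: ival_iff)
    note lev = cycle_levels[OF c(1) bp top]
    obtain t where t: "T (c 0) t" using T_ex[OF CV] by blast
    have n1: "c (int i) \<sim> c (int (Suc i))" for i using ecyc_nb(1)[OF c(1), of "int i"] by (simp add: add.commute)
    have n2: "c (- int i) \<sim> c (- int (Suc i))" for i
    proof -
      have "- int (Suc i) = - int i - 1" by simp
      then show ?thesis using ecyc_nb(3)[OF c(1), of "- int i"] by metis
    qed
    obtain f where f: "f 0 = t" "\<And>i. E (c (int i)) (f i) (c (int (Suc i))) (f (Suc i))"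
      using path_lift[of "\<lambda>i. c (int i)" t] n1 T_lift[OF t] by auto
    \<comment> \<open>\<open>f\<close> lifts the whole cycle in one direction, \<open>h\<close> in
      the other, from the same element \<open>t\<close> above \<open>c 0\<close>.\<close>
    obtain h where h: "h 0 = t" "\<And>i. E (c (- int i)) (h i) (c (- int (Suc i))) (h (Suc i))"
      using path_lift[of "\<lambda>i. c (- int i)" t] n2 T_lift[OF t] by auto
    have Tf: "int i \<le> k \<Longrightarrow> T (c (int i)) (f i)" for i
    proof (induction i)
      case (Suc i)
      have "d bp (c (int (Suc i))) = d bp (c (int i)) + 1"
        using lev(1)[of "int i"] lev(1)[of "int (Suc i)"] Suc by simp
      then show ?case using T.step[OF _ f(2)] Suc by simp
    qed (use t f in simp)
    have Th: "int i \<le> k \<Longrightarrow> T (c (- int i)) (h i)" for i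
    proof (induction i)
      case (Suc i)
      have "d bp (c (- int (Suc i))) = d bp (c (- int i)) + 1"
        using lev(2)[of "int i"] lev(2)[of "int (Suc i)"] Suc by simp
      then show ?case using T.step[OF _ h(2)] Suc by simp
    qed (use t h in simp)
    define m where "m = nat k - 1"
    have m: "k = int (Suc m)" using k by (simp add: m_def)
    have p': "c (- j) = c (2 * k - j)" for j using ecyc_periodic(1)[OF c(1), of "- j"] by (simp add: algebra_simps)
    have ym: "c (int m) = y1" "c (int (Suc m)) = x" "c (- int m) = y2" "c (- int (Suc m)) = x"
      using c m p'[of "int m"] p'[of "int (Suc m)"] by (simp_all add: algebra_simps)
    have "f m = p1" using Suc.hyps(1)[of y1] y1 Tf[of m] ym m by simp
    then have fp: "f (Suc m) = p" using f(2)[of m] E_unique[OF y1(2)] ym by simp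
    have "h m = q1" using Suc.hyps(1)[of y2] y2 Th[of m] ym m by simp
    then have hq: "h (Suc m) = q" using h(2)[of m] E_unique[OF y2(2)] ym by simp
    have cl: "f (nat (2 * k)) = t" using cycle_closed[OF c(1) f(2)] f(1) by simp
    \<comment> \<open>Because \<open>f\<close> closes up, reading it backwards from index
      \<open>2 * k\<close> lifts the same path as \<open>h\<close> from the same start. Both arrive
      at the top vertex after \<open>k\<close> steps.\<close>
    have rev_eq: "j \<le> Suc m \<Longrightarrow> f (nat (2 * k) - j) = h j" for j
    proof (induction j)
      case (Suc j)
      define s where "s = nat (2 * k) - Suc j"
      have s: "Suc s = nat (2 * k) - j" "int (Suc s) = 2 * k - int j" "int s = 2 * k - int (Suc j)"
        using Suc.prems m by (auto simp: s_def)
      have "E (c (int (Suc s))) (f (Suc s)) (c (int s)) (f s)" using E_sym[OF f(2)] .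
      then have "E (c (- int j)) (h j) (c (- int (Suc j))) (f s)"
        using Suc s p'[of "int j"] p'[of "int (Suc j)"] by simp
      then show ?case using E_unique[OF h(2)] by (simp add: s_def)
    qed (use cl h in simp)
    have "nat (2 * k) - Suc m = Suc m" using m by simp
    then have "f (Suc m) = h (Suc m)" using rev_eq[of "Suc m"] by simp
    then show ?thesis using fp hq by simp
  qed
qed

text \<open>The vertices selected by \<open>T\<close>, one above each vertex of \<open>X\<close>,
  form a copy of \<open>X\<close>. Edges between different levels belong to it by construction; an
  edge within a level is the base of a triangle with a lower vertex, and triangles lift to closed
  paths.\<close>

lemma T_edge:
  assumes "x \<sim> x'" "T x p" "T x' p'"
  shows "E x p x' p'"
proof -
  have up: "E x p x' p'" if u: "x \<sim> x'" "T x p" "T x' p'" "d bp x' = d bp x + 1" for x p x' p'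
  proof -
    obtain p'' where e: "E x p x' p''" using E_ex[OF T_lift[OF u(2)] u(1)] by blast
    then have "T x' p''" using T.step[OF u(2)] u(4) by blast
    then show ?thesis using T_unique[OF u(3)] e by blast
  qed
  have V: "x \<in> V" "x' \<in> V" using nb_V assms by auto
  consider "d bp x' = d bp x + 1" | "d bp x = d bp x' + 1" | "d bp x = d bp x'"
    using d_nb_le[OF assms(1) bp] by linarith
  then show ?thesis
  proof cases
    case 1
    then show ?thesis using up assms by blast
  next
    case 2
    then show ?thesis using E_sym[OF up[OF nb_sym[OF assms(1)] assms(3,2)]] by blast
  next
    case 3
    then obtain z where z: "x \<sim> z" "x' \<sim> z" "d bp x = d bp z + 1" "z \<in> V"
      using triangle_rule[OF bp assms(1)] by metis
    obtain t where t: "T z t" using T_ex[OF z(4)] by blast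
    have "E z t x p" "E z t x' p'" using up[OF nb_sym[OF z(1)] t assms(2)] up[OF nb_sym[OF z(2)] t assms(3)] z 3 by auto
    then show ?thesis using triangle_closed[OF E_sym _ assms(1)] by blast
  qed
qed

lemma T_step:
  assumes "T x p" "E x p x' p'" shows "T x' p'"
proof -
  obtain q where q: "T x' q" using T_ex[OF nb_V(2)[OF E_props(5)[OF assms(2)]]] by blast
  then show ?thesis using T_edge[OF E_props(5)[OF assms(2)] assms(1) q] E_unique[OF assms(2)] by blast
qed

text \<open>\<open>Y\<close> is convex, hence connected, so \<open>T\<close> spreads over a whole
  copy of \<open>Y\<close> in the covering.\<close>

lemma T_chamber:
  assumes p: "p \<in> carrier P" and y': "y' \<in> Y"
  shows "y \<in> Y \<Longrightarrow> T (\<phi> (\<pi> p) y) p \<Longrightarrow> T (\<phi> (\<pi> p) y') p"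
proof (induction "d y' y" arbitrary: y)
  case 0
  then have "y' = y" using d_eq_0 Y_V y' by auto
  then show ?case using 0 by simp
next
  case (Suc n)
  note V = Y_V[OF Suc.prems(1)] Y_V[OF y']
  obtain z where z: "y \<sim> z" "d y' z = n" "z \<in> V" using d_step_nb[OF V(2,1)] Suc.hyps(2) by metis
  have "z \<in> Y" using convexD[OF Y_convex y' Suc.prems(1) z(3)] z Suc.hyps(2) d_nb[OF nb_sym[OF z(1)]] by simp
  then have "E (\<phi> (\<pi> p) y) p (\<phi> (\<pi> p) z) p" using E.inside p Suc.prems(1) z by blast
  then have "T (\<phi> (\<pi> p) z) p" using T_step Suc.prems(2) by blast
  then show ?case using Suc.hyps(1)[of z] z \<open>z \<in> Y\<close> by simp
qed

text \<open>Connectedness of the covering: multiplying on the right by a generator leads to an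
  adjacent copy of \<open>Y\<close>, and the generators yield all of \<open>P\<close>.\<close>

lemma T_all:
  assumes p: "p \<in> carrier P" and y: "y \<in> Y"
  shows "T (\<phi> (\<pi> p) y) p"
proof -
  define good where "good = (\<lambda>p. p \<in> carrier P \<and> (\<forall>y\<in>Y. T (\<phi> (\<pi> p) y) p))"
  have gI: "good p" if "p \<in> carrier P" "y \<in> Y" "T (\<phi> (\<pi> p) y) p" for p y
    unfolding good_def using T_chamber[OF that(1) _ that(2,3)] that(1) by blast
  have io: "good (p \<otimes>\<^bsub>P\<^esub> io J r)" if p: "good p" and J: "J \<in> TT" "r \<in> R J" for p J r
  proof (cases "r = \<one>")
    case True
    then show ?thesis using p io_one[OF J(1)] by (simp add: good_def)
  next
    case False
    have pc: "p \<in> carrier P" using p by (simp add: good_def)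
    obtain x x' where x: "{x, x'} \<in> J" "x \<in> Y" using TT_edge[OF J(1)] by metis
    have e: "{x, \<phi> r x} \<in> J" using R_edge_moved(1)[OF J(2) TT_\<J>[OF J(1)] False x(1)] .
    have "E (\<phi> (\<pi> p) x) p (\<phi> (\<pi> p) (\<phi> r x)) (p \<otimes>\<^bsub>P\<^esub> io J r)" using E.cross pc x(2) J e by blast
    moreover have "T (\<phi> (\<pi> p) x) p" using p x(2) by (simp add: good_def)
    ultimately have "T (\<phi> (\<pi> p) (\<phi> r x)) (p \<otimes>\<^bsub>P\<^esub> io J r)" by (rule T_step[rotated])
    moreover have "\<phi> (\<pi> p) (\<phi> r x) = \<phi> (\<pi> (p \<otimes>\<^bsub>P\<^esub> io J r)) x"
      using act_mult[of "\<pi> p" r x] pc R_carrier[OF J(2)] Y_V[OF x(2)] J by (simp add: \<pi>_\<iota>)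
    ultimately show ?thesis using gI[of "p \<otimes>\<^bsub>P\<^esub> io J r" x] pc J x(2) by simp
  qed
  \<comment> \<open>Stated for right multiplication of an arbitrary good element, so that the
    induction passes through products.\<close>
  have "q \<in> carrier P \<and> (\<forall>p. good p \<longrightarrow> good (p \<otimes>\<^bsub>P\<^esub> q))" if "q \<in> generate P (\<Union>J\<in>TT. \<iota> (R J) ` R J)" for q
    using that
  proof (induction rule: generate.induct)
    case one
    then show ?case by (simp add: good_def)
  next
    case (incl h)
    then show ?case using io by auto
  next
    case (inv h)
    then obtain J r where J: "J \<in> TT" "r \<in> R J" "h = io J r" by blast
    then have "inv\<^bsub>P\<^esub> h = io J (inv r)" using io_inv by simp
    then show ?case using io[OF _ J(1) R_inv[OF J(2)]] J R_inv[OF J(2)] by simp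
  next
    case (eng h1 h2)
    then show ?case by (metis P.m_assoc P.m_closed good_def)
  qed
  moreover have "good \<one>\<^bsub>P\<^esub>"
    using gI[OF P.one_closed bp_Y] T.base bp by simp
  ultimately have "good (\<one>\<^bsub>P\<^esub> \<otimes>\<^bsub>P\<^esub> p)" using p P_gen by blast
  then show ?thesis using y p by (simp add: good_def)
qed

text \<open>Over \<open>\<phi> (\<pi> p) y\<close> lie a vertex of the copy of \<open>Y\<close>
  indexed by \<open>p\<close> and one of the copy indexed by the identity; over each vertex there is
  only one.\<close>

theorem chamber_free:
  assumes p: "p \<in> carrier P" and y: "y \<in> Y" "\<phi> (\<pi> p) y \<in> Y"
  shows "p = \<one>\<^bsub>P\<^esub>"
proof -
  have "T (\<phi> (\<pi> p) y) p" using T_all[OF p y(1)] .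
  moreover have "T (\<phi> (\<pi> p) y) \<one>\<^bsub>P\<^esub>" using T_all[OF P.one_closed y(2)] Y_V[OF y(2)] by simp
  ultimately show ?thesis using T_unique by blast
qed

end

section \<open>Free products\<close>

lemma map_alt_word: "map f (alt_word n x y) = alt_word n (f x) (f y)"
  by (induction n arbitrary: x y) auto

lemma set_alt_word: "set (alt_word n x y) \<subseteq> {x, y}"
proof (induction n arbitrary: x y)
  case (Suc n)
  then show ?case using Suc[of y x] by auto
qed auto

definition (in monoid) mprod :: "'a list \<Rightarrow> 'a" where "mprod w = foldr (\<otimes>) w \<one>"

lemma (in monoid) mprod_simps [simp]: "mprod [] = \<one>" "mprod (x # w) = x \<otimes> mprod w"
  by (simp_all add: mprod_def)

lemma (in monoid) mprod_closed [simp]: "set w \<subseteq> carrier G \<Longrightarrow> mprod w \<in> carrier G"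
  by (induction w) auto

lemma (in monoid) mprod_append: "set v \<subseteq> carrier G \<Longrightarrow> set w \<subseteq> carrier G \<Longrightarrow> mprod (v @ w) = mprod v \<otimes> mprod w"
  by (induction v) (auto simp: m_assoc)

lemma (in monoid) alt_closed [simp]:
  "x \<in> carrier G \<Longrightarrow> y \<in> carrier G \<Longrightarrow> mprod (alt_word n x y) \<in> carrier G"
  by (induction n arbitrary: x y) auto

text \<open>The inverse of an alternating word in involutions is its reversal, so the quotient of
  the two words alternates throughout its \<open>2 n\<close> letters.\<close>

lemma (in group) involution_alt:
  assumes "x \<in> carrier G" "y \<in> carrier G" "x \<otimes> x = \<one>" "y \<otimes> y = \<one>"
  shows "mprod (alt_word n x y) \<otimes> inv (mprod (alt_word n y x)) = (x \<otimes> y) [^] n"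
  using assms
proof (induction n arbitrary: x y)
  case (Suc n)
  have c: "mprod (alt_word n x y) \<in> carrier G" "mprod (alt_word n y x) \<in> carrier G"
    using Suc.prems by simp_all
  have "mprod (alt_word (Suc n) x y) \<otimes> inv (mprod (alt_word (Suc n) y x)) =
    x \<otimes> (mprod (alt_word n y x) \<otimes> inv (mprod (alt_word n x y))) \<otimes> inv y"
    using c Suc.prems by (simp add: inv_mult_group m_assoc)
  also have "\<dots> = x \<otimes> (y \<otimes> x) [^] n \<otimes> y" using Suc by (simp add: inv_equality)
  also have "\<dots> = (x \<otimes> y) [^] Suc n"
  proof (induction n)
    case (Suc n)
    have "x \<otimes> (y \<otimes> x) [^] Suc n \<otimes> y = (x \<otimes> (y \<otimes> x) [^] n \<otimes> y) \<otimes> (x \<otimes> y)"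
      using \<open>x \<in> carrier G\<close> \<open>y \<in> carrier G\<close> by (simp add: m_assoc)
    then show ?case using Suc by simp
  qed (use Suc.prems in simp)
  finally show ?case .
qed simp

text \<open>Exchanges braid relations for orders of products, the form in which shifts of long
  cycles supply them.\<close>

lemma (in group) involution_braid:
  assumes "x \<in> carrier G" "y \<in> carrier G" "x \<otimes> x = \<one>" "y \<otimes> y = \<one>"
  shows "mprod (alt_word n x y) = mprod (alt_word n y x) \<longleftrightarrow> (x \<otimes> y) [^] n = \<one>"
proof -
  have c: "mprod (alt_word n x y) \<in> carrier G" "mprod (alt_word n y x) \<in> carrier G"
    using assms by simp_all
  have "mprod (alt_word n x y) = mprod (alt_word n y x) \<longleftrightarrow>
     mprod (alt_word n x y) \<otimes> inv (mprod (alt_word n y x)) = \<one>"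
    using c by (metis inv_equality inv_inv r_inv inv_closed)
  then show ?thesis using involution_alt[OF assms] by simp
qed

section \<open>The group structure of a free product\<close>

locale group_family =
  fixes I :: "'i set" and \<G> :: "'i \<Rightarrow> ('g, 'm) monoid_scheme"
  assumes fam: "\<And>u. u \<in> I \<Longrightarrow> group (\<G> u)"
begin

abbreviation W where "W \<equiv> fp_words I \<G>"
abbreviation Eq where "Eq \<equiv> fp_eq I \<G>"
abbreviation F where "F \<equiv> free_product I \<G>"
abbreviation cl where "cl \<equiv> fp_class I \<G>"

lemma W_simps [simp]: "[] \<in> W" "(u, a) # w \<in> W \<longleftrightarrow> u \<in> I \<and> a \<in> carrier (\<G> u) \<and> w \<in> W"
  "v @ w \<in> W \<longleftrightarrow> v \<in> W \<and> w \<in> W"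
  by (auto simp: fp_words_def)

lemma step_words: "(v, w) \<in> fp_step I \<G> \<Longrightarrow> v \<in> W \<and> w \<in> W"
  using fam by (auto simp: fp_step_def group.is_monoid monoid.one_closed monoid.m_closed)

lemma Eq_refl: "(v, v) \<in> Eq" by (simp add: fp_eq_def)
lemma Eq_trans: "(u, v) \<in> Eq \<Longrightarrow> (v, w) \<in> Eq \<Longrightarrow> (u, w) \<in> Eq" unfolding fp_eq_def by (rule rtrancl_trans)
lemma Eq_sym: "(v, w) \<in> Eq \<Longrightarrow> (w, v) \<in> Eq"
  unfolding fp_eq_def by (metis sym_rtrancl symD sym_Un_converse)

lemma Eq_step: "(v, w) \<in> fp_step I \<G> \<Longrightarrow> (v, w) \<in> Eq"
  unfolding fp_eq_def by auto

lemma Eq_words: assumes "(v, w) \<in> Eq" "v \<in> W" shows "w \<in> W"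
  using assms unfolding fp_eq_def by (induction rule: rtrancl_induct) (auto dest: step_words)

lemma step_context:
  assumes "(v, w) \<in> fp_step I \<G>" "p \<in> W" "q \<in> W"
  shows "(p @ v @ q, p @ w @ q) \<in> fp_step I \<G>"
  using assms(1) unfolding fp_step_def
proof (elim UnE, goal_cases)
  case 1
  then obtain p' q' u where 1: "v = p' @ [(u, \<one>\<^bsub>\<G> u\<^esub>)] @ q'" "w = p' @ q'" "p' \<in> W" "q' \<in> W" "u \<in> I" by auto
  then have "p @ v @ q = (p @ p') @ [(u, \<one>\<^bsub>\<G> u\<^esub>)] @ (q' @ q)" "p @ w @ q = (p @ p') @ (q' @ q)"
    "p @ p' \<in> W" "q' @ q \<in> W" using assms by auto
  then show ?case using 1(5) by blast
next
  case 2
  then obtain p' q' u a b where 2: "v = p' @ [(u, a), (u, b)] @ q'" "w = p' @ [(u, a \<otimes>\<^bsub>\<G> u\<^esub> b)] @ q'"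
    "p' \<in> W" "q' \<in> W" "u \<in> I" "a \<in> carrier (\<G> u)" "b \<in> carrier (\<G> u)" by auto
  then have "p @ v @ q = (p @ p') @ [(u, a), (u, b)] @ (q' @ q)"
    "p @ w @ q = (p @ p') @ [(u, a \<otimes>\<^bsub>\<G> u\<^esub> b)] @ (q' @ q)" "p @ p' \<in> W" "q' @ q \<in> W" using assms by auto
  then show ?case using 2(5-7) by blast
qed

lemma Eq_context:
  assumes "(v, w) \<in> Eq" "p \<in> W" "q \<in> W" shows "(p @ v @ q, p @ w @ q) \<in> Eq"
  using assms(1) unfolding fp_eq_def
proof (induction rule: rtrancl_induct)
  case (step w w')
  then have "(p @ w @ q, p @ w' @ q) \<in> fp_step I \<G> \<union> (fp_step I \<G>)\<inverse>"
    using step_context[OF _ assms(2,3)] by blast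
  then show ?case using step.IH by (rule rtrancl_into_rtrancl[rotated])
qed simp

lemma Eq_append:
  assumes "(v, v') \<in> Eq" "(w, w') \<in> Eq" "v \<in> W" "w \<in> W" shows "(v @ w, v' @ w') \<in> Eq"
proof -
  have "(v @ w, v' @ w) \<in> Eq" using Eq_context[OF assms(1), of "[]" w] assms(4) by simp
  moreover have "(v' @ w, v' @ w') \<in> Eq"
    using Eq_context[OF assms(2), of v' "[]"] Eq_words[OF assms(1,3)] by simp
  ultimately show ?thesis by (rule Eq_trans)
qed

lemma cl_mem: "v \<in> cl w \<longleftrightarrow> (w, v) \<in> Eq" by (simp add: fp_class_def)

lemma cl_eq: "cl v = cl w \<longleftrightarrow> (v, w) \<in> Eq"
proof
  assume "cl v = cl w"
  then show "(v, w) \<in> Eq" using cl_mem Eq_refl by blast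
next
  assume "(v, w) \<in> Eq"
  then show "cl v = cl w" unfolding fp_class_def using Eq_trans Eq_sym by blast
qed

lemma F_carrier: "carrier F = cl ` W"
  by (auto simp: free_product_def quotient_def fp_class_def)

lemma F_one: "\<one>\<^bsub>F\<^esub> = cl []" by (simp add: free_product_def)

lemma F_mult: assumes "v \<in> W" "w \<in> W" shows "cl v \<otimes>\<^bsub>F\<^esub> cl w = cl (v @ w)"
proof -
  have "cl (v' @ w') = cl (v @ w)" if "v' \<in> cl v" "w' \<in> cl w" for v' w'
    using that Eq_append[of v v' w w'] assms Eq_sym unfolding cl_mem cl_eq by blast
  moreover have "v \<in> cl v" "w \<in> cl w" using cl_mem Eq_refl by auto
  ultimately have "(\<Union>v'\<in>cl v. \<Union>w'\<in>cl w. cl (v' @ w')) = cl (v @ w)" by blast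
  then show ?thesis by (simp add: free_product_def)
qed

lemma letter_inv:
  assumes "u \<in> I" "a \<in> carrier (\<G> u)"
  shows "([(u, inv\<^bsub>\<G> u\<^esub> a), (u, a)], []) \<in> Eq"
proof -
  interpret u: group "\<G> u" by (rule fam[OF assms(1)])
  have "([] @ [(u, inv\<^bsub>\<G> u\<^esub> a), (u, a)] @ [], [] @ [(u, inv\<^bsub>\<G> u\<^esub> a \<otimes>\<^bsub>\<G> u\<^esub> a)] @ []) \<in> fp_step I \<G>"
    unfolding fp_step_def using assms W_simps(1) u.inv_closed by blast
  moreover have "([] @ [(u, \<one>\<^bsub>\<G> u\<^esub>)] @ [], [] @ []) \<in> fp_step I \<G>"
    unfolding fp_step_def using assms W_simps(1) by blast
  ultimately show ?thesis using Eq_trans[OF Eq_step Eq_step] assms by simp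
qed

lemma word_inv: "w \<in> W \<Longrightarrow> \<exists>v\<in>W. (v @ w, []) \<in> Eq"
proof (induction w)
  case (Cons l w)
  obtain u a where l: "l = (u, a)" by fastforce
  then have la: "u \<in> I" "a \<in> carrier (\<G> u)" "w \<in> W" using Cons by auto
  interpret u: group "\<G> u" by (rule fam[OF la(1)])
  obtain v where v: "v \<in> W" "(v @ w, []) \<in> Eq" using Cons la by blast
  have "(v @ [(u, inv\<^bsub>\<G> u\<^esub> a), (u, a)] @ w, v @ [] @ w) \<in> Eq"
    using Eq_context[OF letter_inv[OF la(1,2)] v(1) la(3)] .
  then have "((v @ [(u, inv\<^bsub>\<G> u\<^esub> a)]) @ l # w, []) \<in> Eq" using Eq_trans v(2) l by simp
  then show ?case using v(1) la by (metis W_simps u.inv_closed)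
qed (use Eq_refl in \<open>auto intro: bexI[of _ "[]"]\<close>)

lemma F_group: "group F"
proof (rule groupI)
  show "\<one>\<^bsub>F\<^esub> \<in> carrier F" by (simp add: F_one F_carrier)
  show "x \<otimes>\<^bsub>F\<^esub> y \<in> carrier F" if "x \<in> carrier F" "y \<in> carrier F" for x y
    using that F_mult by (auto simp: F_carrier)
  show "x \<otimes>\<^bsub>F\<^esub> y \<otimes>\<^bsub>F\<^esub> z = x \<otimes>\<^bsub>F\<^esub> (y \<otimes>\<^bsub>F\<^esub> z)" if "x \<in> carrier F" "y \<in> carrier F" "z \<in> carrier F" for x y z
    using that F_mult by (auto simp: F_carrier)
  show "\<one>\<^bsub>F\<^esub> \<otimes>\<^bsub>F\<^esub> x = x" if "x \<in> carrier F" for x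
    using that F_mult by (auto simp: F_carrier F_one)
  show "\<exists>y\<in>carrier F. y \<otimes>\<^bsub>F\<^esub> x = \<one>\<^bsub>F\<^esub>" if x: "x \<in> carrier F" for x
  proof -
    obtain w where w: "w \<in> W" "x = cl w" using x by (auto simp: F_carrier)
    then obtain v where "v \<in> W" "(v @ w, []) \<in> Eq" using word_inv by blast
    then show ?thesis using w F_mult cl_eq by (auto simp: F_carrier F_one)
  qed
qed

lemma letter_hom: "u \<in> I \<Longrightarrow> (\<lambda>a. cl [(u, a)]) \<in> hom (\<G> u) F"
proof (rule homI)
  assume u: "u \<in> I"
  show "cl [(u, a)] \<in> carrier F" if "a \<in> carrier (\<G> u)" for a using that u by (simp add: F_carrier)
  fix a b assume ab: "a \<in> carrier (\<G> u)" "b \<in> carrier (\<G> u)"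
  have "([] @ [(u, a), (u, b)] @ [], [] @ [(u, a \<otimes>\<^bsub>\<G> u\<^esub> b)] @ []) \<in> fp_step I \<G>"
    unfolding fp_step_def using u ab W_simps(1) by blast
  then have "cl [(u, a), (u, b)] = cl [(u, a \<otimes>\<^bsub>\<G> u\<^esub> b)]" using Eq_step cl_eq by simp
  then show "cl [(u, a \<otimes>\<^bsub>\<G> u\<^esub> b)] = cl [(u, a)] \<otimes>\<^bsub>F\<^esub> cl [(u, b)]"
    using F_mult[of "[(u, a)]" "[(u, b)]"] u ab by simp
qed

lemma F_generate: "carrier F = generate F (\<Union>u\<in>I. (\<lambda>a. cl [(u, a)]) ` carrier (\<G> u))"
proof -
  interpret F: group F by (rule F_group)
  define L where "L = (\<Union>u\<in>I. (\<lambda>a. cl [(u, a)]) ` carrier (\<G> u))"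
  have LF: "L \<subseteq> carrier F" by (auto simp: L_def F_carrier)
  have "cl w \<in> generate F L" if "w \<in> W" for w
    using that
  proof (induction w)
    case Nil
    then show ?case using generate.one[of F L] by (simp add: F_one)
  next
    case (Cons l w)
    obtain u a where l: "l = (u, a)" by fastforce
    then have la: "u \<in> I" "a \<in> carrier (\<G> u)" "w \<in> W" using Cons by auto
    have "cl [(u, a)] \<in> generate F L" by (rule generate.incl) (use la in \<open>auto simp: L_def\<close>)
    then have "cl [(u, a)] \<otimes>\<^bsub>F\<^esub> cl w \<in> generate F L" using Cons.IH[OF la(3)] by (rule generate.eng)
    then show ?case using F_mult[of "[(u, a)]" w] la l by simp
  qed
  then have "carrier F \<subseteq> generate F L" by (auto simp: F_carrier)
  moreover have "generate F L \<subseteq> carrier F" using F.generate_incl[OF LF] .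
  ultimately show ?thesis by (simp add: L_def)
qed

subsection \<open>Normal forms\<close>

text \<open>Left multiplication of a reduced word by a letter, as in van der Waerden's argument:
  each factor acts on reduced words, so equivalent words have the same normal form and no confluence
  argument is needed.\<close>

definition nact :: "'i \<Rightarrow> 'g \<Rightarrow> ('i \<times> 'g) list \<Rightarrow> ('i \<times> 'g) list" where
  "nact u a w = (if a = \<one>\<^bsub>\<G> u\<^esub> then w else
     (case w of [] \<Rightarrow> [(u, a)] | (u', b) # w' \<Rightarrow>
        if u' = u then (if a \<otimes>\<^bsub>\<G> u\<^esub> b = \<one>\<^bsub>\<G> u\<^esub> then w' else (u, a \<otimes>\<^bsub>\<G> u\<^esub> b) # w') else (u, a) # w))"

fun nred :: "('i \<times> 'g) list \<Rightarrow> bool" where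
  "nred [] \<longleftrightarrow> True"
| "nred ((u, a) # w) \<longleftrightarrow> u \<in> I \<and> a \<in> carrier (\<G> u) \<and> a \<noteq> \<one>\<^bsub>\<G> u\<^esub> \<and> nred w \<and> (w \<noteq> [] \<longrightarrow> fst (hd w) \<noteq> u)"

definition nf where "nf w = foldr (\<lambda>(u, a). nact u a) w []"

lemma nact_nred:
  assumes "u \<in> I" "a \<in> carrier (\<G> u)" "nred w" shows "nred (nact u a w)"
proof -
  interpret u: group "\<G> u" by (rule fam[OF assms(1)])
  show ?thesis
  proof (cases w)
    case (Cons l w')
    then show ?thesis using assms by (cases l) (auto simp: nact_def)
  qed (use assms in \<open>auto simp: nact_def\<close>)
qed

lemma nact_mult:
  assumes u: "u \<in> I" "a \<in> carrier (\<G> u)" "b \<in> carrier (\<G> u)" and w: "nred w"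
  shows "nact u a (nact u b w) = nact u (a \<otimes>\<^bsub>\<G> u\<^esub> b) w"
proof -
  interpret u: group "\<G> u" by (rule fam[OF u(1)])
  have ne: "a \<otimes>\<^bsub>\<G> u\<^esub> x \<noteq> \<one>\<^bsub>\<G> u\<^esub>" if "x = \<one>\<^bsub>\<G> u\<^esub>" "a \<noteq> \<one>\<^bsub>\<G> u\<^esub>" for x using that u by simp
  show ?thesis
  proof (cases w)
    case Nil
    then show ?thesis using u by (simp add: nact_def)
  next
    case (Cons l w')
    obtain u' c where l: "l = (u', c)" by fastforce
    show ?thesis
    proof (cases "u' = u")
      case False
      then show ?thesis using u Cons l by (simp add: nact_def)
    next
      case True
      then have c: "c \<in> carrier (\<G> u)" "c \<noteq> \<one>\<^bsub>\<G> u\<^esub>" "w' \<noteq> [] \<longrightarrow> fst (hd w') \<noteq> u" using w Cons l by auto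
      have w': "nact u x w' = (if x = \<one>\<^bsub>\<G> u\<^esub> then w' else (u, x) # w')" for x
        using c(3) by (cases w') (auto simp: nact_def)
      have key: "nact u x (if y = \<one>\<^bsub>\<G> u\<^esub> then w' else (u, y) # w') =
        (if x \<otimes>\<^bsub>\<G> u\<^esub> y = \<one>\<^bsub>\<G> u\<^esub> then w' else (u, x \<otimes>\<^bsub>\<G> u\<^esub> y) # w')" if "x \<in> carrier (\<G> u)" "y \<in> carrier (\<G> u)" for x y
        using that w'[of x] by (cases "y = \<one>\<^bsub>\<G> u\<^esub>") (simp_all add: nact_def[of u x "(u, y) # w'"])
      \<comment> \<open>\<open>h y\<close> is \<open>w'\<close> with the letter \<open>y\<close> in
        front, dropped when trivial. On these words \<open>nact\<close> is multiplication in the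
        group of \<open>u\<close>, which covers all cancellations at once.\<close>
      define h where "h y = (if y = \<one>\<^bsub>\<G> u\<^esub> then w' else (u, y) # w')" for y
      have "w = h c" using Cons l True c by (simp add: h_def)
      moreover have "nact u x (h y) = h (x \<otimes>\<^bsub>\<G> u\<^esub> y)" if "x \<in> carrier (\<G> u)" "y \<in> carrier (\<G> u)" for x y
        using key[OF that] by (simp add: h_def)
      ultimately show ?thesis using u c by (simp add: u.m_assoc)
    qed
  qed
qed

lemma nf_nred: "w \<in> W \<Longrightarrow> nred (nf w)"
proof (induction w)
  case (Cons l w)
  then show ?case using nact_nred by (cases l) (auto simp: nf_def)
qed (simp add: nf_def)

lemma nf_step: assumes "(v, w) \<in> fp_step I \<G>" shows "nf v = nf w"
proof -
  have ap: "nf (p @ q) = foldr (\<lambda>(u, a). nact u a) p (nf q)" for p q by (simp add: nf_def)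
  from assms show ?thesis unfolding fp_step_def
  proof (elim UnE, goal_cases)
    case 1
    then obtain p q u where 1: "v = p @ [(u, \<one>\<^bsub>\<G> u\<^esub>)] @ q" "w = p @ q" by auto
    have "nf ([(u, \<one>\<^bsub>\<G> u\<^esub>)] @ q) = nf q" by (simp add: nf_def nact_def)
    then show ?case using 1 ap by simp
  next
    case 2
    then obtain p q u a b where 2: "v = p @ [(u, a), (u, b)] @ q" "w = p @ [(u, a \<otimes>\<^bsub>\<G> u\<^esub> b)] @ q"
      "q \<in> W" "u \<in> I" "a \<in> carrier (\<G> u)" "b \<in> carrier (\<G> u)" by auto
    have "nf ([(u, a), (u, b)] @ q) = nf ([(u, a \<otimes>\<^bsub>\<G> u\<^esub> b)] @ q)"
      using nact_mult[OF 2(4-6) nf_nred[OF 2(3)]] by (simp add: nf_def)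
    then show ?case using 2 ap by simp
  qed
qed

lemma nf_Eq: "(v, w) \<in> Eq \<Longrightarrow> nf v = nf w"
  unfolding fp_eq_def by (induction rule: rtrancl_induct) (auto dest: nf_step)

lemma nf_nred_id: "nred w \<Longrightarrow> nf w = w"
proof (induction w)
  case (Cons l w)
  obtain u a where l: "l = (u, a)" by fastforce
  have "nf (l # w) = nact u a w" using Cons l by (simp add: nf_def)
  also have "\<dots> = l # w" using Cons.prems l by (cases w) (auto simp: nact_def)
  finally show ?case .
qed (simp add: nf_def)

lemma nred_W: "nred w \<Longrightarrow> w \<in> W"
  by (induction w rule: nred.induct) auto

lemma nact_Eq:
  assumes "u \<in> I" "a \<in> carrier (\<G> u)" "nred w" shows "((u, a) # w, nact u a w) \<in> Eq"
proof -
  interpret u: group "\<G> u" by (rule fam[OF assms(1)])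
  note wW = nred_W[OF assms(3)]
  have one: "((u, \<one>\<^bsub>\<G> u\<^esub>) # v, v) \<in> Eq" if v: "v \<in> W" for v
  proof -
    have "([] @ [(u, \<one>\<^bsub>\<G> u\<^esub>)] @ v, [] @ v) \<in> fp_step I \<G>"
      unfolding fp_step_def using assms(1) v W_simps(1) by blast
    then show ?thesis using Eq_step by simp
  qed
  have two: "((u, a) # (u, b) # v, (u, a \<otimes>\<^bsub>\<G> u\<^esub> b) # v) \<in> Eq" if v: "v \<in> W" "b \<in> carrier (\<G> u)" for v b
  proof -
    have "([] @ [(u, a), (u, b)] @ v, [] @ [(u, a \<otimes>\<^bsub>\<G> u\<^esub> b)] @ v) \<in> fp_step I \<G>"
      unfolding fp_step_def using assms(1,2) v W_simps(1) by blast
    then show ?thesis using Eq_step by simp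
  qed
  show ?thesis
  proof (cases w)
    case Nil
    then show ?thesis using one[of w] wW Eq_refl by (simp add: nact_def)
  next
    case (Cons l w')
    obtain u' b where l: "l = (u', b)" by fastforce
    show ?thesis
    proof (cases "u' = u \<and> a \<noteq> \<one>\<^bsub>\<G> u\<^esub>")
      case True
      then have "b \<in> carrier (\<G> u)" "w' \<in> W" using wW Cons l by auto
      then show ?thesis using True two[of w' b] one[of w'] Eq_trans[OF two[of w' b]] Cons l
        by (auto simp: nact_def)
    next
      case False
      then show ?thesis using one[OF wW] Eq_refl Cons l by (auto simp: nact_def)
    qed
  qed
qed

lemma nf_rep: "w \<in> W \<Longrightarrow> (w, nf w) \<in> Eq"
proof (induction w)
  case (Cons l w)
  obtain u a where l: "l = (u, a)" by fastforce
  then have la: "u \<in> I" "a \<in> carrier (\<G> u)" "w \<in> W" using Cons by auto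
  have "(l # w, l # nf w) \<in> Eq"
    using Eq_context[OF Cons.IH[OF la(3)], of "[l]" "[]"] la l by simp
  moreover have "(l # nf w, nf (l # w)) \<in> Eq" using nact_Eq[OF la(1,2) nf_nred[OF la(3)]] l by (simp add: nf_def)
  ultimately show ?case by (rule Eq_trans)
qed (simp add: nf_def Eq_refl)

lemma nred_alt:
  assumes "u \<in> I" "v \<in> I" "u \<noteq> v" "a \<in> carrier (\<G> u)" "b \<in> carrier (\<G> v)" "a \<noteq> \<one>\<^bsub>\<G> u\<^esub>" "b \<noteq> \<one>\<^bsub>\<G> v\<^esub>"
  shows "nred (alt_word n (u, a) (v, b))"
  using assms
proof (induction n arbitrary: u v a b)
  case (Suc n)
  then have "nred (alt_word n (v, b) (u, a))" by simp
  then show ?case using Suc.prems by (cases n) auto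
qed simp

text \<open>Both alternating words are reduced, hence their own normal forms, and they begin with
  different letters.\<close>

lemma alt_not_Eq:
  assumes "u \<in> I" "v \<in> I" "u \<noteq> v" "a \<in> carrier (\<G> u)" "b \<in> carrier (\<G> v)" "a \<noteq> \<one>\<^bsub>\<G> u\<^esub>" "b \<noteq> \<one>\<^bsub>\<G> v\<^esub>" "0 < n"
  shows "cl (alt_word n (u, a) (v, b)) \<noteq> cl (alt_word n (v, b) (u, a))"
proof
  assume "cl (alt_word n (u, a) (v, b)) = cl (alt_word n (v, b) (u, a))"
  then have "nf (alt_word n (u, a) (v, b)) = nf (alt_word n (v, b) (u, a))" using nf_Eq cl_eq by blast
  then have "alt_word n (u, a) (v, b) = alt_word n (v, b) (u, a)"
    using nf_nred_id[OF nred_alt[OF assms(1-7)]] nf_nred_id[OF nred_alt[OF assms(2,1) assms(3)[symmetric] assms(5,4,7,6)]] by simp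
  then show False using assms(3,8) by (cases n) auto
qed

end

subsection \<open>Free products of subgroups\<close>

locale subgroup_family = H: group H for H :: "'h monoid" (structure) +
  fixes \<B> :: "'h set set"
  assumes sub: "\<And>A. A \<in> \<B> \<Longrightarrow> subgroup A H"
begin

sublocale group_family \<B> "sub_group H"
  using H.subgroup_imp_group[OF sub] by (rule group_family.intro)

abbreviation ev where "ev w \<equiv> H.mprod (map snd w)"

lemma W_carrier: "w \<in> W \<Longrightarrow> set (map snd w) \<subseteq> carrier H"
  using subgroup.subset[OF sub] by (fastforce simp: fp_words_def)

lemma ev_Eq: "(v, w) \<in> Eq \<Longrightarrow> ev v = ev w"
proof -
  have st: "ev v = ev w" if "(v, w) \<in> fp_step \<B> (sub_group H)" for v w
    using that unfolding fp_step_def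
  proof (elim UnE, goal_cases)
    case 1
    then obtain p q u where 1: "v = p @ [(u, \<one>)] @ q" "w = p @ q" "p \<in> W" "q \<in> W" by auto
    then show ?case using W_carrier by (simp add: H.mprod_append)
  next
    case 2
    then obtain p q u a b where 2: "v = p @ [(u, a), (u, b)] @ q" "w = p @ [(u, a \<otimes> b)] @ q" "p \<in> W" "q \<in> W"
      "u \<in> \<B>" "a \<in> u" "b \<in> u" by auto
    then have "a \<in> carrier H" "b \<in> carrier H" using subgroup.subset[OF sub] by blast+
    then show ?case using 2 W_carrier by (simp add: H.mprod_append H.m_assoc)
  qed
  show "(v, w) \<in> Eq \<Longrightarrow> ev v = ev w"
    unfolding fp_eq_def by (induction rule: rtrancl_induct) (auto dest: st)
qed

lemma canonical_cl: "fp_canonical H (cl w) = ev w"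
proof -
  have "foldr (\<otimes>) (map snd v) \<one> = ev w" if "v \<in> cl w" for v
    using ev_Eq[of w v] that by (simp add: cl_mem H.mprod_def)
  then have "(\<lambda>w. foldr (\<otimes>) (map snd w) \<one>) ` cl w = (\<lambda>_. ev w) ` cl w"
    by (rule image_cong[OF refl])
  also have "\<dots> = {ev w}" using cl_mem[of w w] Eq_refl[of w] by auto
  finally have "(\<lambda>w. foldr (\<otimes>) (map snd w) \<one>) ` cl w = {ev w}" .
  then show ?thesis by (simp add: fp_canonical_def)
qed

lemma canonical_hom: "fp_canonical H \<in> hom F H"
  by (rule homI) (use W_carrier in \<open>auto simp: F_carrier F_mult canonical_cl H.mprod_append\<close>)

lemma canonical_image: "fp_canonical H ` carrier F = generate H (\<Union>\<B>)"
proof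
  have BH: "\<Union>\<B> \<subseteq> carrier H" using subgroup.subset[OF sub] by blast
  have "ev w \<in> generate H (\<Union>\<B>)" if "w \<in> W" for w
    using that
  proof (induction w)
    case Nil
    then show ?case using generate.one[of H] by simp
  next
    case (Cons l w)
    then have "snd l \<in> \<Union>\<B>" "w \<in> W" by (cases l; auto)+
    have "snd l \<otimes> ev w \<in> generate H (\<Union>\<B>)"
      by (rule generate.eng[OF generate.incl[OF \<open>snd l \<in> \<Union>\<B>\<close>] Cons.IH[OF \<open>w \<in> W\<close>]])
    then show ?case by simp
  qed
  then show "fp_canonical H ` carrier F \<subseteq> generate H (\<Union>\<B>)" by (auto simp: F_carrier canonical_cl)
  have gh: "group_hom F H (fp_canonical H)"
    using F_group canonical_hom H.group_axioms by (simp add: group_hom_def group_hom_axioms_def)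
  have "subgroup (fp_canonical H ` carrier F) H" using group_hom.img_is_subgroup[OF gh] .
  moreover have "\<Union>\<B> \<subseteq> fp_canonical H ` carrier F"
  proof
    fix a assume "a \<in> \<Union>\<B>"
    then obtain A where A: "A \<in> \<B>" "a \<in> A" by blast
    then have "[(A, a)] \<in> W" "ev [(A, a)] = a" using BH by auto
    then have "a = fp_canonical H (cl [(A, a)])" "cl [(A, a)] \<in> carrier F"
      by (simp_all add: canonical_cl F_carrier)
    then show "a \<in> fp_canonical H ` carrier F" by (rule image_eqI)
  qed
  ultimately show "generate H (\<Union>\<B>) \<subseteq> fp_canonical H ` carrier F"
    using H.generate_subgroup_incl by blast
qed

text \<open>Every class has a reduced representative, so the kernel is controlled by the products of
  nonempty reduced words.\<close>

lemma canonical_iso: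
  assumes "\<And>w. nred w \<Longrightarrow> w \<noteq> [] \<Longrightarrow> ev w \<noteq> \<one>"
  shows "fp_canonical H \<in> iso F (sub_group H (generate H (\<Union>\<B>)))"
proof -
  have BH: "\<Union>\<B> \<subseteq> carrier H" using subgroup.subset[OF sub] by blast
  have gh: "group_hom F H (fp_canonical H)"
    using F_group canonical_hom H.group_axioms by (simp add: group_hom_def group_hom_axioms_def)
  have "x = \<one>\<^bsub>F\<^esub>" if x: "x \<in> carrier F" "fp_canonical H x = \<one>" for x
  proof -
    obtain w where w: "w \<in> W" "x = cl w" using x(1) by (auto simp: F_carrier)
    then have e: "x = cl (nf w)" using nf_rep cl_eq by blast
    then have "ev (nf w) = \<one>" using x(2) canonical_cl by simp
    then have "nf w = []" using assms nf_nred[OF w(1)] by blast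
    then show ?thesis using e F_one by simp
  qed
  then have "inj_on (fp_canonical H) (carrier F)" using group_hom.inj_iff_trivial_ker[OF gh]
    by (auto simp: kernel_def F_carrier F_one canonical_cl)
  moreover have "fp_canonical H \<in> hom F (sub_group H (generate H (\<Union>\<B>)))"
    using canonical_hom canonical_image by (auto simp: hom_def)
  ultimately show ?thesis using canonical_image by (simp add: iso_def bij_betw_def)
qed

text \<open>A braid relation in \<open>H\<close> gives two distinct elements of the free product
  with the same image.\<close>

lemma canonical_not_iso:
  assumes "A \<in> \<B>" "B \<in> \<B>" "A \<noteq> B" "a \<in> A" "b \<in> B" "a \<noteq> \<one>" "b \<noteq> \<one>" "0 < n"
    "H.mprod (alt_word n a b) = H.mprod (alt_word n b a)"
  shows "fp_canonical H \<notin> iso F K"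
proof
  assume "fp_canonical H \<in> iso F K"
  then have inj: "inj_on (fp_canonical H) (carrier F)" by (simp add: iso_def bij_betw_def)
  have W: "alt_word n (A, a) (B, b) \<in> W" "alt_word n (B, b) (A, a) \<in> W"
    using set_alt_word[of n "(A, a)" "(B, b)"] set_alt_word[of n "(B, b)" "(A, a)"] assms
    by (auto simp: fp_words_def)
  have "fp_canonical H (cl (alt_word n (A, a) (B, b))) = fp_canonical H (cl (alt_word n (B, b) (A, a)))"
    using assms(9) by (simp add: canonical_cl map_alt_word)
  then have "cl (alt_word n (A, a) (B, b)) = cl (alt_word n (B, b) (A, a))"
    using inj W by (auto simp: F_carrier inj_on_def)
  then show False using alt_not_Eq[of A B a b n] assms by simp
qed

end

section \<open>Quotients by normal closures\<close>

context group begin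

lemma normal_closure_normal: "N \<subseteq> carrier G \<Longrightarrow> normal_closure G N \<lhd> G"
proof -
  assume N: "N \<subseteq> carrier G"
  \<comment> \<open>The whole group belongs to the family, so the intersection is not over an empty
    family.\<close>
  have ne: "carrier G \<in> {M. M \<lhd> G \<and> N \<subseteq> M}" using N normal_inv_iff subgroup_self by auto
  have "subgroup (\<Inter>{M. M \<lhd> G \<and> N \<subseteq> M}) G"
    by (rule subgroups_Inter) (use ne normal_imp_subgroup in auto)
  then show ?thesis unfolding normal_inv_iff normal_closure_def by blast
qed

lemma normal_closure_incl: "N \<subseteq> normal_closure G N"
  by (auto simp: normal_closure_def)

lemma normal_closure_least: "M \<lhd> G \<Longrightarrow> N \<subseteq> M \<Longrightarrow> normal_closure G N \<subseteq> M"
  by (auto simp: normal_closure_def)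

end

lemma (in group_hom) the_elem_coset:
  assumes "K \<lhd> G" "K \<subseteq> kernel G H h" "x \<in> carrier G"
  shows "the_elem (h ` (K #> x)) = h x"
proof -
  have s: "subgroup K G" using assms(1) normal_imp_subgroup by blast
  have "h y = h x" if "y \<in> K #> x" for y
    using that assms(2,3) by (auto simp: r_coset_def kernel_def)
  then have "h ` (K #> x) = (\<lambda>_. h x) ` (K #> x)" by (rule image_cong[OF refl])
  also have "\<dots> = {h x}" using G.rcos_self[OF assms(3) s] by auto
  finally show ?thesis by simp
qed

lemma (in group_hom) the_elem_coset_hom:
  assumes "K \<lhd> G" "K \<subseteq> kernel G H h"
  shows "(\<lambda>C. the_elem (h ` C)) \<in> hom (G Mod K) H"
proof (rule homI)
  fix C D assume "C \<in> carrier (G Mod K)" "D \<in> carrier (G Mod K)"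
  then obtain x y where xy: "x \<in> carrier G" "y \<in> carrier G" "C = K #> x" "D = K #> y"
    by (auto simp: carrier_FactGroup)
  have "C \<otimes>\<^bsub>G Mod K\<^esub> D = K #> (x \<otimes> y)" using normal.rcos_sum[OF assms(1)] xy by simp
  then show "the_elem (h ` (C \<otimes>\<^bsub>G Mod K\<^esub> D)) = the_elem (h ` C) \<otimes>\<^bsub>H\<^esub> the_elem (h ` D)"
    using the_elem_coset[OF assms] xy by simp
qed (auto simp: carrier_FactGroup the_elem_coset[OF assms])

section \<open>The rotation group as a periagroup\<close>

context rot_chamber begin

definition HH where "HH = G\<lparr>carrier := Rot\<rparr>"
definition BB where "BB = R ` TT"
definition Gam where "Gam = basis_graph HH BB"

section \<open>Braid relations between rotation groups\<close>

definition braid where "braid m A B \<longleftrightarrow> (\<forall>a\<in>A - {\<one>}. \<forall>b\<in>B - {\<one>}. mprod (alt_word m a b) = mprod (alt_word m b a))"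
text \<open>The least length of a braid relation that holds in \<open>G\<close>; minimality makes
  the longer relations demanded by the covering consequences of this one. Quantifying over both
  orders of the two groups makes it a function of the unordered edge.\<close>

definition lab where "lab e = (LEAST m. 2 \<le> m \<and> (\<forall>A\<in>e. \<forall>B\<in>e. A \<noteq> B \<longrightarrow> braid m A B))"

lemma braid_sym: "braid m A B \<longleftrightarrow> braid m B A"
  unfolding braid_def by metis

lemma braid_two:
  assumes "\<And>a b. a \<in> R J1 \<Longrightarrow> b \<in> R J2 \<Longrightarrow> a \<otimes> b = b \<otimes> a" shows "braid 2 (R J1) (R J2)"
proof -
  have "mprod (alt_word 2 a b) = mprod (alt_word 2 b a)" if "a \<in> R J1" "b \<in> R J2" for a b
    using assms[OF that] R_carrier[OF that(1)] R_carrier[OF that(2)] by (simp add: numeral_2_eq_2)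
  then show ?thesis unfolding braid_def by blast
qed

lemma HH_simps [simp]: "carrier HH = Rot" "mult HH = mult G" "\<one>\<^bsub>HH\<^esub> = \<one>"
  by (simp_all add: HH_def)

lemma HH_group: "group HH"
  unfolding HH_def by (rule subgroup_imp_group[OF Rot_subgroup(1)])

lemma HH_mprod: "monoid.mprod HH w = mprod w"
  using monoid.mprod_def[OF group.is_monoid[OF HH_group]] by (simp add: mprod_def)

lemma R_Rot: assumes "J \<in> \<J>" shows "R J \<subseteq> Rot"
proof
  fix r assume "r \<in> R J"
  then have "r \<in> (\<Union>J\<in>\<J>. R J)" using assms by blast
  then show "r \<in> Rot" unfolding Rot_def by (rule generate.incl)
qed

lemma BB_subgroup: "A \<in> BB \<Longrightarrow> subgroup A HH"
  unfolding BB_def HH_def using subgroup_incl[OF R_subgroup Rot_subgroup(1) R_Rot[OF TT_\<J>]] by blast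

lemma BB_family: "subgroup_family HH BB"
  by (intro subgroup_family.intro subgroup_family_axioms.intro HH_group BB_subgroup)

lemma pair_family: "J1 \<in> TT \<Longrightarrow> J2 \<in> TT \<Longrightarrow> subgroup_family HH {R J1, R J2}"
  by (intro subgroup_family.intro subgroup_family_axioms.intro HH_group) (auto intro!: BB_subgroup simp: BB_def)

lemma Gam_verts: "verts Gam = BB"
  by (simp add: Gam_def basis_graph_def)

lemma Gam_edge_iff:
  assumes "J1 \<in> TT" "J2 \<in> TT" "J1 \<noteq> J2"
  shows "{R J1, R J2} \<in> edges Gam \<longleftrightarrow>
    fp_canonical HH \<notin> iso (free_product {R J1, R J2} (sub_group HH)) (sub_group HH (generate HH (R J1 \<union> R J2)))"
    (is "_ \<longleftrightarrow> ?not (R J1) (R J2)")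
proof -
  have ne: "R J1 \<noteq> R J2" using R_neq TT_\<J> assms by blast
  have "?not A B \<longleftrightarrow> ?not B A" for A B by (simp add: insert_commute Un_commute)
  then show ?thesis
    using assms ne unfolding Gam_def basis_graph_def BB_def by (auto simp: doubleton_eq_iff)
qed

lemma Gam_edgeE:
  assumes "{A, B} \<in> edges Gam"
  obtains J1 J2 where "J1 \<in> TT" "J2 \<in> TT" "J1 \<noteq> J2" "A = R J1" "B = R J2"
proof -
  have "A \<in> BB" "B \<in> BB" "A \<noteq> B" using assms by (auto simp: Gam_def basis_graph_def doubleton_eq_iff)
  then show thesis using that unfolding BB_def by blast
qed

text \<open>The vertices beyond \<open>J1\<close> and those beyond \<open>J2\<close> form disjoint
  sets, and a non-trivial rotation around either hyperplane sends everything on the side of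
  \<open>bp\<close> beyond it. So a nonempty reduced word moves \<open>bp\<close>.\<close>

lemma pingpong:
  assumes J: "J1 \<in> TT" "J2 \<in> TT" "J1 \<noteq> J2"
    and no: "\<And>z. z \<in> V \<Longrightarrow> hsame J1 bp z \<or> hsame J2 bp z"
  shows "{R J1, R J2} \<notin> edges Gam"
proof -
  interpret D: subgroup_family HH "{R J1, R J2}" by (rule pair_family[OF J(1,2)])
  note T = TT_\<J>[OF J(1)] TT_\<J>[OF J(2)]
  have ne: "R J1 \<noteq> R J2" using R_neq T J by blast
  \<comment> \<open>The first letter of a reduced word tells which hyperplane separates
    \<open>bp\<close> from its image.\<close>
  have key: "D.nred w \<Longrightarrow> w \<noteq> [] \<Longrightarrow> D.ev w \<in> carrier G \<and>
    (\<forall>K\<in>{J1, J2}. fst (hd w) = R K \<longrightarrow> \<not> hsame K bp (\<phi> (D.ev w) bp))" for w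
  proof (induction w)
    case (Cons l w)
    obtain A a where l: "l = (A, a)" by fastforce
    have A: "A \<in> {R J1, R J2}" "a \<in> A" "a \<noteq> \<one>" "D.nred w" "w \<noteq> [] \<longrightarrow> fst (hd w) \<noteq> A"
      using Cons.prems l by auto
    obtain K L where K: "{K, L} = {J1, J2}" "A = R K" using A(1) by blast
    have KT: "K \<in> TT" "L \<in> TT" "K \<noteq> L" "K \<in> \<J>" using K J T by (auto simp: doubleton_eq_iff)
    have aK: "a \<in> R K" using A K by simp
    note aG = R_carrier[OF aK]
    define x where "x = \<phi> (D.ev w) bp"
    have wG: "D.ev w \<in> carrier G" using Cons.IH A(4) by (cases "w = []") auto
    have xV: "x \<in> V" using wG bp by (simp add: x_def)
    have "hsame K bp x"
    proof (cases "w = []")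
      case True
      then show ?thesis using hsame_refl[OF \<J>_hyp[OF KT(4)] bp] bp by (simp add: x_def)
    next
      case False
      have "fst (hd w) \<in> {R J1, R J2}" using A(4) False by (cases w) auto
      then have "fst (hd w) = R L" using A(5) False K by (auto simp: doubleton_eq_iff)
      then have "\<not> hsame L bp x" using Cons.IH A(4) False K(1) by (auto simp: x_def doubleton_eq_iff)
      then show ?thesis using no[OF xV] K(1) by (auto simp: doubleton_eq_iff)
    qed
    then have "\<not> hsame K bp (\<phi> a x)"
      using hsame_trans[OF \<J>_hyp[OF KT(4)] xV bp act_V[OF aG xV]] R_move(1)[OF aK KT(4) A(3) xV]
        hsame_sym[of K bp x] by blast
    moreover have e: "D.ev (l # w) = a \<otimes> D.ev w" using l by simp
    then have "\<phi> (D.ev (l # w)) bp = \<phi> a x" using act_mult[OF aG wG bp] by (simp add: x_def)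
    moreover have "K' = K" if "K' \<in> {J1, J2}" "A = R K'" for K' using that K ne by (auto simp: doubleton_eq_iff)
    ultimately show ?case using e aG wG l by auto
  qed simp
  have "D.ev w \<noteq> \<one>\<^bsub>HH\<^esub>" if w: "D.nred w" "w \<noteq> []" for w
  proof
    assume 1: "D.ev w = \<one>\<^bsub>HH\<^esub>"
    have "fst (hd w) \<in> {R J1, R J2}" using w by (cases w) auto
    then obtain K where "K \<in> {J1, J2}" "fst (hd w) = R K" by blast
    then have "\<not> hsame K bp (\<phi> (D.ev w) bp)" "K \<in> \<J>" using key[OF w] T by auto
    then show False using 1 bp hsame_refl[OF \<J>_hyp bp] by simp
  qed
  then show ?thesis using D.canonical_iso Gam_edge_iff[OF J] by simp
qed

text \<open>If ping-pong fails, some vertex lies beyond both hyperplanes, and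
  \<open>pair_cycle\<close> gives a convex even cycle crossed by both. A square makes the groups
  commute; a cycle of length \<open>2 * k\<close> with \<open>k \<ge> 3\<close> gives order two and
  a braid relation of length \<open>k\<close>.\<close>

lemma edge_types:
  assumes J: "J1 \<in> TT" "J2 \<in> TT" "J1 \<noteq> J2" and e: "{R J1, R J2} \<in> edges Gam"
  shows "braid 2 (R J1) (R J2) \<or>
   (card (R J1) = 2 \<and> card (R J2) = 2 \<and> (\<exists>m\<ge>2. braid m (R J1) (R J2)))"
proof -
  note T = TT_\<J>[OF J(1)] TT_\<J>[OF J(2)]
  obtain z where z: "z \<in> V" "\<not> hsame J1 bp z" "\<not> hsame J2 bp z" using pingpong[OF J] e by blast
  obtain k c i j where c: "ecyc k c" "{c i, c (i + 1)} \<in> J1" "{c j, c (j + 1)} \<in> J2"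
    using pair_cycle[OF J z] .
  show ?thesis
  proof (cases "k = 2")
    case True
    have "braid 2 (R J1) (R J2)"
      by (rule braid_two) (rule square_all(3)[OF T J(3) c(1)[unfolded True] c(2,3)])
    then show ?thesis ..
  next
    case False
    then have k: "3 \<le> k" using ecyc_k[OF c(1)] by simp
    obtain a where a: "a \<in> R J1" "a \<noteq> \<one>" using R_nontrivial[OF T(1)] by blast
    obtain b where b: "b \<in> R J2" "b \<noteq> \<one>" using R_nontrivial[OF T(2)] by blast
    note Ra = long_order_two[OF T(1) c(1) k c(2) a] and Rb = long_order_two[OF T(2) c(1) k c(3) b]
    note G = R_carrier[OF a(1)] R_carrier[OF b(1)]
    have "mprod (alt_word (nat k) a b) = mprod (alt_word (nat k) b a)"
      using long_rotation(3)[OF T c(1) k c(2,3) a b] involution_braid[OF G Ra(2) Rb(2)] by simp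
    then have "braid (nat k) (R J1) (R J2)" unfolding braid_def Ra(1) Rb(1) by auto
    moreover have "card (R J1) = 2" "card (R J2) = 2" using Ra(1) Rb(1) a b by auto
    moreover have "2 \<le> nat k" using k by simp
    ultimately show ?thesis by blast
  qed
qed

lemma lab_eq:
  assumes "A \<noteq> B" shows "lab {A, B} = (LEAST m. 2 \<le> m \<and> braid m A B)"
proof -
  have "(\<forall>C\<in>{A, B}. \<forall>D\<in>{A, B}. C \<noteq> D \<longrightarrow> braid m C D) \<longleftrightarrow> braid m A B" for m
    using assms braid_sym by auto
  then show ?thesis by (simp add: lab_def)
qed

lemma lab_props:
  assumes J: "J1 \<in> TT" "J2 \<in> TT" "J1 \<noteq> J2" and m: "2 \<le> m" "braid m (R J1) (R J2)"
  shows "2 \<le> lab {R J1, R J2}" "braid (lab {R J1, R J2}) (R J1) (R J2)" "lab {R J1, R J2} \<le> m"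
proof -
  have ne: "R J1 \<noteq> R J2" using R_neq TT_\<J> J by blast
  have "2 \<le> lab {R J1, R J2} \<and> braid (lab {R J1, R J2}) (R J1) (R J2)"
    unfolding lab_eq[OF ne] by (rule LeastI[of _ m]) (use m in simp)
  then show "2 \<le> lab {R J1, R J2}" "braid (lab {R J1, R J2}) (R J1) (R J2)" by auto
  show "lab {R J1, R J2} \<le> m" unfolding lab_eq[OF ne] by (rule Least_le) (use m in simp)
qed

text \<open>Converse of \<open>edge_types\<close>: wherever the covering demands a relation, the
  basis graph has an edge to impose it.\<close>

lemma braid_edge:
  assumes J: "J1 \<in> TT" "J2 \<in> TT" "J1 \<noteq> J2" and m: "2 \<le> m" "braid m (R J1) (R J2)"
  shows "{R J1, R J2} \<in> edges Gam"
proof -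
  interpret D: subgroup_family HH "{R J1, R J2}" by (rule pair_family[OF J(1,2)])
  have ne: "R J1 \<noteq> R J2" using R_neq TT_\<J> J by blast
  obtain a where a: "a \<in> R J1" "a \<noteq> \<one>" using R_nontrivial TT_\<J> J(1) by blast
  obtain b where b: "b \<in> R J2" "b \<noteq> \<one>" using R_nontrivial TT_\<J> J(2) by blast
  have "mprod (alt_word m a b) = mprod (alt_word m b a)" using m(2) a b unfolding braid_def by blast
  then show ?thesis
    using D.canonical_not_iso[of "R J1" "R J2" a b m] ne a b m(1) Gam_edge_iff[OF J] by (simp add: HH_mprod)
qed

lemma Gam_data: "periagroup_data Gam lab (sub_group HH)"
  unfolding periagroup_data_def
proof (intro conjI ballI allI impI)
  show "simple_graph Gam" by (auto simp: simple_graph_def Gam_def basis_graph_def)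
  show "group (sub_group HH u)" if "u \<in> verts Gam" for u
    using group.subgroup_imp_group[OF HH_group BB_subgroup] that Gam_verts by blast
  have ty: "2 \<le> lab {A, B}" "2 < lab {A, B} \<longrightarrow> card A = 2 \<and> card B = 2" if e: "{A, B} \<in> edges Gam" for A B
  proof -
    obtain J1 J2 where J: "J1 \<in> TT" "J2 \<in> TT" "J1 \<noteq> J2" "A = R J1" "B = R J2" using Gam_edgeE[OF e] .
    from edge_types[OF J(1-3)] e J have "braid 2 A B \<or> (card A = 2 \<and> card B = 2 \<and> (\<exists>m\<ge>2. braid m A B))" by simp
    then show "2 \<le> lab {A, B}" "2 < lab {A, B} \<longrightarrow> card A = 2 \<and> card B = 2"
      using lab_props[OF J(1-3)] unfolding J by (metis le_refl not_less)+
  qed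
  show "2 \<le> lab e" if e: "e \<in> edges Gam" for e
  proof -
    obtain A B where "e = {A, B}" using e by (auto simp: Gam_def basis_graph_def)
    then show ?thesis using ty(1) e by blast
  qed
  show "order (sub_group HH u) = 2" "order (sub_group HH v) = 2" if "{u, v} \<in> edges Gam \<and> 2 < lab {u, v}" for u v
    using ty(2)[of u v] that by (simp_all add: order_def)
qed

section \<open>The periagroup and its homomorphism to the rotation group\<close>

abbreviation FF where "FF \<equiv> free_product BB (sub_group HH)"
abbreviation KK where "KK \<equiv> normal_closure FF (periagroup_relators Gam lab (sub_group HH))"
abbreviation cl where "cl \<equiv> fp_class BB (sub_group HH)"
definition PP where "PP = periagroup Gam lab (sub_group HH)"
definition psi where "psi = (\<lambda>C. the_elem (fp_canonical HH ` C))"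
definition gen where "gen = periagroup_gen Gam lab (sub_group HH)"

lemma PP_eq: "PP = FF Mod KK"
  by (simp add: PP_def periagroup_def Let_def Gam_verts)

lemma gen_eq: "gen A a = KK #>\<^bsub>FF\<^esub> cl [(A, a)]"
  by (simp add: gen_def periagroup_gen_def Let_def Gam_verts)

interpretation B: subgroup_family HH BB by (rule BB_family)
interpretation F: group FF by (rule B.F_group)
interpretation can: group_hom FF HH "fp_canonical HH"
  using B.F_group B.canonical_hom HH_group by (simp add: group_hom_def group_hom_axioms_def)

lemma alt_W: "A \<in> BB \<Longrightarrow> B \<in> BB \<Longrightarrow> a \<in> A \<Longrightarrow> b \<in> B \<Longrightarrow> alt_word n (A, a) (B, b) \<in> B.W"
  using set_alt_word[of n "(A, a)" "(B, b)"] by (auto simp: fp_words_def)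

lemma relatorE:
  assumes "x \<in> periagroup_relators Gam lab (sub_group HH)"
  obtains J1 J2 a b where "J1 \<in> TT" "J2 \<in> TT" "J1 \<noteq> J2" "{R J1, R J2} \<in> edges Gam"
    "a \<in> R J1" "b \<in> R J2" "a \<noteq> \<one>" "b \<noteq> \<one>"
    "x = cl (alt_word (lab {R J1, R J2}) (R J1, a) (R J2, b)) \<otimes>\<^bsub>FF\<^esub>
       inv\<^bsub>FF\<^esub> (cl (alt_word (lab {R J1, R J2}) (R J2, b) (R J1, a)))"
proof -
  obtain A B a b where x: "{A, B} \<in> edges Gam" "a \<in> A" "b \<in> B" "a \<noteq> \<one>" "b \<noteq> \<one>"
    "x = cl (alt_word (lab {A, B}) (A, a) (B, b)) \<otimes>\<^bsub>FF\<^esub> inv\<^bsub>FF\<^esub> (cl (alt_word (lab {A, B}) (B, b) (A, a)))"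
    using assms unfolding periagroup_relators_def Let_def Gam_verts by auto
  then show thesis using Gam_edgeE[OF x(1)] that by metis
qed

lemma R_BB: "J \<in> TT \<Longrightarrow> R J \<in> BB" by (simp add: BB_def)

lemma relators_F: "periagroup_relators Gam lab (sub_group HH) \<subseteq> carrier FF"
proof
  fix x assume "x \<in> periagroup_relators Gam lab (sub_group HH)"
  then show "x \<in> carrier FF"
  proof (cases rule: relatorE)
    case (1 J1 J2 a b)
    have "cl (alt_word n (R J1, a) (R J2, b)) \<in> carrier FF" "cl (alt_word n (R J2, b) (R J1, a)) \<in> carrier FF" for n
      using alt_W R_BB 1 by (auto simp: B.F_carrier)
    then show ?thesis unfolding 1(9) by (intro F.m_closed F.inv_closed)
  qed
qed

lemma KK_normal: "KK \<lhd> FF" using F.normal_closure_normal[OF relators_F] .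

lemma edge_braid:
  assumes J: "J1 \<in> TT" "J2 \<in> TT" "J1 \<noteq> J2" and e: "{R J1, R J2} \<in> edges Gam"
  shows "braid (lab {R J1, R J2}) (R J1) (R J2)"
  using edge_types[OF J e] lab_props(2)[OF J] by blast

lemma KK_kernel: "KK \<subseteq> kernel FF HH (fp_canonical HH)"
proof (rule F.normal_closure_least[OF can.normal_kernel], rule subsetI)
  fix x assume "x \<in> periagroup_relators Gam lab (sub_group HH)"
  then show "x \<in> kernel FF HH (fp_canonical HH)"
  proof (cases rule: relatorE)
    case (1 J1 J2 a b)
    define n where "n = lab {R J1, R J2}"
    have W: "alt_word n (R J1, a) (R J2, b) \<in> B.W" "alt_word n (R J2, b) (R J1, a) \<in> B.W"
      using alt_W R_BB 1 by auto
    have eq: "mprod (alt_word n a b) = mprod (alt_word n b a)"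
      using edge_braid[OF 1(1-4)] 1(5-8) unfolding braid_def n_def by blast
    have "fp_canonical HH (cl (alt_word n (R J1, a) (R J2, b))) = fp_canonical HH (cl (alt_word n (R J2, b) (R J1, a)))"
      using eq by (simp add: B.canonical_cl HH_mprod map_alt_word)
    moreover have "cl (alt_word n (R J1, a) (R J2, b)) \<in> carrier FF" "cl (alt_word n (R J2, b) (R J1, a)) \<in> carrier FF"
      using W by (simp_all add: B.F_carrier)
    ultimately have "fp_canonical HH x = \<one>\<^bsub>HH\<^esub>" "x \<in> carrier FF"
      unfolding 1(9) n_def[symmetric] by (simp_all del: HH_simps)
    then show ?thesis by (simp add: kernel_def)
  qed
qed

lemma PP_group: "group PP"
  unfolding PP_eq by (rule normal.factorgroup_is_group[OF KK_normal])

interpretation P: group PP by (rule PP_group)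

lemma proj_hom: "(\<lambda>x. KK #>\<^bsub>FF\<^esub> x) \<in> hom FF PP"
  unfolding PP_eq by (rule normal.r_coset_hom_Mod[OF KK_normal])

interpretation pr: group_hom FF PP "\<lambda>x. KK #>\<^bsub>FF\<^esub> x"
  using proj_hom PP_group B.F_group by (simp add: group_hom_def group_hom_axioms_def)

lemma psi_hom: "psi \<in> hom PP HH"
  unfolding PP_eq psi_def by (rule can.the_elem_coset_hom[OF KK_normal KK_kernel])

lemma psi_coset: "x \<in> carrier FF \<Longrightarrow> psi (KK #>\<^bsub>FF\<^esub> x) = fp_canonical HH x"
  unfolding psi_def by (rule can.the_elem_coset[OF KK_normal KK_kernel])

lemma letter_F: "J \<in> TT \<Longrightarrow> r \<in> R J \<Longrightarrow> cl [(R J, r)] \<in> carrier FF"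
  by (simp add: B.F_carrier R_BB)

lemma gen_closed [simp]: "J \<in> TT \<Longrightarrow> r \<in> R J \<Longrightarrow> gen (R J) r \<in> carrier PP"
  using pr.hom_closed[OF letter_F] by (simp add: gen_eq)

lemma gen_hom: assumes J: "J \<in> TT" shows "gen (R J) \<in> hom (G\<lparr>carrier := R J\<rparr>) PP"
proof (rule homI)
  fix r s assume "r \<in> carrier (G\<lparr>carrier := R J\<rparr>)" "s \<in> carrier (G\<lparr>carrier := R J\<rparr>)"
  then have rs: "r \<in> R J" "s \<in> R J" by auto
  have "cl [(R J, r \<otimes> s)] = cl [(R J, r)] \<otimes>\<^bsub>FF\<^esub> cl [(R J, s)]"
    using hom_mult[OF B.letter_hom[OF R_BB[OF J]], of r s] rs by simp
  then show "gen (R J) (r \<otimes>\<^bsub>G\<lparr>carrier := R J\<rparr>\<^esub> s) = gen (R J) r \<otimes>\<^bsub>PP\<^esub> gen (R J) s"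
    using pr.hom_mult[OF letter_F[OF J rs(1)] letter_F[OF J rs(2)]] by (simp add: gen_eq)
qed (use J in simp)

lemma psi_gen: "J \<in> TT \<Longrightarrow> r \<in> R J \<Longrightarrow> psi (gen (R J) r) = r"
proof -
  assume J: "J \<in> TT" and r: "r \<in> R J"
  have "psi (gen (R J) r) = fp_canonical HH (cl [(R J, r)])"
    unfolding gen_eq by (rule psi_coset[OF letter_F[OF J r]])
  then show ?thesis using R_carrier[OF r] by (simp add: B.canonical_cl HH_mprod)
qed

lemma PP_generate: "carrier PP = generate PP (\<Union>J\<in>TT. gen (R J) ` R J)"
proof -
  define L where "L = (\<Union>A\<in>BB. (\<lambda>a. cl [(A, a)]) ` carrier (sub_group HH A))"
  have LF: "L \<subseteq> carrier FF" by (auto simp: L_def B.F_carrier)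
  have "carrier PP = (\<lambda>x. KK #>\<^bsub>FF\<^esub> x) ` carrier FF" by (simp add: PP_eq carrier_FactGroup)
  also have "\<dots> = (\<lambda>x. KK #>\<^bsub>FF\<^esub> x) ` generate FF L" using B.F_generate by (simp add: L_def)
  also have "\<dots> = generate PP ((\<lambda>x. KK #>\<^bsub>FF\<^esub> x) ` L)" using pr.generate_img[OF LF] by simp
  also have "(\<lambda>x. KK #>\<^bsub>FF\<^esub> x) ` L = (\<Union>J\<in>TT. gen (R J) ` R J)"
    by (simp add: L_def BB_def gen_eq image_UN image_image)
  finally show ?thesis .
qed

lemma coset_prod:
  assumes "w \<in> B.W" shows "KK #>\<^bsub>FF\<^esub> cl w = P.mprod (map (\<lambda>(A, a). gen A a) w)"
  using assms
proof (induction w)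
  case Nil
  then show ?case using pr.hom_one by (simp add: B.F_one)
next
  case (Cons l w)
  obtain A a where l: "l = (A, a)" by fastforce
  then have w: "[(A, a)] \<in> B.W" "w \<in> B.W" using Cons.prems by auto
  then have "cl (l # w) = cl [(A, a)] \<otimes>\<^bsub>FF\<^esub> cl w" using B.F_mult l by simp
  moreover have "cl [(A, a)] \<in> carrier FF" "cl w \<in> carrier FF" using w unfolding B.F_carrier by blast+
  ultimately show ?case using Cons.IH[OF w(2)] l by (simp add: gen_eq pr.hom_mult)
qed

lemma edge_relation:
  assumes J: "J1 \<in> TT" "J2 \<in> TT" "J1 \<noteq> J2" and e: "{R J1, R J2} \<in> edges Gam"
    and ab: "a \<in> R J1" "b \<in> R J2" "a \<noteq> \<one>" "b \<noteq> \<one>" and n: "n = lab {R J1, R J2}"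
  shows "P.mprod (alt_word n (gen (R J1) a) (gen (R J2) b)) = P.mprod (alt_word n (gen (R J2) b) (gen (R J1) a))"
proof -
  define v w where "v = alt_word n (R J1, a) (R J2, b)" and "w = alt_word n (R J2, b) (R J1, a)"
  have W: "v \<in> B.W" "w \<in> B.W" using alt_W R_BB J ab by (auto simp: v_def w_def)
  then have F: "cl v \<in> carrier FF" "cl w \<in> carrier FF" by (simp_all add: B.F_carrier)
  have "cl v \<otimes>\<^bsub>FF\<^esub> inv\<^bsub>FF\<^esub> (cl w) \<in> periagroup_relators Gam lab (sub_group HH)"
    unfolding periagroup_relators_def Let_def Gam_verts v_def w_def n using e ab by auto
  then have "cl v \<otimes>\<^bsub>FF\<^esub> inv\<^bsub>FF\<^esub> (cl w) \<in> KK" using F.normal_closure_incl by blast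
  then have "KK #>\<^bsub>FF\<^esub> (cl v \<otimes>\<^bsub>FF\<^esub> inv\<^bsub>FF\<^esub> (cl w)) = KK"
    using F.coset_join2 normal_imp_subgroup[OF KK_normal] F by simp
  then have "(KK #>\<^bsub>FF\<^esub> cl v) \<otimes>\<^bsub>PP\<^esub> inv\<^bsub>PP\<^esub> (KK #>\<^bsub>FF\<^esub> cl w) = \<one>\<^bsub>PP\<^esub>"
    using F pr.hom_mult[of "cl v" "inv\<^bsub>FF\<^esub> (cl w)"] by (simp add: pr.hom_inv) (simp add: PP_eq)
  then have "inv\<^bsub>PP\<^esub> (inv\<^bsub>PP\<^esub> (KK #>\<^bsub>FF\<^esub> cl w)) = KK #>\<^bsub>FF\<^esub> cl v"
    by (rule P.inv_equality[OF _ P.inv_closed[OF pr.hom_closed[OF F(2)]] pr.hom_closed[OF F(1)]])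
  then have "KK #>\<^bsub>FF\<^esub> cl v = KK #>\<^bsub>FF\<^esub> cl w"
    unfolding P.inv_inv[OF pr.hom_closed[OF F(2)]] by (rule sym)
  then show ?thesis using coset_prod[OF W(1)] coset_prod[OF W(2)] by (simp add: v_def w_def map_alt_word)
qed

lemma gen_one: "J \<in> TT \<Longrightarrow> gen (R J) \<one> = \<one>\<^bsub>PP\<^esub>"
  using hom_mult[OF gen_hom, of J \<one> \<one>] gen_closed[of J \<one>] R_one[of J] by simp

lemma covering: "rot_covering X G \<phi> \<J> bp PP psi gen"
proof unfold_locales
  show "psi \<in> hom PP G" using psi_hom subgroup.subset[OF Rot_subgroup(1)] by (auto simp: hom_def)
  show "gen (R J) \<in> hom (G\<lparr>carrier := R J\<rparr>) PP" if "J \<in> TT" for J using gen_hom[OF that] .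
  show "psi (gen (R J) r) = r" if "J \<in> TT" "r \<in> R J" for J r using psi_gen[OF that] .
  show "carrier PP = generate PP (\<Union>J\<in>TT. gen (R J) ` R J)" by (rule PP_generate)
next
  fix J1 J2 a b
  assume J: "J1 \<in> TT" "J2 \<in> TT" "J1 \<noteq> J2" and cm: "\<And>a b. a \<in> R J1 \<Longrightarrow> b \<in> R J2 \<Longrightarrow> a \<otimes> b = b \<otimes> a"
    and ab: "a \<in> R J1" "b \<in> R J2"
  show "gen (R J1) a \<otimes>\<^bsub>PP\<^esub> gen (R J2) b = gen (R J2) b \<otimes>\<^bsub>PP\<^esub> gen (R J1) a"
  proof (cases "a = \<one> \<or> b = \<one>")
    case True
    then show ?thesis using gen_one J ab by auto
  next
    case False
    have br: "braid 2 (R J1) (R J2)" by (rule braid_two) (rule cm)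
    have "lab {R J1, R J2} = 2" using lab_props[OF J _ br] by simp
    then show ?thesis using edge_relation[OF J braid_edge[OF J _ br] ab, of 2] False J ab
      by (simp add: numeral_2_eq_2)
  qed
next
  fix J1 J2 a b and n :: nat
  assume J: "J1 \<in> TT" "J2 \<in> TT" "J1 \<noteq> J2" and R: "R J1 = {\<one>, a}" "R J2 = {\<one>, b}"
    and ab: "a \<noteq> \<one>" "b \<noteq> \<one>" "a \<otimes> a = \<one>" "b \<otimes> b = \<one>" and n: "(a \<otimes> b) [^] n = \<one>"
  have m: "a \<in> R J1" "b \<in> R J2" using R by auto
  note G = R_carrier[OF m(1)] R_carrier[OF m(2)]
  \<comment> \<open>Otherwise \<open>a = b\<close> would be a non-trivial rotation around two
    hyperplanes.\<close>
  have ab1: "a \<otimes> b \<noteq> \<one>"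
  proof
    assume "a \<otimes> b = \<one>"
    then have "a = b" using ab(4) G by (metis inv_equality inv_inv inv_closed)
    then show False using R_inter[OF TT_\<J>[OF J(1)] TT_\<J>[OF J(2)] J(3) m(1)] m(2) ab(1) by blast
  qed
  have br: "braid m (R J1) (R J2) \<longleftrightarrow> (a \<otimes> b) [^] m = \<one>" for m
    using involution_braid[OF G ab(3,4), of m] R ab by (auto simp: braid_def)
  define x y where "x = gen (R J1) a" and "y = gen (R J2) b"
  have xy: "x \<in> carrier PP" "y \<in> carrier PP" using J m by (simp_all add: x_def y_def)
  have x2: "x \<otimes>\<^bsub>PP\<^esub> x = \<one>\<^bsub>PP\<^esub>" "y \<otimes>\<^bsub>PP\<^esub> y = \<one>\<^bsub>PP\<^esub>"
    using hom_mult[OF gen_hom[OF J(1)], of a a] hom_mult[OF gen_hom[OF J(2)], of b b] m ab gen_one J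
    by (simp_all add: x_def y_def)
  have "(x \<otimes>\<^bsub>PP\<^esub> y) [^]\<^bsub>PP\<^esub> n = \<one>\<^bsub>PP\<^esub>"
  proof (cases "n = 0")
    case False
    then have n2: "2 \<le> n" using ab1 n G by (cases "n = 1") auto
    define l where "l = lab {R J1, R J2}"
    note lp = lab_props[OF J n2 br[THEN iffD2, OF n], folded l_def]
    have l1: "(a \<otimes> b) [^] l = \<one>" using lp(2) br by simp
    \<comment> \<open>The label \<open>l\<close> divides \<open>n\<close>: the remainder is an
      exponent below \<open>l\<close> that is also trivial in \<open>G\<close>. Minimality of the
      label concerns lengths of at least two, so remainder one has to be excluded by
      \<open>ab1\<close>.\<close>
    have "(a \<otimes> b) [^] (n mod l) = \<one>"
    proof -
      have "(a \<otimes> b) [^] n = ((a \<otimes> b) [^] l) [^] (n div l) \<otimes> (a \<otimes> b) [^] (n mod l)"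
        using G by (simp add: nat_pow_pow nat_pow_mult)
      then show ?thesis using n l1 G by simp
    qed
    moreover have "n mod l < l" using lp(1) by simp
    ultimately have "n mod l = 0"
    proof -
      assume r: "(a \<otimes> b) [^] (n mod l) = \<one>" "n mod l < l"
      have "n mod l \<noteq> 1"
      proof
        assume "n mod l = 1"
        then show False using r(1) ab1 G by simp
      qed
      moreover have "\<not> 2 \<le> n mod l"
        using lab_props(3)[OF J _ br[THEN iffD2, OF r(1)], folded l_def] r(2) by linarith
      ultimately show ?thesis by linarith
    qed
    then have nl: "n = l * (n div l)" by auto
    have "P.mprod (alt_word l x y) = P.mprod (alt_word l y x)"
      using edge_relation[OF J braid_edge[OF J n2 br[THEN iffD2, OF n]] m ab(1,2), of l] by (simp add: x_def y_def l_def)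
    then have "(x \<otimes>\<^bsub>PP\<^esub> y) [^]\<^bsub>PP\<^esub> l = \<one>\<^bsub>PP\<^esub>" using P.involution_braid[OF xy x2] by simp
    then have "((x \<otimes>\<^bsub>PP\<^esub> y) [^]\<^bsub>PP\<^esub> l) [^]\<^bsub>PP\<^esub> (n div l) = \<one>\<^bsub>PP\<^esub>" by simp
    then show ?thesis using P.nat_pow_pow[of "x \<otimes>\<^bsub>PP\<^esub> y" l "n div l"] xy nl by simp
  qed simp
  then show "(gen (R J1) a \<otimes>\<^bsub>PP\<^esub> gen (R J2) b) [^]\<^bsub>PP\<^esub> n = \<one>\<^bsub>PP\<^esub>" by (simp add: x_def y_def)
qed

interpretation cov: rot_covering X G \<phi> \<J> bp PP psi gen by (rule covering)

lemma psi_surj: "psi ` carrier PP = Rot"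
proof -
  have "carrier PP = (\<lambda>x. KK #>\<^bsub>FF\<^esub> x) ` carrier FF" by (simp add: PP_eq carrier_FactGroup)
  then have "psi ` carrier PP = fp_canonical HH ` carrier FF" using psi_coset by (force simp: image_image)
  also have "\<dots> = generate HH (\<Union>BB)" by (rule B.canonical_image)
  also have "\<dots> = generate G (\<Union>BB)"
  proof -
    have "\<Union>BB \<subseteq> Rot" using R_Rot[OF TT_\<J>] by (auto simp: BB_def)
    then show ?thesis unfolding HH_def by (rule generate_consistent[OF _ Rot_subgroup(1)])
  qed
  also have "\<dots> = Rot" using Rot_eq by (simp add: RotT_def BB_def)
  finally show ?thesis .
qed

text \<open>A kernel element fixes \<open>bp\<close>, which lies in \<open>Y\<close>, so
  \<open>chamber_free\<close> makes it trivial.\<close>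

lemma psi_iso: "psi \<in> iso PP HH"
proof -
  have gh: "group_hom PP HH psi" using psi_hom PP_group HH_group by (simp add: group_hom_def group_hom_axioms_def)
  have "x = \<one>\<^bsub>PP\<^esub>" if "x \<in> carrier PP" "psi x = \<one>" for x
    using cov.chamber_free[OF that(1) bp_Y] that(2) bp bp_Y by simp
  then have "kernel PP HH psi = {\<one>\<^bsub>PP\<^esub>}" using group_hom.hom_one[OF gh] by (auto simp: kernel_def)
  then have "inj_on psi (carrier PP)" using group_hom.inj_iff_trivial_ker[OF gh] by simp
  then show ?thesis using psi_hom psi_surj by (simp add: iso_def bij_betw_def)
qed

lemma periagroup_basis: "periagroup_with_basis HH BB"
  unfolding periagroup_with_basis_def
proof (intro conjI ballI)
  show "group HH" by (rule HH_group)
  show "subgroup B HH" if "B \<in> BB" for B using BB_subgroup[OF that] .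
  show "B \<noteq> {\<one>\<^bsub>HH\<^esub>}" if "B \<in> BB" for B using that R_nontrivial[OF TT_\<J>] by (fastforce simp: BB_def)
  show "\<exists>lab \<psi>. periagroup_data (basis_graph HH BB) lab (sub_group HH) \<and>
       \<psi> \<in> iso (periagroup (basis_graph HH BB) lab (sub_group HH)) HH \<and>
       (\<forall>B\<in>BB. \<forall>b\<in>B. \<psi> (periagroup_gen (basis_graph HH BB) lab (sub_group HH) B b) = b)"
  proof (rule exI[of _ lab], rule exI[of _ psi], intro conjI ballI)
    show "periagroup_data (basis_graph HH BB) lab (sub_group HH)" using Gam_data by (simp add: Gam_def)
    show "psi \<in> iso (periagroup (basis_graph HH BB) lab (sub_group HH)) HH"
      using psi_iso by (simp add: PP_def Gam_def)
    show "psi (periagroup_gen (basis_graph HH BB) lab (sub_group HH) B b) = b" if "B \<in> BB" "b \<in> B" for B b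
      using psi_gen that by (auto simp: BB_def gen_def Gam_def)
  qed
qed

section \<open>The stabiliser of the chamber as a complement of the rotation group\<close>

lemma stab_iff: "g \<in> set_stab G \<phi> Y \<longleftrightarrow> g \<in> carrier G \<and> \<phi> g bp \<in> Y"
proof
  assume "g \<in> set_stab G \<phi> Y"
  then show "g \<in> carrier G \<and> \<phi> g bp \<in> Y" using bp_Y by (auto simp: set_stab_def stabilizer_def)
next
  assume g: "g \<in> carrier G \<and> \<phi> g bp \<in> Y"
  have "\<phi> g ` Y = Y"
  proof
    show "\<phi> g ` Y \<subseteq> Y" using cov.chamber_map[OF _ bp_Y] g Y_V by blast
    show "Y \<subseteq> \<phi> g ` Y"
    proof
      fix y assume y: "y \<in> Y"
      have "\<phi> (inv g) y \<in> Y" using cov.chamber_map[OF _ bp_Y, of g "\<phi> (inv g) y"] g y Y_V by simp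
      then show "y \<in> \<phi> g ` Y" using act_inv(2)[of g y] g Y_V[OF y] by (metis imageI)
    qed
  qed
  then show "g \<in> set_stab G \<phi> Y" using g by (simp add: set_stab_def stabilizer_def)
qed

lemma semidirect: "internal_semidirect G Rot (set_stab G \<phi> Y)"
  unfolding internal_semidirect_def
proof (intro conjI)
  \<comment> \<open>Conjugation by \<open>g\<close> permutes the rotation groups because
    \<open>\<J>\<close> is invariant, so they generate a normal subgroup.\<close>
  have "g \<otimes> r \<otimes> inv g \<in> (\<Union>J\<in>\<J>. R J)" if "r \<in> (\<Union>J\<in>\<J>. R J)" "g \<in> carrier G" for r g
    using that R_conj act_hact by blast
  then show "Rot \<lhd> G" unfolding Rot_def using normal_generateI[OF gens_G(1)] by blast
  show sub: "subgroup (set_stab G \<phi> Y) G"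
  proof (rule subgroupI)
    show "set_stab G \<phi> Y \<subseteq> carrier G" using stab_iff by blast
    show "set_stab G \<phi> Y \<noteq> {}" using stab_iff[of \<one>] bp bp_Y by auto
    show "inv a \<in> set_stab G \<phi> Y" if "a \<in> set_stab G \<phi> Y" for a
      using that cov.chamber_map[OF _ bp_Y, of a "\<phi> (inv a) bp"] bp bp_Y unfolding stab_iff by simp
    show "a \<otimes> b \<in> set_stab G \<phi> Y" if "a \<in> set_stab G \<phi> Y" "b \<in> set_stab G \<phi> Y" for a b
      using that cov.chamber_map[OF _ bp_Y, of a "\<phi> b bp"] bp act_mult[of a b bp] unfolding stab_iff by simp
  qed
  show "Rot \<inter> set_stab G \<phi> Y = {\<one>}"
  proof
    show "{\<one>} \<subseteq> Rot \<inter> set_stab G \<phi> Y"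
      using subgroup.one_closed[OF sub] subgroup.one_closed[OF Rot_subgroup(1)] by blast
    show "Rot \<inter> set_stab G \<phi> Y \<subseteq> {\<one>}"
    proof
      fix g assume g: "g \<in> Rot \<inter> set_stab G \<phi> Y"
      then obtain x where x: "x \<in> carrier PP" "g = psi x" using psi_surj by blast
      then have "x = \<one>\<^bsub>PP\<^esub>" using cov.chamber_free[OF x(1) bp_Y] g stab_iff by blast
      moreover have "psi \<one>\<^bsub>PP\<^esub> = \<one>" using hom_one[OF psi_hom PP_group HH_group] by simp
      ultimately show "g \<in> {\<one>}" using x by simp
    qed
  qed
  show "Rot <#> set_stab G \<phi> Y = carrier G"
  proof
    show "Rot <#> set_stab G \<phi> Y \<subseteq> carrier G"
      using subgroup.subset[OF Rot_subgroup(1)] subgroup.subset[OF sub] by (auto simp: set_mult_def)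
    show "carrier G \<subseteq> Rot <#> set_stab G \<phi> Y"
    proof
      fix g assume g: "g \<in> carrier G"
      \<comment> \<open>\<open>m\<close> carries \<open>Y\<close> to the chamber of
        \<open>\<phi> g bp\<close>, so \<open>inv m \<otimes> g\<close> stabilises
        \<open>Y\<close>.\<close>
      obtain m y where m: "m \<in> RotT" "y \<in> Y" "\<phi> g bp = \<phi> m y" using RotT_cover[of "\<phi> g bp"] g bp by auto
      have mG: "m \<in> carrier G" using subgroup.mem_carrier[OF Rot_subgroup(2) m(1)] .
      have "\<phi> (inv m \<otimes> g) bp = y" using act_mult[of "inv m" g bp] mG g bp m Y_V by simp
      then have "inv m \<otimes> g \<in> set_stab G \<phi> Y" using stab_iff mG g m(2) by simp
      moreover have "g = m \<otimes> (inv m \<otimes> g)" using mG g by (simp add: m_assoc[symmetric])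
      ultimately show "g \<in> Rot <#> set_stab G \<phi> Y" using m(1) Rot_eq unfolding set_mult_def by blast
    qed
  qed
qed

end

theorem theorem6p1:
  fixes G :: "'g monoid" and X :: "'v sgraph" and \<phi> :: "'g \<Rightarrow> 'v \<Rightarrow> 'v"
    and \<J> :: "'v set set set"
  assumes "group G"
    and "mediangle X"
    and "graph_action G X \<phi>"
    and "\<J> \<subseteq> hyperplanes X"
    and "invariant_collection G \<phi> \<J>"
    and "\<And>J. J \<in> \<J> \<Longrightarrow> permutes_sectors_freely_transitively G X \<phi> J"
  defines "Rot \<equiv> generate G (\<Union>J\<in>\<J>. rot_stab G X \<phi> J)"
  shows "\<exists>Y. convex_subgraph X Y \<and> Y \<noteq> {} \<and>
    internal_semidirect G Rot (set_stab G \<phi> Y) \<and>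
    periagroup_with_basis (G\<lparr>carrier := Rot\<rparr>)
      {rot_stab G X \<phi> J | J. J \<in> hyperplanes X \<and> tangent J Y}"
proof -
  obtain bp where bp: "bp \<in> verts X"
    using assms(2) by (auto simp: mediangle_def connected_graph_def)
  interpret rot_chamber X G \<phi> \<J> bp
    by (intro rot_chamber.intro rot_action.intro mediangle_graph.intro rot_action_axioms.intro
        rot_chamber_axioms.intro assms bp)
  have BB: "BB = {rot_stab G X \<phi> J | J. J \<in> hyperplanes X \<and> tangent J Y}"
    by (auto simp: BB_def TT_def)
  show ?thesis
    using Y_convex bp_Y semidirect periagroup_basis unfolding HH_def BB Rot_def Rot_def[unfolded assms(7)]
    by (intro exI[of _ Y]) (auto simp: assms(7))
qed

end
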